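(* Let $\pi:X\to B$ be a complex elliptic fibration with a section, with generic fiber $E_K$ where $K=\mathbb C(B)$, and let $\{C_t\}_{t\in T}$ be a covering family of movable curves in $B$. Assume that $\mathrm{MW}(X/B)=E_K(K)$ is finitely generated. For a very general $t\in T$, let $h:Z_t=\pi^{-1}(C_t)\to C_t$ be the restricted fibration, with generic fiber $E_F$, where $F=\mathbb C(C_t)$. Then the natural restriction map $$\mathrm{MW}(X/B)=E_K(K)\longrightarrow \mathrm{MW}(Z_t/C_t)=E_F(F)$$ is injective.
   Context: Varieties are complex, normal, projective and irreducible unless otherwise specified. An elliptic fibration is a morphism whose fibers over a dense open set are elliptic curves. $\mathrm{MW}(X/B)$ is the group of rational sections of $\pi$, i.e. the group of rational points of the generic fiber over the function field of the base. A covering family of movable curves is an irreducible subvariety $\mathcal C\subset B\times T$, $T$ an irreducible variety, all of whose fibers $C_t$ over $t\in T$ are irreducible curves in $B$ and such that $\mathcal C\to B$ has dense image. Very general: if $k\subset\mathbb C$ is an algebraically closed subfield and $T$ is a variety over $k$, a point of $T(\mathbb C)$ is very general if it does not lie on any proper $k$-subvariety of $T$ (equivalently it is given by a $k$-embedding of $k(T)$ in $\mathbb C$). Here $k$ is a countable algebraically closed subfield of $\mathbb C$ over which $X$, $B$, $T$, $\pi$ and the family are defined. *)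

theory Defs
  imports
    "HOL-Analysis.Analysis"
    "HOL-Library.Poly_Mapping"
    "HOL-Library.Extended_Nat"
    "HOL-Computational_Algebra.Polynomial"
    "HOL-Algebra.Generated_Groups"
begin

text \<open>
  Classical algebraic geometry over the complex numbers. Varieties are sets of complex points of
  projective spaces; a subfield \<open>k\<close> of the complex numbers enters through forms with coefficients
  in \<open>k\<close>. The case \<open>k = UNIV\<close> is the geometry over the complex numbers themselves.
\<close>

section \<open>Projective space and the Zariski topology\<close>

text \<open>\<open>'n proj\<close> is projective space of dimension \<open>CARD('n) - 1\<close>.\<close>

quotient_type (overloaded) 'n proj = "complex ^ ('n::finite)" / partial:
  "\<lambda>v w. v \<noteq> 0 \<and> w \<noteq> 0 \<and> (\<exists>c. c \<noteq> 0 \<and> w = c *s v)"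
proof (rule part_equivpI)
  show "\<exists>v::complex ^ 'n. v \<noteq> 0 \<and> v \<noteq> 0 \<and> (\<exists>c. c \<noteq> 0 \<and> v = c *s v)"
    by (intro exI[of _ "1 :: complex ^ 'n"] conjI exI[of _ "1::complex"])
       (auto simp: vec_eq_iff)
  show "symp (\<lambda>v w::complex ^ 'n. v \<noteq> 0 \<and> w \<noteq> 0 \<and> (\<exists>c. c \<noteq> 0 \<and> w = c *s v))"
  proof (rule sympI, elim conjE exE, intro conjI)
    fix v w :: "complex ^ 'n" and c assume "c \<noteq> 0" "w = c *s v"
    then show "\<exists>c. c \<noteq> 0 \<and> v = c *s w"
      by (intro exI[of _ "inverse c"]) (simp add: vector_smult_assoc)
  qed auto
  show "transp (\<lambda>v w::complex ^ 'n. v \<noteq> 0 \<and> w \<noteq> 0 \<and> (\<exists>c. c \<noteq> 0 \<and> w = c *s v))"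
  proof (rule transpI, elim conjE exE, intro conjI)
    fix u v w :: "complex ^ 'n" and c d assume "c \<noteq> 0" "v = c *s u" "d \<noteq> 0" "w = d *s v"
    then show "\<exists>c. c \<noteq> 0 \<and> w = c *s u"
      by (intro exI[of _ "d * c"]) (simp add: vector_smult_assoc)
  qed auto
qed

text \<open>\<open>rep_proj p\<close> is a choice of homogeneous coordinates of \<open>p\<close>, and \<open>abs_proj v\<close> is the point with
  homogeneous coordinates \<open>v \<noteq> 0\<close>.\<close>

type_synonym 'n mpoly = "('n \<Rightarrow>\<^sub>0 nat) \<Rightarrow>\<^sub>0 complex"

definition eval_mpoly :: "('n::finite) mpoly \<Rightarrow> complex ^ 'n \<Rightarrow> complex" where
  "eval_mpoly P v =
     (\<Sum>m\<in>Poly_Mapping.keys P.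
        Poly_Mapping.lookup P m * (\<Prod>i\<in>UNIV. (v $ i) ^ Poly_Mapping.lookup m i))"

text \<open>Forms of degree \<open>d\<close> with coefficients in \<open>k\<close> (the zero form included).\<close>

definition forms :: "complex set \<Rightarrow> nat \<Rightarrow> ('n::finite) mpoly set" where
  "forms k d = {P. (\<forall>m\<in>Poly_Mapping.keys P. (\<Sum>i\<in>UNIV. Poly_Mapping.lookup m i) = d)
                 \<and> (\<forall>m. Poly_Mapping.lookup P m \<in> k)}"

text \<open>Whether a form vanishes at a point does not depend on the homogeneous coordinates. The closed
  sets of \<open>zariski k\<close> are the common zero loci of families of forms over \<open>k\<close>, so a closed algebraic
  set is defined over an algebraically closed \<open>k\<close> if and only if it is closed in \<open>zariski k\<close>.\<close>

definition zariski :: "complex set \<Rightarrow> ('n::finite) proj topology" where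
  "zariski k = topology_generated_by
     {{p. eval_mpoly P (rep_proj p) \<noteq> 0} | P. \<exists>d. P \<in> forms k d}"

definition irreducible_subset :: "'a topology \<Rightarrow> 'a set \<Rightarrow> bool" where
  "irreducible_subset \<T> S \<longleftrightarrow> S \<subseteq> topspace \<T> \<and> S \<noteq> {} \<and>
     (\<forall>A B. closedin \<T> A \<and> closedin \<T> B \<and> S \<subseteq> A \<union> B \<longrightarrow> S \<subseteq> A \<or> S \<subseteq> B)"

text \<open>Krull dimension of a topological space.\<close>

definition krull_dim :: "'a topology \<Rightarrow> enat" where
  "krull_dim \<T> = Sup {enat n | n. \<exists>Z :: nat \<Rightarrow> 'a set.
     (\<forall>i\<le>n. closedin \<T> (Z i) \<and> irreducible_subset \<T> (Z i)) \<and> (\<forall>i<n. Z i \<subset> Z (Suc i))}"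

text \<open>Products carry the structure given by the Segre embedding.\<close>

definition segre :: "('n::finite) proj \<Rightarrow> ('m::finite) proj \<Rightarrow> ('n \<times> 'm) proj" where
  "segre p q = abs_proj (\<chi> ij. rep_proj p $ fst ij * rep_proj q $ snd ij)"

definition segre_image :: "(('n::finite) proj \<times> ('m::finite) proj) set \<Rightarrow> ('n \<times> 'm) proj set" where
  "segre_image S = (\<lambda>(p, q). segre p q) ` S"

section \<open>Varieties and morphisms\<close>

definition projective_variety :: "('n::finite) proj set \<Rightarrow> bool" where
  "projective_variety V \<longleftrightarrow> closedin (zariski UNIV) V \<and> irreducible_subset (zariski UNIV) V"

definition locally_closed :: "complex set \<Rightarrow> ('n::finite) proj set \<Rightarrow> bool" where
  "locally_closed k V \<longleftrightarrow> (\<exists>Z W. closedin (zariski k) Z \<and> openin (zariski k) W \<and> V = Z \<inter> W)"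

definition irreducible_curve :: "('n::finite) proj set \<Rightarrow> bool" where
  "irreducible_curve C \<longleftrightarrow> projective_variety C \<and> krull_dim (subtopology (zariski UNIV) C) = 1"

definition regular_fun :: "('n::finite) proj set \<Rightarrow> ('n proj \<Rightarrow> complex) \<Rightarrow> bool" where
  "regular_fun S f \<longleftrightarrow> (\<forall>p\<in>S. \<exists>N d. \<exists>P\<in>forms UNIV d. \<exists>Q\<in>forms UNIV d.
     openin (zariski UNIV) N \<and> p \<in> N \<and>
     (\<forall>x\<in>S \<inter> N. eval_mpoly Q (rep_proj x) \<noteq> 0 \<and>
                 f x = eval_mpoly P (rep_proj x) / eval_mpoly Q (rep_proj x)))"

text \<open>\<open>V\<close> is normal if each local ring is integrally closed in the function field: a rational function
  \<open>f\<close>, regular on some nonempty open \<open>U\<close>, that satisfies a monic equation with coefficients \<open>a i\<close>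
  regular near \<open>p\<close>, is itself regular near \<open>p\<close>.\<close>

definition normal_variety :: "('n::finite) proj set \<Rightarrow> bool" where
  "normal_variety V \<longleftrightarrow>
    (\<forall>p\<in>V. \<forall>U f W n a.
       openin (subtopology (zariski UNIV) V) U \<and> U \<noteq> {} \<and> regular_fun U f \<and>
       openin (subtopology (zariski UNIV) V) W \<and> p \<in> W \<and> n > 0 \<and>
       (\<forall>i<n. regular_fun W (a i)) \<and>
       (\<forall>x\<in>U \<inter> W. f x ^ n + (\<Sum>i<n. a i x * f x ^ i) = 0) \<longrightarrow>
       (\<exists>W' g. openin (subtopology (zariski UNIV) V) W' \<and> p \<in> W' \<and> regular_fun W' g \<and>
               (\<forall>x\<in>U \<inter> W'. g x = f x)))"

text \<open>Morphisms, given locally by forms of equal degree with coefficients in \<open>k\<close>. Values outside \<open>S\<close>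
  are irrelevant.\<close>

definition morphism_over ::
  "complex set \<Rightarrow> ('n::finite) proj set \<Rightarrow> ('m::finite) proj set \<Rightarrow> ('n proj \<Rightarrow> 'm proj) \<Rightarrow> bool" where
  "morphism_over k S W f \<longleftrightarrow> f ` S \<subseteq> W \<and>
     (\<forall>p\<in>S. \<exists>N d P. openin (zariski k) N \<and> p \<in> N \<and> (\<forall>j. P j \<in> forms k d) \<and>
        (\<forall>x\<in>S \<inter> N. (\<chi> j. eval_mpoly (P j) (rep_proj x)) \<noteq> 0 \<and>
                    f x = abs_proj (\<chi> j. eval_mpoly (P j) (rep_proj x))))"

section \<open>Elliptic curves and elliptic fibrations\<close>

text \<open>An elliptic curve is a one-dimensional abelian variety, that is, a complete irreducible curve with
  the structure of an algebraic group (smoothness and genus one are then automatic). The group law is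
  determined by its origin.\<close>

definition elliptic_group_law ::
  "('n::finite) proj set \<Rightarrow> 'n proj \<Rightarrow> ('n proj \<Rightarrow> 'n proj \<Rightarrow> 'n proj) \<Rightarrow> bool" where
  "elliptic_group_law E p0 m \<longleftrightarrow>
     irreducible_curve E \<and>
     group \<lparr>carrier = E, monoid.mult = m, one = p0\<rparr> \<and>
     (\<exists>M. morphism_over UNIV (segre_image (E \<times> E)) E M \<and>
          (\<forall>p\<in>E. \<forall>q\<in>E. M (segre p q) = m p q)) \<and>
     morphism_over UNIV E E (m_inv \<lparr>carrier = E, monoid.mult = m, one = p0\<rparr>)"

definition elliptic_curve :: "('n::finite) proj set \<Rightarrow> bool" where
  "elliptic_curve E \<longleftrightarrow> (\<exists>p0 m. elliptic_group_law E p0 m)"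

definition fiber :: "'a set \<Rightarrow> ('a \<Rightarrow> 'b) \<Rightarrow> 'b \<Rightarrow> 'a set" where
  "fiber X \<pi> b = {x \<in> X. \<pi> x = b}"

definition elliptic_fibration ::
  "('x::finite) proj set \<Rightarrow> ('b::finite) proj set \<Rightarrow> ('x proj \<Rightarrow> 'b proj) \<Rightarrow> bool" where
  "elliptic_fibration X B \<pi> \<longleftrightarrow> morphism_over UNIV X B \<pi> \<and>
     (\<exists>U. openin (subtopology (zariski UNIV) B) U \<and> B \<subseteq> (zariski UNIV) closure_of U \<and>
          (\<forall>b\<in>U. elliptic_curve (fiber X \<pi> b)))"

section \<open>Rational sections and the Mordell--Weil group\<close>

text \<open>A rational section is an equivalence class of sections over nonempty open subsets of the
  irreducible base, two being identified when they agree on the common domain. These classes are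
  the points of the generic fiber over the function field of the base.\<close>

definition local_sections ::
  "('x::finite) proj set \<Rightarrow> ('b::finite) proj set \<Rightarrow> ('x proj \<Rightarrow> 'b proj) \<Rightarrow>
   ('b proj set \<times> ('b proj \<Rightarrow> 'x proj)) set" where
  "local_sections X B \<pi> = {(U, s). openin (subtopology (zariski UNIV) B) U \<and> U \<noteq> {} \<and>
     morphism_over UNIV U X s \<and> (\<forall>b\<in>U. \<pi> (s b) = b)}"

definition section_rel ::
  "('x::finite) proj set \<Rightarrow> ('b::finite) proj set \<Rightarrow> ('x proj \<Rightarrow> 'b proj) \<Rightarrow>
   ('b proj set \<times> ('b proj \<Rightarrow> 'x proj)) rel" where
  "section_rel X B \<pi> = {((U, s), (U', s')). (U, s) \<in> local_sections X B \<pi> \<and>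
     (U', s') \<in> local_sections X B \<pi> \<and> (\<forall>b\<in>U \<inter> U'. s b = s' b)}"

type_synonym ('x, 'b) ratsec = "('b proj set \<times> ('b proj \<Rightarrow> 'x proj)) set"

definition rational_sections ::
  "('x::finite) proj set \<Rightarrow> ('b::finite) proj set \<Rightarrow> ('x proj \<Rightarrow> 'b proj) \<Rightarrow> ('x, 'b) ratsec set"
  where "rational_sections X B \<pi> = local_sections X B \<pi> // section_rel X B \<pi>"

text \<open>\<open>\<rho>\<close> is the sum of \<open>\<sigma>\<close> and \<open>\<tau>\<close> with respect to the origin \<open>\<omega>\<close> if it is so in the elliptic curves
  \<open>fiber X \<pi> b\<close> for all \<open>b\<close> in a nonempty open set.\<close>

definition is_section_sum ::
  "('x::finite) proj set \<Rightarrow> ('b::finite) proj set \<Rightarrow> ('x proj \<Rightarrow> 'b proj) \<Rightarrow>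
   ('x, 'b) ratsec \<Rightarrow> ('x, 'b) ratsec \<Rightarrow> ('x, 'b) ratsec \<Rightarrow> ('x, 'b) ratsec \<Rightarrow> bool" where
  "is_section_sum X B \<pi> \<omega> \<sigma> \<tau> \<rho> \<longleftrightarrow>
     (\<exists>U z s t r. (U, z) \<in> \<omega> \<and> (U, s) \<in> \<sigma> \<and> (U, t) \<in> \<tau> \<and> (U, r) \<in> \<rho> \<and>
        (\<forall>b\<in>U. \<exists>m. elliptic_group_law (fiber X \<pi> b) (z b) m \<and> r b = m (s b) (t b)))"

definition MW ::
  "('x::finite) proj set \<Rightarrow> ('b::finite) proj set \<Rightarrow> ('x proj \<Rightarrow> 'b proj) \<Rightarrow> ('x, 'b) ratsec \<Rightarrow>
   ('x, 'b) ratsec monoid" where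
  "MW X B \<pi> \<omega> =
     \<lparr>carrier = rational_sections X B \<pi>,
      monoid.mult = (\<lambda>\<sigma> \<tau>. THE \<rho>. \<rho> \<in> rational_sections X B \<pi> \<and> is_section_sum X B \<pi> \<omega> \<sigma> \<tau> \<rho>),
      one = \<omega>\<rparr>"

definition finitely_generated_group :: "('a, 'r) monoid_scheme \<Rightarrow> bool" where
  "finitely_generated_group G \<longleftrightarrow> (\<exists>S. finite S \<and> S \<subseteq> carrier G \<and> generate G S = carrier G)"

text \<open>Restriction to \<open>C\<close> of a rational section: restrict any representative whose domain meets \<open>C\<close>.
  If there is none, the result is empty, hence not a rational section over \<open>C\<close>.\<close>

definition restrict_section ::
  "('x::finite) proj set \<Rightarrow> ('b::finite) proj set \<Rightarrow> ('x proj \<Rightarrow> 'b proj) \<Rightarrow>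
   ('x, 'b) ratsec \<Rightarrow> ('x, 'b) ratsec" where
  "restrict_section Z C \<pi> \<sigma> =
     (\<Union>(U, s)\<in>{(U, s) \<in> \<sigma>. U \<inter> C \<noteq> {}}. section_rel Z C \<pi> `` {(U \<inter> C, s)})"

section \<open>Families of curves and very general points\<close>

definition family_member :: "('b \<times> 't) set \<Rightarrow> 't \<Rightarrow> 'b set" where
  "family_member \<C> t = {b. (b, t) \<in> \<C>}"

definition covering_family ::
  "('b::finite) proj set \<Rightarrow> ('t::finite) proj set \<Rightarrow> ('b proj \<times> 't proj) set \<Rightarrow> bool" where
  "covering_family B T \<C> \<longleftrightarrow>
     \<C> \<subseteq> B \<times> T \<and>
     closedin (subtopology (zariski UNIV) (segre_image (B \<times> T))) (segre_image \<C>) \<and>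
     irreducible_subset (zariski UNIV) (segre_image \<C>) \<and>
     (\<forall>t\<in>T. irreducible_curve (family_member \<C> t)) \<and>
     B \<subseteq> (zariski UNIV) closure_of (fst ` \<C>)"

definition algebraically_closed_subfield :: "complex set \<Rightarrow> bool" where
  "algebraically_closed_subfield k \<longleftrightarrow>
     0 \<in> k \<and> 1 \<in> k \<and>
     (\<forall>x\<in>k. \<forall>y\<in>k. x + y \<in> k \<and> x * y \<in> k) \<and> (\<forall>x\<in>k. - x \<in> k \<and> inverse x \<in> k) \<and>
     (\<forall>p :: complex poly. (\<forall>i. coeff p i \<in> k) \<and> degree p > 0 \<longrightarrow> (\<exists>x\<in>k. poly p x = 0))"

definition very_general :: "complex set \<Rightarrow> ('t::finite) proj set \<Rightarrow> 't proj \<Rightarrow> bool" where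
  "very_general k T t \<longleftrightarrow> t \<in> T \<and>
     (\<forall>Z. closedin (subtopology (zariski k) T) Z \<and> Z \<noteq> T \<longrightarrow> t \<notin> Z)"

end

theory Submission
  imports
    Defs
    "HOL-Computational_Algebra.Fundamental_Theorem_Algebra"
    "HOL-Library.Function_Algebras"
begin

text \<open>
  The group \<open>Aut(\<complex>/k)\<close> acts on the points of all varieties over \<open>k\<close>, on the sections of \<open>\<pi>\<close> over open sets
  and on the set of elliptic fibers, and it permutes the very general points of \<open>T\<close> transitively. As the
  Mordell--Weil group is countable, two given sections have countably many conjugates, represented by
  automorphisms \<open>g\<^sub>i\<close>. Let \<open>W\<close> be a nonempty open set on which the two sections are defined and distinct (or
  the fibers elliptic). A point \<open>(b, t')\<close> of the family that is generic over a countable field containing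
  equations for all complements of \<open>g\<^sub>i W\<close> has \<open>b \<in> g\<^sub>i W\<close> for all \<open>i\<close> and \<open>t'\<close> very general, hence \<open>t' = g t\<close> for
  some automorphism \<open>g\<close>. If \<open>g\<close> and \<open>g\<^sub>i\<close> have the same effect on the sections, then \<open>g\<inverse> g\<^sub>i\<close> fixes both of
  them and \<open>g\<inverse> b\<close> is a point of \<open>C\<^sub>t\<close> in \<open>g\<inverse> g\<^sub>i W\<close>. So both sections are defined at some point of \<open>C\<^sub>t\<close>, and
  they are distinct there.
\<close>

section \<open>Partial isomorphisms with the complex numbers\<close>

text \<open>The obstacle is that the sections, their domains and the locus of elliptic fibers are
  given over \<complex>, whereas \<open>t\<close> is very general only over \<open>k\<close>:
  nothing known about the given \<open>W\<close> prevents it from missing the curve over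
  \<open>t\<close>. The way out is a change of representatives. A conjugate section in the same
  class is another representative, and restriction can be computed from any representative whose
  domain meets the curve. Injectivity is tested on pairs of distinct sections, so a difference at
  one point of the curve suffices. Automorphisms of \<complex> and generic points have a common
  origin, the extension of an isomorphism between a subring of \<open>A / I\<close> and a subring of
  \<complex>. With \<open>A\<close> = \<complex> and \<open>I\<close> = 0 it yields automorphisms;
  with \<open>A\<close> the functions on an affine chart of the family and \<open>I\<close> those
  vanishing on it, it yields complex points generic over a countable ring. Subrings, graphs and
  pseudo-division replace subfields, maps and division, so that neither fractions nor quotient rings
  have to be formed.\<close>

text \<open>A homomorphism between subrings is represented by its graph, a subring of the product. The left ring
  carries a prime ideal \<open>I\<close>, so that a partial isomorphism is one between a subring of \<open>A / I\<close> and a subring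
  of the complex numbers.\<close>

definition ring_rel :: "('a::comm_ring_1 \<times> complex) set \<Rightarrow> bool" where
  "ring_rel \<Gamma> \<longleftrightarrow> (1, 1) \<in> \<Gamma> \<and>
     (\<forall>a b c d. (a, b) \<in> \<Gamma> \<longrightarrow> (c, d) \<in> \<Gamma> \<longrightarrow> (a - c, b - d) \<in> \<Gamma> \<and> (a * c, b * d) \<in> \<Gamma>)"

lemma ring_rel_one: "ring_rel \<Gamma> \<Longrightarrow> (1, 1) \<in> \<Gamma>"
  and ring_rel_diff: "ring_rel \<Gamma> \<Longrightarrow> (a, b) \<in> \<Gamma> \<Longrightarrow> (c, d) \<in> \<Gamma> \<Longrightarrow> (a - c, b - d) \<in> \<Gamma>"
  and ring_rel_mult: "ring_rel \<Gamma> \<Longrightarrow> (a, b) \<in> \<Gamma> \<Longrightarrow> (c, d) \<in> \<Gamma> \<Longrightarrow> (a * c, b * d) \<in> \<Gamma>"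
  unfolding ring_rel_def by blast+

lemma ring_rel_zero: "ring_rel \<Gamma> \<Longrightarrow> (0, 0) \<in> \<Gamma>"
  using ring_rel_diff[OF _ ring_rel_one ring_rel_one] by fastforce

lemma ring_rel_uminus: "ring_rel \<Gamma> \<Longrightarrow> (a, b) \<in> \<Gamma> \<Longrightarrow> (- a, - b) \<in> \<Gamma>"
  using ring_rel_diff[OF _ ring_rel_zero, of \<Gamma> a b] by fastforce

lemma ring_rel_add: "ring_rel \<Gamma> \<Longrightarrow> (a, b) \<in> \<Gamma> \<Longrightarrow> (c, d) \<in> \<Gamma> \<Longrightarrow> (a + c, b + d) \<in> \<Gamma>"
  using ring_rel_diff[OF _ _ ring_rel_uminus, of \<Gamma> a b c d] by fastforce

lemma ring_rel_sum:
  assumes "ring_rel \<Gamma>" and "\<And>i. i \<in> N \<Longrightarrow> (f i, g i) \<in> \<Gamma>"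
  shows "(sum f N, sum g N) \<in> \<Gamma>"
  using assms(2) by (induction N rule: infinite_finite_induct)
    (auto intro: ring_rel_zero ring_rel_add assms(1))

lemma ring_rel_power: "ring_rel \<Gamma> \<Longrightarrow> (a, b) \<in> \<Gamma> \<Longrightarrow> (a ^ n, b ^ n) \<in> \<Gamma>"
  by (induction n) (auto intro: ring_rel_one ring_rel_mult)

lemma ring_rel_prod:
  assumes "ring_rel \<Gamma>" and "\<And>i. i \<in> N \<Longrightarrow> (f i, g i) \<in> \<Gamma>"
  shows "(prod f N, prod g N) \<in> \<Gamma>"
  using assms(2) by (induction N rule: infinite_finite_induct)
    (auto intro: ring_rel_one ring_rel_mult assms(1))

text \<open>The coefficientwise extension of the graph. Related polynomials may have different
  degrees: a coefficient on the left can be nonzero and yet lie in the ideal, and then its partner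
  is 0.\<close>

definition polys :: "('a::comm_ring_1 \<times> complex) set \<Rightarrow> ('a poly \<times> complex poly) set" where
  "polys \<Gamma> = {(p, q). \<forall>i. (coeff p i, coeff q i) \<in> \<Gamma>}"

text \<open>The only candidate for an extension that sends \<open>x\<close> to \<open>y\<close>. It
  is a ring relation for every \<open>y\<close>; only a suitable \<open>y\<close> makes it
  single-valued and injective modulo the ideal.\<close>

definition adjoin ::
  "('a::comm_ring_1 \<times> complex) set \<Rightarrow> 'a \<Rightarrow> complex \<Rightarrow> ('a \<times> complex) set" where
  "adjoin \<Gamma> x y = (\<lambda>(p, q). (poly p x, poly q y)) ` polys \<Gamma>"

context
  fixes \<Gamma> :: "('a::comm_ring_1 \<times> complex) set"
  assumes rr: "ring_rel \<Gamma>"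
begin

lemma polys_const: "(a, b) \<in> \<Gamma> \<Longrightarrow> ([:a:], [:b:]) \<in> polys \<Gamma>"
  using ring_rel_zero[OF rr] by (auto simp: polys_def coeff_pCons split: nat.split)

lemma polys_pCons: "(a, b) \<in> \<Gamma> \<Longrightarrow> (p, q) \<in> polys \<Gamma> \<Longrightarrow> (pCons a p, pCons b q) \<in> polys \<Gamma>"
  by (auto simp: polys_def coeff_pCons split: nat.split)

lemma polys_diff: "(p, q) \<in> polys \<Gamma> \<Longrightarrow> (p', q') \<in> polys \<Gamma> \<Longrightarrow> (p - p', q - q') \<in> polys \<Gamma>"
  by (auto simp: polys_def intro: ring_rel_diff[OF rr])

lemma polys_add: "(p, q) \<in> polys \<Gamma> \<Longrightarrow> (p', q') \<in> polys \<Gamma> \<Longrightarrow> (p + p', q + q') \<in> polys \<Gamma>"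
  by (auto simp: polys_def intro: ring_rel_add[OF rr])

lemma polys_mult: "(p, q) \<in> polys \<Gamma> \<Longrightarrow> (p', q') \<in> polys \<Gamma> \<Longrightarrow> (p * p', q * q') \<in> polys \<Gamma>"
  by (auto simp: polys_def coeff_mult intro!: ring_rel_sum[OF rr] ring_rel_mult[OF rr])

lemma polys_smult: "(a, b) \<in> \<Gamma> \<Longrightarrow> (p, q) \<in> polys \<Gamma> \<Longrightarrow> (smult a p, smult b q) \<in> polys \<Gamma>"
  by (auto simp: polys_def intro!: ring_rel_mult[OF rr])

lemma polys_monom: "(a, b) \<in> \<Gamma> \<Longrightarrow> (monom a n, monom b n) \<in> polys \<Gamma>"
  using ring_rel_zero[OF rr] by (auto simp: polys_def)

lemma polys_coeff: "(p, q) \<in> polys \<Gamma> \<Longrightarrow> (coeff p i, coeff q i) \<in> \<Gamma>"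
  by (auto simp: polys_def)

lemma subset_adjoin: "\<Gamma> \<subseteq> adjoin \<Gamma> x y"
proof (clarify)
  fix a b assume "(a, b) \<in> \<Gamma>"
  from polys_const[OF this] show "(a, b) \<in> adjoin \<Gamma> x y"
    by (force simp: adjoin_def)
qed

lemma mem_adjoin: "(x, y) \<in> adjoin \<Gamma> x y"
proof -
  have "([:0, 1:], [:0, 1:]) \<in> polys \<Gamma>"
    by (intro polys_pCons polys_const ring_rel_zero[OF rr] ring_rel_one[OF rr])
  then show ?thesis by (force simp: adjoin_def)
qed

lemma ring_rel_adjoin: "ring_rel (adjoin \<Gamma> x y)"
  unfolding ring_rel_def
proof (intro conjI allI impI)
  show "(1, 1) \<in> adjoin \<Gamma> x y"
    using subset_adjoin ring_rel_one[OF rr] by blast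
next
  fix a b c d assume "(a, b) \<in> adjoin \<Gamma> x y" "(c, d) \<in> adjoin \<Gamma> x y"
  then obtain p q p' q' where pq: "(p, q) \<in> polys \<Gamma>" "a = poly p x" "b = poly q y"
    and pq': "(p', q') \<in> polys \<Gamma>" "c = poly p' x" "d = poly q' y"
    by (auto simp: adjoin_def)
  show "(a - c, b - d) \<in> adjoin \<Gamma> x y" using polys_diff[OF pq(1) pq'(1)] pq pq'
    by (force simp: adjoin_def)
  show "(a * c, b * d) \<in> adjoin \<Gamma> x y" using polys_mult[OF pq(1) pq'(1)] pq pq'
    by (force simp: adjoin_def)
qed

text \<open>The degree is controlled in the second component only: the coefficients in the first one matter
  only modulo an ideal.\<close>

lemma pseudo_division:
  assumes pq: "(p, q) \<in> polys \<Gamma>" and "q \<noteq> 0" and "(f, g) \<in> polys \<Gamma>"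
  shows "\<exists>c c' h h' r r'. (c, c') \<in> \<Gamma> \<and> c' \<noteq> 0 \<and> (h, h') \<in> polys \<Gamma> \<and> (r, r') \<in> polys \<Gamma> \<and>
    smult c f = p * h + r \<and> smult c' g = q * h' + r' \<and> (r' = 0 \<or> degree r' < degree q)"
  using assms(3)
\<comment> \<open>The measure separates 0 from the nonzero constants, so that a drop from degree 0
  to the zero polynomial counts as well.\<close>
proof (induction "if g = 0 then 0 else Suc (degree g)" arbitrary: f g rule: less_induct)
  case less
  show ?case
  proof (cases "g = 0 \<or> degree g < degree q")
    case True
    then show ?thesis using less.prems
      by (intro exI[of _ 1] exI[of _ "1::complex"] exI[of _ "0::'a poly"] exI[of _ "0::complex poly"]
            exI[of _ f] exI[of _ g])
        (auto simp: ring_rel_one[OF rr] ring_rel_zero[OF rr] polys_def)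
  next
    case False
    define n where "n = degree g - degree q"
    \<comment> \<open>\<open>u\<close> is the partner of \<open>lead_coeff q\<close> and
      \<open>v\<close> that of \<open>lead_coeff g\<close>; on the left neither has to be a leading
      coefficient.\<close>
    define u where "u = coeff p (degree q)"
    define v where "v = coeff f (degree g)"
    define f1 where "f1 = smult u f - p * monom v n"
    define g1 where "g1 = smult (lead_coeff q) g - q * monom (lead_coeff g) n"
    have u: "(u, lead_coeff q) \<in> \<Gamma>" and v: "(v, lead_coeff g) \<in> \<Gamma>"
      using polys_coeff pq less.prems by (auto simp: u_def v_def)
    have fg1: "(f1, g1) \<in> polys \<Gamma>" unfolding f1_def g1_def
      by (intro polys_diff polys_smult polys_mult polys_monom u v pq less.prems)
    have "g1 = 0 \<or> degree g1 < degree g"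
    proof -
      have "degree (smult (lead_coeff q) g) \<le> degree g" by simp
      moreover have "degree (q * monom (lead_coeff g) n) \<le> degree g"
        using False degree_mult_le[of q "monom (lead_coeff g) n"] degree_monom_le[of "lead_coeff g" n]
        by (auto simp: n_def)
      ultimately have le: "degree g1 \<le> degree g" unfolding g1_def by (rule degree_diff_le)
      have "coeff (q * monom (lead_coeff g) n) (degree g) = lead_coeff q * lead_coeff g"
        using False coeff_mult_degree_sum[of q "monom (lead_coeff g) n"]
        by (simp add: n_def degree_monom_eq)
      then have "coeff g1 (degree g) = 0" by (simp add: g1_def)
      then show ?thesis using le by (metis le_neq_implies_less leading_coeff_0_iff)
    qed
    then have "(if g1 = 0 then 0 else Suc (degree g1)) < (if g = 0 then 0 else Suc (degree g))"
      using False by auto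
    from less.hyps[OF this fg1] obtain c c' h h' r r' where
      IH: "(c, c') \<in> \<Gamma>" "c' \<noteq> 0" "(h, h') \<in> polys \<Gamma>" "(r, r') \<in> polys \<Gamma>"
      "smult c f1 = p * h + r" "smult c' g1 = q * h' + r'" "r' = 0 \<or> degree r' < degree q"
      by blast
    have "smult c f1 = smult (c * u) f - p * smult c (monom v n)"
      by (simp add: f1_def smult_diff_right)
    then have "smult (c * u) f = (p * h + r) + p * smult c (monom v n)"
      unfolding IH(5) by (simp only: eq_diff_eq)
    then have "smult (c * u) f = p * (h + smult c (monom v n)) + r"
      by (simp only: distrib_left ac_simps)
    moreover have "smult c' g1 = smult (c' * lead_coeff q) g - q * smult c' (monom (lead_coeff g) n)"
      by (simp add: g1_def smult_diff_right)
    then have "smult (c' * lead_coeff q) g = (q * h' + r') + q * smult c' (monom (lead_coeff g) n)"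
      unfolding IH(6) by (simp only: eq_diff_eq)
    then have "smult (c' * lead_coeff q) g = q * (h' + smult c' (monom (lead_coeff g) n)) + r'"
      by (simp only: distrib_left ac_simps)
    moreover have "(h + smult c (monom v n), h' + smult c' (monom (lead_coeff g) n)) \<in> polys \<Gamma>"
      by (intro polys_add IH polys_smult polys_monom v)
    moreover have "(c * u, c' * lead_coeff q) \<in> \<Gamma>" by (intro ring_rel_mult[OF rr] IH u)
    moreover have "c' * lead_coeff q \<noteq> 0" using IH \<open>q \<noteq> 0\<close> by simp
    ultimately show ?thesis using IH(4,7)
      by (intro exI[of _ "c * u"] exI[of _ "c' * lead_coeff q"] exI[of _ "h + smult c (monom v n)"]
            exI[of _ "h' + smult c' (monom (lead_coeff g) n)"] exI[of _ r] exI[of _ r'] conjI)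
  qed
qed

lemma countable_polys: "countable \<Gamma> \<Longrightarrow> countable (polys \<Gamma>)"
proof -
  assume "countable \<Gamma>"
  have "\<exists>zs. set zs \<subseteq> \<Gamma> \<and> z = (Poly (map fst zs), Poly (map snd zs))" if "z \<in> polys \<Gamma>" for z
  proof -
    obtain p q where z: "z = (p, q)" by force
    \<comment> \<open>The larger of the two degrees is taken because the components need not have
      the same degree.\<close>
    define zs where "zs = map (\<lambda>i. (coeff p i, coeff q i)) [0..<Suc (max (degree p) (degree q))]"
    have "Poly (map fst zs) = p" "Poly (map snd zs) = q"
      by (auto simp: zs_def poly_eq_iff coeff_Poly_eq nth_default_def coeff_eq_0 less_Suc_eq_le
               simp del: upt_Suc)
    moreover have "set zs \<subseteq> \<Gamma>" using that by (auto simp: zs_def z polys_def)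
    ultimately show ?thesis using z by blast
  qed
  then have "polys \<Gamma> \<subseteq> (\<lambda>zs. (Poly (map fst zs), Poly (map snd zs))) ` lists \<Gamma>"
    by (force simp: lists_eq_set)
  moreover have "countable (lists \<Gamma>)" using \<open>countable \<Gamma>\<close> by blast
  ultimately show ?thesis by (rule countable_subset[OF _ countable_image])
qed

lemma countable_adjoin: "countable \<Gamma> \<Longrightarrow> countable (adjoin \<Gamma> x y)"
  unfolding adjoin_def by (intro countable_image countable_polys)

end

text \<open>\<open>A\<close> and \<open>I\<close> are subsets of a type, so that a coordinate ring
  can be realised as a set of functions. Properness of \<open>I\<close> is implicit in
  \<open>partial_iso\<close>: its graph contains \<open>(1, 1)\<close>, which forces
  \<open>1 \<notin> I\<close>.\<close>

locale prime_ideal_on =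
  fixes A I :: "'a::comm_ring_1 set"
  assumes one_A: "1 \<in> A"
    and diff_A: "a \<in> A \<Longrightarrow> b \<in> A \<Longrightarrow> a - b \<in> A"
    and mult_A: "a \<in> A \<Longrightarrow> b \<in> A \<Longrightarrow> a * b \<in> A"
    and zero_I: "0 \<in> I"
    and diff_I: "a \<in> I \<Longrightarrow> b \<in> I \<Longrightarrow> a - b \<in> I"
    and mult_I: "a \<in> A \<Longrightarrow> b \<in> I \<Longrightarrow> a * b \<in> I"
    and prime: "a \<in> A \<Longrightarrow> b \<in> A \<Longrightarrow> a * b \<in> I \<Longrightarrow> a \<in> I \<or> b \<in> I"
begin

lemma zero_A: "0 \<in> A" using diff_A[OF one_A one_A] by simp

lemma add_A: "a \<in> A \<Longrightarrow> b \<in> A \<Longrightarrow> a + b \<in> A"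
  using diff_A[of a "0 - b"] diff_A[OF zero_A, of b] by simp

lemma add_I: "a \<in> I \<Longrightarrow> b \<in> I \<Longrightarrow> a + b \<in> I"
  using diff_I[of a "0 - b"] diff_I[OF zero_I, of b] by simp

text \<open>Applied to differences of pairs, the equivalence says two things at once: the image
  depends only on the class modulo \<open>I\<close>, and distinct classes have distinct
  images.\<close>

definition partial_iso :: "('a \<times> complex) set \<Rightarrow> bool" where
  "partial_iso \<Gamma> \<longleftrightarrow> ring_rel \<Gamma> \<and> fst ` \<Gamma> \<subseteq> A \<and> (\<forall>a b. (a, b) \<in> \<Gamma> \<longrightarrow> (a \<in> I \<longleftrightarrow> b = 0))"

lemma partial_isoD:
  assumes "partial_iso \<Gamma>"
  shows "ring_rel \<Gamma>" "(a, b) \<in> \<Gamma> \<Longrightarrow> a \<in> A" "(a, b) \<in> \<Gamma> \<Longrightarrow> a \<in> I \<longleftrightarrow> b = 0"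
  using assms unfolding partial_iso_def by force+

text \<open>The condition of being nonzero is put on \<open>q\<close>: a nonzero \<open>p\<close>
  may have all its coefficients in \<open>I\<close> and then expresses nothing modulo
  \<open>I\<close>.\<close>

definition algebraic_over :: "('a \<times> complex) set \<Rightarrow> 'a \<Rightarrow> bool" where
  "algebraic_over \<Gamma> x \<longleftrightarrow> (\<exists>(p, q) \<in> polys \<Gamma>. q \<noteq> 0 \<and> poly p x \<in> I)"

context
  fixes \<Gamma> x
  assumes pi: "partial_iso \<Gamma>" and x: "x \<in> A"
begin

lemma poly_in_A: "(p, q) \<in> polys \<Gamma> \<Longrightarrow> poly p x \<in> A"
proof -
  assume "(p, q) \<in> polys \<Gamma>"
  then have "\<And>i. coeff p i \<in> A" using partial_isoD(2)[OF pi] by (auto simp: polys_def)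
  then show ?thesis
  proof (induction p)
    case (pCons a p)
    have "a \<in> A" using pCons.prems[of 0] by simp
    moreover have "coeff p i \<in> A" for i using pCons.prems[of "Suc i"] by simp
    ultimately show ?case using pCons.IH by (auto intro!: add_A mult_A x)
  qed (auto simp: zero_A)
qed

lemma poly_in_I: "(p, 0) \<in> polys \<Gamma> \<Longrightarrow> poly p x \<in> I"
proof -
  assume "(p, 0) \<in> polys \<Gamma>"
  then have "\<And>i. coeff p i \<in> I" using partial_isoD(3)[OF pi] by (auto simp: polys_def)
  then show ?thesis
  proof (induction p)
    case (pCons a p)
    have "a \<in> I" using pCons.prems[of 0] by simp
    moreover have "coeff p i \<in> I" for i using pCons.prems[of "Suc i"] by simp
    ultimately show ?case using pCons.IH by (auto intro!: add_I mult_I x)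
  qed (auto simp: zero_I)
qed

lemma partial_iso_adjoinI:
  assumes "\<And>f g. (f, g) \<in> polys \<Gamma> \<Longrightarrow> poly f x \<in> I \<longleftrightarrow> poly g y = 0"
  shows "partial_iso (adjoin \<Gamma> x y)"
  unfolding partial_iso_def
  using ring_rel_adjoin[OF partial_isoD(1)[OF pi]] assms poly_in_A by (auto simp: adjoin_def)

text \<open>Both sides of the criterion \<open>partial_iso_adjoinI\<close> hold for a pair with
  \<open>g = 0\<close> and fail for every other pair.\<close>

lemma adjoin_transcendental:
  assumes "\<not> algebraic_over \<Gamma> x"
    and y: "\<And>f g. (f, g) \<in> polys \<Gamma> \<Longrightarrow> g \<noteq> 0 \<Longrightarrow> poly g y \<noteq> 0"
  shows "partial_iso (adjoin \<Gamma> x y)"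
proof (rule partial_iso_adjoinI)
  fix f g assume fg: "(f, g) \<in> polys \<Gamma>"
  show "poly f x \<in> I \<longleftrightarrow> poly g y = 0"
    using assms(1) y[OF fg] poly_in_I fg by (cases "g = 0") (auto simp: algebraic_over_def)
qed

text \<open>The image \<open>y\<close> is a root of a relation \<open>q\<close> of least degree
  satisfied by \<open>x\<close>. Relations of \<open>x\<close> pass to \<open>y\<close> because the
  remainder of a pseudo-division by \<open>q\<close> would be a relation of lower degree. For the
  converse the division is by a relation of least degree at \<open>y\<close>, and primality of
  \<open>I\<close> takes the place of irreducibility of a minimal polynomial.\<close>

lemma adjoin_algebraic:
  assumes "algebraic_over \<Gamma> x"
  shows "\<exists>y. partial_iso (adjoin \<Gamma> x y)"
proof -
  note rr = partial_isoD(1)[OF pi]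
  define P where "P = (\<lambda>(p, q). (p, q) \<in> polys \<Gamma> \<and> q \<noteq> 0 \<and> poly p x \<in> I)"
  obtain z where "P z" using assms by (auto simp: P_def algebraic_over_def)
  then have "\<exists>z. P z \<and> (\<forall>z'. P z' \<longrightarrow> degree (snd z) \<le> degree (snd z'))"
    by (rule ex_has_least_nat)
  then obtain p q where
    "P (p, q)" and "\<And>p' q'. P (p', q') \<Longrightarrow> degree q \<le> degree q'"
    by (metis snd_conv surj_pair)
  then have pq: "(p, q) \<in> polys \<Gamma>" "q \<noteq> 0" "poly p x \<in> I"
    and min: "\<And>p' q'. (p', q') \<in> polys \<Gamma> \<Longrightarrow> q' \<noteq> 0 \<Longrightarrow> poly p' x \<in> I \<Longrightarrow> degree q \<le> degree q'"
    by (auto simp: P_def)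
  \<comment> \<open>If \<open>q\<close> were constant, \<open>p\<close> would differ from its
    constant coefficient by a polynomial with coefficients in \<open>I\<close>; this coefficient
    would then lie in \<open>I\<close>, although its partner is nonzero.\<close>
  have "degree q \<noteq> 0"
  proof
    assume "degree q = 0"
    then have q: "q = [:coeff q 0:]" by (metis degree_0_id)
    have c: "(coeff p 0, coeff q 0) \<in> \<Gamma>" by (rule polys_coeff[OF rr pq(1)])
    have "(p - [:coeff p 0:], 0) \<in> polys \<Gamma>"
      using polys_diff[OF rr pq(1) polys_const[OF rr c]] q by simp
    from diff_I[OF pq(3) poly_in_I[OF this]] have "coeff p 0 \<in> I" by simp
    then show False using partial_isoD(3)[OF pi c] pq(2) q by auto
  qed
  then have "\<not> constant (poly q)" by (simp add: constant_degree)
  from fundamental_theorem_of_algebra[OF this] obtain y where y: "poly q y = 0" by blast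
  have up: "poly g y = 0" if fg: "(f, g) \<in> polys \<Gamma>" and f: "poly f x \<in> I" for f g
  proof -
    obtain c c' h h' r r' where d: "(c, c') \<in> \<Gamma>" "c' \<noteq> 0" "(h, h') \<in> polys \<Gamma>" "(r, r') \<in> polys \<Gamma>"
      "smult c f = p * h + r" "smult c' g = q * h' + r'" "r' = 0 \<or> degree r' < degree q"
      using pseudo_division[OF rr pq(1,2) fg] by blast
    have "poly r x = c * poly f x - poly h x * poly p x"
      using arg_cong[OF d(5), of "\<lambda>s. poly s x"] by (simp add: algebra_simps)
    also have "\<dots> \<in> I"
      by (intro diff_I mult_I f pq(3) partial_isoD(2)[OF pi d(1)] poly_in_A[OF d(3)])
    finally have "r' = 0" using min[OF d(4)] d(7) by (meson not_less)
    then have "c' * poly g y = 0"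
      using arg_cong[OF d(6), of "\<lambda>s. poly s y"] y by simp
    then show ?thesis using d(2) by simp
  qed
  have down: "poly f x \<in> I" if fg: "(f, g) \<in> polys \<Gamma>" and g: "poly g y = 0" for f g
  proof -
    define Q where "Q = (\<lambda>(p, q). (p, q) \<in> polys \<Gamma> \<and> q \<noteq> 0 \<and> poly q y = 0)"
    have "Q (p, q)" using pq y by (auto simp: Q_def)
    then have "\<exists>z. Q z \<and> (\<forall>z'. Q z' \<longrightarrow> degree (snd z) \<le> degree (snd z'))"
      by (rule ex_has_least_nat)
    then obtain f1 g1 where
      "Q (f1, g1)" and "\<And>p' q'. Q (p', q') \<Longrightarrow> degree g1 \<le> degree q'"
      by (metis snd_conv surj_pair)
    then have fg1: "(f1, g1) \<in> polys \<Gamma>" "g1 \<noteq> 0" "poly g1 y = 0"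
      and min1: "\<And>p' q'. (p', q') \<in> polys \<Gamma> \<Longrightarrow> q' \<noteq> 0 \<Longrightarrow> poly q' y = 0 \<Longrightarrow> degree g1 \<le> degree q'"
      by (auto simp: Q_def)
    have key: "\<exists>c c' h h'. (c, c') \<in> \<Gamma> \<and> c' \<noteq> 0 \<and> (h, h') \<in> polys \<Gamma> \<and>
        c * poly f2 x - poly f1 x * poly h x \<in> I \<and> smult c' g2 = g1 * h'"
      if fg2: "(f2, g2) \<in> polys \<Gamma>" and g2: "poly g2 y = 0" for f2 g2
    proof -
      obtain c c' h h' r r' where d: "(c, c') \<in> \<Gamma>" "c' \<noteq> 0" "(h, h') \<in> polys \<Gamma>" "(r, r') \<in> polys \<Gamma>"
        "smult c f2 = f1 * h + r" "smult c' g2 = g1 * h' + r'" "r' = 0 \<or> degree r' < degree g1"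
        using pseudo_division[OF rr fg1(1,2) fg2] by blast
      have "poly r' y = 0" using arg_cong[OF d(6), of "\<lambda>s. poly s y"] g2 fg1 by simp
      then have r': "r' = 0" using min1[OF d(4)] d(7) by (meson not_less)
      have "c * poly f2 x - poly f1 x * poly h x = poly r x"
        using arg_cong[OF d(5), of "\<lambda>s. poly s x"] by (simp add: algebra_simps)
      then show ?thesis using d r' poly_in_I[of r] by (intro exI[of _ c] exI[of _ c'] exI[of _ h] exI[of _ h']) auto
    qed
    obtain c c' h h' where k: "(c, c') \<in> \<Gamma>" "c' \<noteq> 0" "(h, h') \<in> polys \<Gamma>"
      "c * poly p x - poly f1 x * poly h x \<in> I" "smult c' q = g1 * h'"
      using key[OF pq(1) y] by blast
    have "c * poly p x \<in> I" using partial_isoD(2)[OF pi k(1)] pq(3) by (rule mult_I)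
    \<comment> \<open>A product of two factors lies in \<open>I\<close>. If the factor from
      \<open>h\<close> does, minimality of \<open>q\<close> gives
      \<open>degree q \<le> degree h'\<close>, so \<open>g1\<close> is a constant; having the root
      \<open>y\<close>, it would be 0.\<close>
    from diff_I[OF this k(4)] have "poly f1 x \<in> I \<or> poly h x \<in> I"
      using prime poly_in_A fg1(1) k(3) by fastforce
    then have f1: "poly f1 x \<in> I"
    proof
      assume h: "poly h x \<in> I"
      have "h' \<noteq> 0" using k(2,5) pq(2) by auto
      then have "degree q \<le> degree h'" using min[OF k(3)] h by simp
      moreover have "degree q = degree g1 + degree h'"
        using arg_cong[OF k(5), of degree] k(2) fg1(2) \<open>h' \<noteq> 0\<close> by (simp add: degree_mult_eq)
      ultimately have "degree g1 = 0" by simp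
      then obtain e where "g1 = [:e:]" by (metis degree_0_id)
      then show ?thesis using fg1 by simp
    qed
    obtain c c' h h' where k: "(c, c') \<in> \<Gamma>" "c' \<noteq> 0" "(h, h') \<in> polys \<Gamma>"
      "c * poly f x - poly f1 x * poly h x \<in> I"
      using key[OF fg g] by blast
    have "poly f1 x * poly h x \<in> I"
      using mult_I[OF poly_in_A[OF k(3)] f1] by (simp add: mult.commute)
    from add_I[OF k(4) this] have "c * poly f x \<in> I" by simp
    then show ?thesis using prime[OF partial_isoD(2)[OF pi k(1)] poly_in_A[OF fg]]
        partial_isoD(3)[OF pi k(1)] k(2) by blast
  qed
  from partial_iso_adjoinI up down show ?thesis by blast
qed

text \<open>Over a countable graph there are countably many polynomials with countably many roots,
  so some complex \<open>y\<close> satisfies no relation; it serves as the image of a transcendental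
  \<open>x\<close>.\<close>

lemma adjoin_countable:
  assumes "countable \<Gamma>"
  shows "\<exists>y. partial_iso (adjoin \<Gamma> x y)"
proof (cases "algebraic_over \<Gamma> x")
  case False
  define R where "R = (\<Union>(f, g) \<in> {(f, g) \<in> polys \<Gamma>. g \<noteq> 0}. {y. poly g y = 0})"
  have "countable R" unfolding R_def
  proof (intro countable_UN)
    show "countable {(f, g) \<in> polys \<Gamma>. g \<noteq> 0}"
      by (rule countable_subset[OF _ countable_polys[OF partial_isoD(1)[OF pi] assms]]) auto
  qed (auto intro!: countable_finite poly_roots_finite)
  then have "R \<noteq> UNIV" using uncountable_UNIV_complex by auto
  then obtain y where "y \<notin> R" by blast
  then have "\<And>f g. (f, g) \<in> polys \<Gamma> \<Longrightarrow> g \<noteq> 0 \<Longrightarrow> poly g y \<noteq> 0" by (auto simp: R_def)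
  then show ?thesis using adjoin_transcendental[OF False] by blast
qed (rule adjoin_algebraic)

end

end

section \<open>Extension to automorphisms of the complex numbers\<close>

context prime_ideal_on
begin

lemma partial_iso_Union:
  assumes "\<F> \<noteq> {}" and chain: "\<And>\<Gamma> \<Delta>. \<Gamma> \<in> \<F> \<Longrightarrow> \<Delta> \<in> \<F> \<Longrightarrow> \<Gamma> \<subseteq> \<Delta> \<or> \<Delta> \<subseteq> \<Gamma>"
    and pi: "\<And>\<Gamma>. \<Gamma> \<in> \<F> \<Longrightarrow> partial_iso \<Gamma>"
  shows "partial_iso (\<Union>\<F>)"
  unfolding partial_iso_def
proof (intro conjI allI impI)
  have rr: "ring_rel \<Gamma>" if "\<Gamma> \<in> \<F>" for \<Gamma> using partial_isoD(1)[OF pi[OF that]] .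
  show "ring_rel (\<Union>\<F>)" unfolding ring_rel_def
  proof (intro conjI allI impI)
    show "(1, 1) \<in> \<Union>\<F>" using assms(1) rr ring_rel_one by blast
  next
    fix a b c d assume "(a, b) \<in> \<Union>\<F>" "(c, d) \<in> \<Union>\<F>"
    then obtain \<Gamma> where "\<Gamma> \<in> \<F>" "(a, b) \<in> \<Gamma>" "(c, d) \<in> \<Gamma>" using chain by blast
    then show "(a - c, b - d) \<in> \<Union>\<F>" "(a * c, b * d) \<in> \<Union>\<F>"
      using rr ring_rel_diff ring_rel_mult by blast+
  qed
  show "fst ` \<Union>\<F> \<subseteq> A" using partial_isoD(2)[OF pi] by auto
  show "a \<in> I \<longleftrightarrow> b = 0" if "(a, b) \<in> \<Union>\<F>" for a b
    using partial_isoD(3)[OF pi] that by blast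
qed

lemma partial_iso_UN_Suc:
  fixes f :: "nat \<Rightarrow> ('a \<times> complex) set"
  assumes "\<And>n. partial_iso (f n)" and "\<And>n. f n \<subseteq> f (Suc n)"
  shows "partial_iso (\<Union>n. f n)"
proof (rule partial_iso_Union)
  have mono: "m \<le> n \<Longrightarrow> f m \<subseteq> f n" for m n using lift_Suc_mono_le[of f] assms(2) by blast
  fix \<Gamma> \<Delta> assume "\<Gamma> \<in> range f" "\<Delta> \<in> range f"
  then show "\<Gamma> \<subseteq> \<Delta> \<or> \<Delta> \<subseteq> \<Gamma>" using mono nat_le_linear by (metis imageE)
qed (use assms(1) in auto)

text \<open>The elements of \<open>S\<close> are adjoined one by one along an enumeration. The graph
  stays countable at every stage, which keeps an image available for the next element.\<close>

lemma partial_iso_extend: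
  assumes "partial_iso \<Gamma>" "countable \<Gamma>" "countable S" "S \<subseteq> A"
  shows "\<exists>\<Delta>. partial_iso \<Delta> \<and> countable \<Delta> \<and> \<Gamma> \<subseteq> \<Delta> \<and> S \<subseteq> Domain \<Delta>"
proof (cases "S = {}")
  case True
  then show ?thesis using assms by blast
next
  case False
  define s where "s = from_nat_into S"
  have s: "range s = S" using False assms(3) by (simp add: s_def)
  have "\<exists>f. \<forall>n::nat. (partial_iso (f n) \<and> countable (f n) \<and> \<Gamma> \<subseteq> f n) \<and>
    (f n \<subseteq> f (Suc n) \<and> s n \<in> Domain (f (Suc n)))"
  proof (rule dependent_nat_choice)
    show "\<exists>\<Delta>. partial_iso \<Delta> \<and> countable \<Delta> \<and> \<Gamma> \<subseteq> \<Delta>" using assms by blast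
  next
    fix \<Delta> and n :: nat assume \<Delta>: "partial_iso \<Delta> \<and> countable \<Delta> \<and> \<Gamma> \<subseteq> \<Delta>"
    have "s n \<in> A" using s assms(4) by blast
    then obtain y where "partial_iso (adjoin \<Delta> (s n) y)" using adjoin_countable \<Delta> by blast
    moreover have rr: "ring_rel \<Delta>" using \<Delta> partial_isoD(1) by blast
    moreover have "s n \<in> Domain (adjoin \<Delta> (s n) y)" using mem_adjoin[OF rr] by blast
    ultimately show "\<exists>\<Delta>'. (partial_iso \<Delta>' \<and> countable \<Delta>' \<and> \<Gamma> \<subseteq> \<Delta>') \<and>
        (\<Delta> \<subseteq> \<Delta>' \<and> s n \<in> Domain \<Delta>')"
      using \<Delta> subset_adjoin[OF rr] countable_adjoin[OF rr]
      by (intro exI[of _ "adjoin \<Delta> (s n) y"]) (meson order_trans)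
  qed
  then obtain f where f: "\<And>n. partial_iso (f n)" "\<And>n. countable (f n)" "\<And>n. \<Gamma> \<subseteq> f n"
    "\<And>n. f n \<subseteq> f (Suc n)" "\<And>n. s n \<in> Domain (f (Suc n))" by metis
  have "partial_iso (\<Union>(range f))" using f(1,4) by (rule partial_iso_UN_Suc)
  moreover have "countable (\<Union>(range f))" using f(2) by blast
  moreover have "S \<subseteq> Domain (\<Union>(range f))" using f(5) s by blast
  ultimately show ?thesis using f(3) by blast
qed

lemma algebraic_over_mono: "\<Gamma> \<subseteq> \<Delta> \<Longrightarrow> algebraic_over \<Gamma> x \<Longrightarrow> algebraic_over \<Delta> x"
  unfolding algebraic_over_def polys_def by blast

end

section \<open>Partial isomorphisms between subrings of the complex numbers\<close>

interpretation cx: prime_ideal_on UNIV "{0 :: complex}"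
  by unfold_locales auto

text \<open>With the zero ideal the notion is symmetric, so whatever is shown for domains applies to
  ranges.\<close>

lemma cx_partial_iso_converse: "cx.partial_iso \<Gamma> \<Longrightarrow> cx.partial_iso (\<Gamma>\<inverse>)"
  unfolding cx.partial_iso_def ring_rel_def by auto

lemma polys_converse: "(p, q) \<in> polys (\<Gamma>\<inverse>) \<longleftrightarrow> (q, p) \<in> polys \<Gamma>"
  by (auto simp: polys_def)

lemma adjoin_converse: "adjoin (\<Gamma>\<inverse>) x y = (adjoin \<Gamma> y x)\<inverse>"
  by (force simp: adjoin_def polys_converse)

lemma cx_polys_nonzero: "cx.partial_iso \<Gamma> \<Longrightarrow> (p, q) \<in> polys \<Gamma> \<Longrightarrow> p = 0 \<longleftrightarrow> q = 0"
  using cx.partial_isoD(3) by (force simp: polys_def poly_eq_iff)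

lemma ex_polys:
  assumes "cx.partial_iso \<Gamma>" and "\<And>i. coeff p i \<in> Domain \<Gamma>"
  shows "\<exists>q. (p, q) \<in> polys \<Gamma>"
proof -
  have "\<forall>i. \<exists>b. (coeff p i, b) \<in> \<Gamma>" using assms(2) by blast
  then obtain c where c: "\<And>i. (coeff p i, c i) \<in> \<Gamma>" by metis
  \<comment> \<open>The only partner of 0 is 0, so the sequence \<open>c\<close> is eventually 0 and
    defines a polynomial.\<close>
  have "c i = 0" if "i > degree p" for i
    using cx.partial_isoD(3)[OF assms(1) c[of i]] coeff_eq_0[OF that] by simp
  then have "coeff (Abs_poly c) = c"
    by (intro Abs_poly_inverse) (auto simp: MOST_nat)
  then show ?thesis using c by (intro exI[of _ "Abs_poly c"]) (simp add: polys_def)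
qed

lemma Domain_adjoin:
  assumes "cx.partial_iso \<Gamma>"
  shows "Domain (adjoin \<Gamma> x y) = {poly p x | p. \<forall>i. coeff p i \<in> Domain \<Gamma>}"
  using ex_polys[OF assms] by (force simp: adjoin_def polys_def)

text \<open>Equal domain and range is what later allows a transcendental to be its own image. Each
  stage puts everything that occurs in the previous graph into both its domain and its range, so the
  two agree for the union.\<close>

lemma cx_back_and_forth:
  assumes "cx.partial_iso \<Gamma>" "countable \<Gamma>"
  shows "\<exists>\<Delta>. cx.partial_iso \<Delta> \<and> \<Gamma> \<subseteq> \<Delta> \<and> Domain \<Delta> = Range \<Delta>"
proof -
  have "\<exists>f. \<forall>n::nat. (cx.partial_iso (f n) \<and> countable (f n) \<and> \<Gamma> \<subseteq> f n) \<and>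
    (f n \<subseteq> f (Suc n) \<and> Field (f n) \<subseteq> Domain (f (Suc n)) \<inter> Range (f (Suc n)))"
  proof (rule dependent_nat_choice)
    show "\<exists>\<Delta>. cx.partial_iso \<Delta> \<and> countable \<Delta> \<and> \<Gamma> \<subseteq> \<Delta>" using assms by blast
  next
    fix \<Delta> and n :: nat assume \<Delta>: "cx.partial_iso \<Delta> \<and> countable \<Delta> \<and> \<Gamma> \<subseteq> \<Delta>"
    have "Domain \<Delta> = fst ` \<Delta>" and "Range \<Delta> = snd ` \<Delta>" by force+
    then have F: "countable (Field \<Delta>)" using \<Delta> by (simp add: Field_def)
    obtain \<Delta>1 where 1: "cx.partial_iso \<Delta>1" "countable \<Delta>1" "\<Delta> \<subseteq> \<Delta>1" "Field \<Delta> \<subseteq> Domain \<Delta>1"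
      using cx.partial_iso_extend[of \<Delta> "Field \<Delta>"] \<Delta> F by blast
    have "\<Delta>1\<inverse> = prod.swap ` \<Delta>1" by force
    then have "countable (\<Delta>1\<inverse>)" using 1(2) by simp
    then obtain \<Delta>2 where 2: "cx.partial_iso \<Delta>2" "countable \<Delta>2" "\<Delta>1\<inverse> \<subseteq> \<Delta>2" "Field \<Delta> \<subseteq> Domain \<Delta>2"
      using cx.partial_iso_extend[of "\<Delta>1\<inverse>" "Field \<Delta>"] cx_partial_iso_converse[OF 1(1)] F by blast
    have "\<Delta>2\<inverse> = prod.swap ` \<Delta>2" by force
    then have "countable (\<Delta>2\<inverse>)" using 2(2) by simp
    moreover have "\<Delta> \<subseteq> \<Delta>2\<inverse>" "Field \<Delta> \<subseteq> Domain (\<Delta>2\<inverse>)" "Field \<Delta> \<subseteq> Range (\<Delta>2\<inverse>)"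
      using 1(3,4) 2(3,4) Range_mono[OF 2(3)] by auto
    ultimately show "\<exists>\<Delta>'. (cx.partial_iso \<Delta>' \<and> countable \<Delta>' \<and> \<Gamma> \<subseteq> \<Delta>') \<and>
        (\<Delta> \<subseteq> \<Delta>' \<and> Field \<Delta> \<subseteq> Domain \<Delta>' \<inter> Range \<Delta>')"
      using \<Delta> cx_partial_iso_converse[OF 2(1)]
      by (intro exI[of _ "\<Delta>2\<inverse>"] conjI) (simp_all, meson order_trans)
  qed
  then obtain f where f: "\<And>n. cx.partial_iso (f n)" "\<And>n. \<Gamma> \<subseteq> f n"
    "\<And>n. f n \<subseteq> f (Suc n)" "\<And>n. Field (f n) \<subseteq> Domain (f (Suc n)) \<inter> Range (f (Suc n))" by metis
  have "cx.partial_iso (\<Union>(range f))" using f(1,3) by (rule cx.partial_iso_UN_Suc)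
  moreover have "Domain (\<Union>(range f)) = Range (\<Union>(range f))"
  proof
    have DR: "Domain (f n) \<subseteq> Range (f (Suc n))" and RD: "Range (f n) \<subseteq> Domain (f (Suc n))" for n
      using f(4)[of n] by (auto simp: Field_def)
    have Un: "f n \<subseteq> \<Union>(range f)" for n by blast
    show "Domain (\<Union>(range f)) \<subseteq> Range (\<Union>(range f))"
      using order_trans[OF DR Range_mono[OF Un]] by (simp add: Domain_Union UN_subset_iff)
    show "Range (\<Union>(range f)) \<subseteq> Domain (\<Union>(range f))"
      using order_trans[OF RD Domain_mono[OF Un]] by (simp add: Range_Union UN_subset_iff)
  qed
  moreover have "\<Gamma> \<subseteq> \<Union>(range f)" using f(2)[of 0] by (rule order_trans) auto
  ultimately show ?thesis by (intro exI[of _ "\<Union>(range f)"] conjI)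
qed

text \<open>\<open>Q\<close> is a side condition inherited by unions; it will be equality of domain
  and range, and later the trivial condition.\<close>

lemma cx_Zorn:
  assumes "cx.partial_iso \<Gamma>" "Q \<Gamma>"
    and Q: "\<And>\<F>. \<F> \<noteq> {} \<Longrightarrow> (\<And>\<Delta>. \<Delta> \<in> \<F> \<Longrightarrow> Q \<Delta>) \<Longrightarrow> Q (\<Union>\<F>)"
  obtains M where "cx.partial_iso M" "Q M" "\<Gamma> \<subseteq> M"
    "\<And>\<Delta>. cx.partial_iso \<Delta> \<Longrightarrow> Q \<Delta> \<Longrightarrow> M \<subseteq> \<Delta> \<Longrightarrow> \<Delta> = M"
proof -
  define Z where "Z = {\<Delta>. cx.partial_iso \<Delta> \<and> Q \<Delta> \<and> \<Gamma> \<subseteq> \<Delta>}"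
  have "\<exists>M\<in>Z. \<forall>X\<in>Z. M \<subseteq> X \<longrightarrow> X = M"
  proof (rule subset_Zorn_nonempty)
    show "Z \<noteq> {}" using assms by (auto simp: Z_def)
  next
    fix \<F> assume *: "\<F> \<noteq> {}" "subset.chain Z \<F>"
    then have "\<F> \<subseteq> Z" by (simp add: subset_chain_def)
    then have \<F>: "\<And>\<Delta>. \<Delta> \<in> \<F> \<Longrightarrow> cx.partial_iso \<Delta> \<and> Q \<Delta> \<and> \<Gamma> \<subseteq> \<Delta>" by (auto simp: Z_def)
    have "cx.partial_iso (\<Union>\<F>)"
      by (rule cx.partial_iso_Union[OF *(1)]) (use * \<F> in \<open>auto simp: subset_chain_def\<close>)
    moreover have "Q (\<Union>\<F>)" by (rule Q[OF *(1)]) (use \<F> in blast)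
    moreover have "\<Gamma> \<subseteq> \<Union>\<F>" using * \<F> by blast
    ultimately show "\<Union>\<F> \<in> Z" by (simp add: Z_def)
  qed
  then obtain M where "M \<in> Z" "\<forall>X\<in>Z. M \<subseteq> X \<longrightarrow> X = M" by blast
  then show ?thesis using that[of M] by (auto simp: Z_def)
qed

text \<open>Among partial isomorphisms with equal domain and range a transcendental element can be mapped to
  itself, so no comparison of transcendence degrees is needed.\<close>

lemma cx_extend_algebraic:
  assumes "cx.partial_iso \<Gamma>" "Domain \<Gamma> = Range \<Gamma>"
  shows "\<exists>M. cx.partial_iso M \<and> \<Gamma> \<subseteq> M \<and> Domain M = Range M \<and> (\<forall>x. cx.algebraic_over M x)"
proof -
  obtain M where M: "cx.partial_iso M" "Domain M = Range M" "\<Gamma> \<subseteq> M"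
    and max: "\<And>\<Delta>. cx.partial_iso \<Delta> \<Longrightarrow> Domain \<Delta> = Range \<Delta> \<Longrightarrow> M \<subseteq> \<Delta> \<Longrightarrow> \<Delta> = M"
    by (rule cx_Zorn[of \<Gamma> "\<lambda>\<Delta>. Domain \<Delta> = Range \<Delta>"]) (auto simp: assms Domain_Union Range_Union)
  note rr = cx.partial_isoD(1)[OF M(1)]
  have "cx.algebraic_over M x" for x
  proof (rule ccontr)
    assume na: "\<not> cx.algebraic_over M x"
    \<comment> \<open>Since domain and range coincide, a relation for \<open>x\<close> with
      coefficients in the range is one with coefficients in the domain. So \<open>x\<close> is
      transcendental over both and may be sent to itself.\<close>
    have "poly g x \<noteq> 0" if "(f, g) \<in> polys M" "g \<noteq> 0" for f g
    proof
      assume 0: "poly g x = 0"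
      have "coeff g i \<in> Domain M" for i using that(1) M(2) by (auto simp: polys_def)
      from ex_polys[OF M(1) this] obtain h where h: "(g, h) \<in> polys M" by blast
      then have "h \<noteq> 0" using cx_polys_nonzero[OF M(1) h] that(2) by simp
      then show False using na h 0 by (auto simp: cx.algebraic_over_def)
    qed
    then have pi: "cx.partial_iso (adjoin M x x)" using cx.adjoin_transcendental[OF M(1) _ na] by blast
    have "Range (adjoin M x x) = Domain (adjoin (M\<inverse>) x x)" by (simp add: adjoin_converse)
    then have "Domain (adjoin M x x) = Range (adjoin M x x)"
      using Domain_adjoin[OF M(1)] Domain_adjoin[OF cx_partial_iso_converse[OF M(1)]] M(2) by simp
    from max[OF pi this subset_adjoin[OF rr]] have "(x, x) \<in> M" using mem_adjoin[OF rr] by blast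
    \<comment> \<open>Maximality has put \<open>x\<close> into the domain, where the linear
      polynomial with root \<open>x\<close> is a relation for it.\<close>
    then have "([:- x, 1:], [:- x, 1:]) \<in> polys M"
      by (intro polys_pCons[OF rr] polys_const[OF rr] ring_rel_uminus[OF rr] ring_rel_one[OF rr])
    then show False using na by (force simp: cx.algebraic_over_def)
  qed
  then show ?thesis using M by blast
qed

locale field_aut =
  fixes \<sigma> :: "complex \<Rightarrow> complex"
  assumes bij_aut: "bij \<sigma>"
    and aut_add: "\<sigma> (x + y) = \<sigma> x + \<sigma> y"
    and aut_mult: "\<sigma> (x * y) = \<sigma> x * \<sigma> y"

lemma Domain_maximal:
  assumes "cx.partial_iso M" and max: "\<And>\<Delta>. cx.partial_iso \<Delta> \<Longrightarrow> M \<subseteq> \<Delta> \<Longrightarrow> \<Delta> = M"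
    and "\<And>x. cx.algebraic_over M x"
  shows "Domain M = UNIV"
proof -
  note rr = cx.partial_isoD(1)[OF assms(1)]
  have "x \<in> Domain M" for x
  proof -
    obtain y where "cx.partial_iso (adjoin M x y)"
      using cx.adjoin_algebraic[OF assms(1) _ assms(3)] by blast
    from max[OF this subset_adjoin[OF rr]] mem_adjoin[OF rr, of x y] show ?thesis by auto
  qed
  then show ?thesis by blast
qed

text \<open>Countability secures equal domain and range; an isomorphism of \<complex> with a proper
  subfield shows that an arbitrary partial isomorphism need not extend. Once every number is
  algebraic over the common domain and range, a maximal extension is total and, by the same argument
  for the converse, onto.\<close>

theorem countable_partial_iso_extends_to_aut:
  assumes "cx.partial_iso \<Gamma>" "countable \<Gamma>"
  shows "\<exists>\<sigma>. field_aut \<sigma> \<and> (\<forall>(a, b) \<in> \<Gamma>. \<sigma> a = b)"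
proof -
  obtain \<Delta> where "cx.partial_iso \<Delta>" "\<Gamma> \<subseteq> \<Delta>" "Domain \<Delta> = Range \<Delta>"
    using cx_back_and_forth[OF assms] by blast
  then obtain L where L: "cx.partial_iso L" "\<Gamma> \<subseteq> L" "Domain L = Range L" "\<And>x. cx.algebraic_over L x"
    using cx_extend_algebraic[of \<Delta>] by blast
  \<comment> \<open>Maximality is now meant among all extensions; domain and range are known to
    agree for \<open>L\<close> only.\<close>
  obtain M where M: "cx.partial_iso M" "L \<subseteq> M"
    and max: "\<And>\<Delta>. cx.partial_iso \<Delta> \<Longrightarrow> M \<subseteq> \<Delta> \<Longrightarrow> \<Delta> = M"
    by (rule cx_Zorn[of L "\<lambda>_. True"]) (auto simp: L(1))
  note rr = cx.partial_isoD(1)[OF M(1)]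
  have dom: "Domain M = UNIV"
    using Domain_maximal[OF M(1) max] cx.algebraic_over_mono[OF M(2) L(4)] by blast
  \<comment> \<open>A relation over the domain of \<open>L\<close> has its coefficients in the range
    of \<open>L\<close> too, so the same polynomial is a relation for the converse.\<close>
  have "cx.algebraic_over (M\<inverse>) x" for x
  proof -
    obtain p q where pq: "(p, q) \<in> polys L" "q \<noteq> 0" "poly p x = 0"
      using L(4)[of x] by (auto simp: cx.algebraic_over_def)
    have "coeff p i \<in> Domain (L\<inverse>)" for i using pq(1) L(3) by (auto simp: polys_def)
    from ex_polys[OF cx_partial_iso_converse[OF L(1)] this] obtain h where h: "(p, h) \<in> polys (L\<inverse>)"
      by blast
    have "p \<noteq> 0" using cx_polys_nonzero[OF L(1) pq(1)] pq(2) by simp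
    then have "h \<noteq> 0" using cx_polys_nonzero[OF cx_partial_iso_converse[OF L(1)] h] by simp
    then have "cx.algebraic_over (L\<inverse>) x" using h pq(3) by (auto simp: cx.algebraic_over_def)
    then show ?thesis by (rule cx.algebraic_over_mono[rotated]) (use M(2) in blast)
  qed
  moreover have "\<Delta> = M\<inverse>" if "cx.partial_iso \<Delta>" "M\<inverse> \<subseteq> \<Delta>" for \<Delta>
  proof -
    have "M \<subseteq> \<Delta>\<inverse>" using that(2) by (subst converse_subset_swap)
    from max[OF cx_partial_iso_converse[OF that(1)] this] show ?thesis by (metis converse_converse)
  qed
  ultimately have "Domain (M\<inverse>) = UNIV"
    using Domain_maximal[OF cx_partial_iso_converse[OF M(1)]] by blast
  then have ran: "Range M = UNIV" by simp
  define \<sigma> where "\<sigma> a = (SOME b. (a, b) \<in> M)" for a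
  have \<sigma>: "(a, \<sigma> a) \<in> M" for a unfolding \<sigma>_def by (rule someI_ex) (use dom in blast)
  have M0: "(a, b) \<in> M \<Longrightarrow> a = 0 \<longleftrightarrow> b = 0" for a b using cx.partial_isoD(3)[OF M(1)] by simp
  have eq: "a = a' \<longleftrightarrow> b = b'" if "(a, b) \<in> M" "(a', b') \<in> M" for a b a' b'
    using M0[OF ring_rel_diff[OF rr that]] by simp
  have "bij \<sigma>"
  proof (rule bijI)
    show "inj \<sigma>" using eq[OF \<sigma> \<sigma>] by (auto simp: inj_def)
    have "\<exists>a. b = \<sigma> a" for b
    proof -
      obtain a where "(a, b) \<in> M" using ran by (metis RangeE UNIV_I)
      then show ?thesis using eq[OF \<sigma>[of a]] by blast
    qed
    then show "surj \<sigma>" by (simp add: surj_def)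
  qed
  moreover have "\<sigma> (x + y) = \<sigma> x + \<sigma> y" for x y
    using eq[OF \<sigma>[of "x + y"] ring_rel_add[OF rr \<sigma>[of x] \<sigma>[of y]]] by blast
  moreover have "\<sigma> (x * y) = \<sigma> x * \<sigma> y" for x y
    using eq[OF \<sigma>[of "x * y"] ring_rel_mult[OF rr \<sigma>[of x] \<sigma>[of y]]] by blast
  moreover have "\<forall>(a, b) \<in> \<Gamma>. \<sigma> a = b" using eq[OF \<sigma>] L(2) M(2) by blast
  ultimately show ?thesis unfolding field_aut_def by blast
qed

section \<open>Forms as functions\<close>

text \<open>Forms are handled as functions: products, compositions and conjugates become operations
  on functions, without computations on formal polynomials.\<close>

definition form_fun :: "complex set \<Rightarrow> nat \<Rightarrow> (complex ^ 'n::finite \<Rightarrow> complex) \<Rightarrow> bool" where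
  "form_fun k d F \<longleftrightarrow> (\<exists>P \<in> forms k d. F = eval_mpoly P)"

text \<open>Closure under ring operations covers \<open>k\<close>, \<open>UNIV\<close> and the
  countable rings generated by coefficients of forms.\<close>

definition ring_set :: "complex set \<Rightarrow> bool" where
  "ring_set k \<longleftrightarrow> 0 \<in> k \<and> 1 \<in> k \<and> (\<forall>x\<in>k. \<forall>y\<in>k. x + y \<in> k \<and> x - y \<in> k \<and> x * y \<in> k)"

lemma ring_set_UNIV [simp]: "ring_set UNIV"
  by (simp add: ring_set_def)

abbreviation mon :: "('n::finite \<Rightarrow>\<^sub>0 nat) \<Rightarrow> complex ^ 'n \<Rightarrow> complex" where
  "mon m v \<equiv> (\<Prod>i\<in>UNIV. (v $ i) ^ Poly_Mapping.lookup m i)"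

abbreviation deg :: "('n::finite \<Rightarrow>\<^sub>0 nat) \<Rightarrow> nat" where
  "deg m \<equiv> (\<Sum>i\<in>UNIV. Poly_Mapping.lookup m i)"

lemma eval_mpoly_superset:
  assumes "finite K" "Poly_Mapping.keys P \<subseteq> K"
  shows "eval_mpoly P v = (\<Sum>m\<in>K. Poly_Mapping.lookup P m * mon m v)"
  unfolding eval_mpoly_def
  by (rule sum.mono_neutral_left) (use assms in \<open>auto simp: in_keys_iff\<close>)

lemma eval_mpoly_zero [simp]: "eval_mpoly 0 v = 0"
  by (simp add: eval_mpoly_def)

lemma eval_mpoly_single: "eval_mpoly (Poly_Mapping.single m c) v = c * mon m v"
  by (simp add: eval_mpoly_def)

lemma eval_mpoly_add: "eval_mpoly (P + Q) v = eval_mpoly P v + eval_mpoly Q v"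
proof -
  let ?K = "Poly_Mapping.keys P \<union> Poly_Mapping.keys Q"
  have "eval_mpoly (P + Q) v = (\<Sum>m\<in>?K. Poly_Mapping.lookup (P + Q) m * mon m v)"
    by (rule eval_mpoly_superset) (simp_all add: keys_add)
  also have "\<dots> = (\<Sum>m\<in>?K. Poly_Mapping.lookup P m * mon m v) + (\<Sum>m\<in>?K. Poly_Mapping.lookup Q m * mon m v)"
    by (simp add: lookup_add algebra_simps sum.distrib)
  finally show ?thesis by (simp flip: eval_mpoly_superset)
qed

lemma eval_mpoly_sum: "eval_mpoly (sum P N) v = (\<Sum>i\<in>N. eval_mpoly (P i) v)"
  by (induction N rule: infinite_finite_induct) (auto simp: eval_mpoly_add)

lemma mon_add: "mon (m + m') v = mon m v * mon m' v"
  by (simp add: lookup_add power_add prod.distrib)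

lemma forms_single: "0 \<in> k \<Longrightarrow> c \<in> k \<Longrightarrow> Poly_Mapping.single m c \<in> forms k (deg m)"
  by (auto simp: forms_def lookup_single when_def split: if_splits)

lemma form_fun_zero: "0 \<in> k \<Longrightarrow> form_fun k d (\<lambda>_. 0)"
  unfolding form_fun_def by (intro bexI[of _ 0]) (auto simp: forms_def)

lemma form_fun_monomial: "0 \<in> k \<Longrightarrow> c \<in> k \<Longrightarrow> form_fun k (deg m) (\<lambda>v. c * mon m v)"
  unfolding form_fun_def
  by (intro bexI[of _ "Poly_Mapping.single m c"] forms_single) (simp_all add: fun_eq_iff eval_mpoly_single)

lemma form_fun_const: "0 \<in> k \<Longrightarrow> c \<in> k \<Longrightarrow> form_fun k 0 (\<lambda>_. c)"
  using form_fun_monomial[of k c 0] by simp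

lemma form_fun_coord:
  assumes "0 \<in> k" "1 \<in> k" shows "form_fun k 1 (\<lambda>v. v $ i)"
  using form_fun_monomial[OF assms, of "Poly_Mapping.single i 1"]
  by (simp add: lookup_single when_def if_distrib prod.delta cong: if_cong)

lemma form_fun_add:
  assumes "ring_set k" "form_fun k d F" "form_fun k d G"
  shows "form_fun k d (\<lambda>v. F v + G v)"
proof -
  obtain P Q where "P \<in> forms k d" "Q \<in> forms k d" "F = eval_mpoly P" "G = eval_mpoly Q"
    using assms by (auto simp: form_fun_def)
  moreover from this have "P + Q \<in> forms k d"
    using assms(1) keys_add[of P Q] by (auto simp: forms_def lookup_add ring_set_def)
  ultimately show ?thesis by (auto simp: form_fun_def eval_mpoly_add intro!: bexI[of _ "P + Q"])
qed

lemma form_fun_sum: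
  assumes "ring_set k" "\<And>i. i \<in> N \<Longrightarrow> form_fun k d (F i)"
  shows "form_fun k d (\<lambda>v. \<Sum>i\<in>N. F i v)"
  using assms(2) by (induction N rule: infinite_finite_induct)
    (auto intro: form_fun_add form_fun_zero assms(1) simp: assms(1)[unfolded ring_set_def])

lemma form_fun_expand:
  assumes "form_fun k d F"
  shows "\<exists>N c. finite N \<and> (\<forall>m\<in>N. deg m = d) \<and> (\<forall>m. c m \<in> k) \<and>
    F = (\<lambda>v. \<Sum>m\<in>N. c m * mon m v)"
proof -
  obtain P where "P \<in> forms k d" "F = eval_mpoly P" using assms by (auto simp: form_fun_def)
  then show ?thesis
    by (intro exI[of _ "Poly_Mapping.keys P"] exI[of _ "Poly_Mapping.lookup P"])
      (auto simp: forms_def eval_mpoly_def)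
qed

lemma form_fun_mult:
  assumes k: "ring_set k" and "form_fun k d F" "form_fun k e G"
  shows "form_fun k (d + e) (\<lambda>v. F v * G v)"
proof -
  obtain N c where "finite N" and F: "\<And>m. m \<in> N \<Longrightarrow> deg m = d" "\<And>m. c m \<in> k" "F = (\<lambda>v. \<Sum>m\<in>N. c m * mon m v)"
    using form_fun_expand[OF assms(2)] by auto
  obtain M b where "finite M" and G: "\<And>m. m \<in> M \<Longrightarrow> deg m = e" "\<And>m. b m \<in> k" "G = (\<lambda>v. \<Sum>m\<in>M. b m * mon m v)"
    using form_fun_expand[OF assms(3)] by auto
  have "form_fun k (d + e) (\<lambda>v. \<Sum>m\<in>N. \<Sum>m'\<in>M. (c m * b m') * mon (m + m') v)"
  proof (intro form_fun_sum k)
    fix m m' assume "m \<in> N" "m' \<in> M"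
    then have "deg (m + m') = d + e" using F(1) G(1) by (simp add: lookup_add sum.distrib)
    moreover have "c m * b m' \<in> k" using k F(2) G(2) by (simp add: ring_set_def)
    ultimately show "form_fun k (d + e) (\<lambda>v. (c m * b m') * mon (m + m') v)"
      using form_fun_monomial[of k "c m * b m'" "m + m'"] k by (simp add: ring_set_def)
  qed
  moreover have "(\<lambda>v. F v * G v) = (\<lambda>v. \<Sum>m\<in>N. \<Sum>m'\<in>M. (c m * b m') * mon (m + m') v)"
    unfolding F(3) G(3) sum_product mon_add by (simp only: mult_ac)
  ultimately show ?thesis by simp
qed

lemma form_fun_power:
  assumes k: "ring_set k" and "form_fun k d F"
  shows "form_fun k (d * n) (\<lambda>v. F v ^ n)"
proof (induction n)
  case 0 then show ?case using form_fun_const[of k 1] k by (simp add: ring_set_def)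
next
  case (Suc n) then show ?case using form_fun_mult[OF k assms(2) Suc] by simp
qed

lemma form_fun_prod:
  assumes k: "ring_set k" and "finite N" "\<And>i. i \<in> N \<Longrightarrow> form_fun k (d i) (F i)"
  shows "form_fun k (\<Sum>i\<in>N. d i) (\<lambda>v. \<Prod>i\<in>N. F i v)"
  using assms(2,3)
proof (induction N)
  case empty then show ?case using form_fun_const[of k 1] k by (simp add: ring_set_def)
next
  case (insert i N)
  then show ?case using form_fun_mult[OF k, of "d i" "F i" "sum d N" "\<lambda>v. \<Prod>i\<in>N. F i v"] by simp
qed

lemma form_fun_scale: "ring_set k \<Longrightarrow> c \<in> k \<Longrightarrow> form_fun k d F \<Longrightarrow> form_fun k d (\<lambda>v. c * F v)"
  using form_fun_mult[of k 0 "\<lambda>_. c" d F] form_fun_const[of k c] by (simp add: ring_set_def)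

lemma form_fun_diff:
  assumes "ring_set k" "form_fun k d F" "form_fun k d G"
  shows "form_fun k d (\<lambda>v. F v - G v)"
proof -
  have "0 - 1 \<in> k" using assms(1) unfolding ring_set_def by blast
  from form_fun_add[OF assms(1,2) form_fun_scale[OF assms(1) this assms(3)]] show ?thesis by simp
qed

lemma form_fun_compose:
  assumes k: "ring_set k" and F: "form_fun k d F" and u: "\<And>i. form_fun k e (u i)"
  shows "form_fun k (e * d) (\<lambda>v. F (\<chi> i. u i v))"
proof -
  obtain N c where "finite N" and F: "\<And>m. m \<in> N \<Longrightarrow> deg m = d" "\<And>m. c m \<in> k" "F = (\<lambda>v. \<Sum>m\<in>N. c m * mon m v)"
    using form_fun_expand[OF F] by auto
  have "form_fun k (e * d) (\<lambda>v. \<Sum>m\<in>N. c m * mon m (\<chi> i. u i v))"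
  proof (intro form_fun_sum form_fun_scale k F(2))
    fix m assume m: "m \<in> N"
    have "form_fun k (\<Sum>i\<in>UNIV. e * Poly_Mapping.lookup m i) (\<lambda>v. \<Prod>i\<in>UNIV. u i v ^ Poly_Mapping.lookup m i)"
      by (intro form_fun_prod form_fun_power k u) simp
    then show "form_fun k (e * d) (\<lambda>v. mon m (\<chi> i. u i v))"
      using F(1)[OF m] by (simp flip: sum_distrib_left)
  qed
  then show ?thesis by (simp add: F(3))
qed

lemma form_fun_homogeneous:
  assumes "form_fun k d F" shows "F (c *s v) = c ^ d * F v"
proof -
  obtain N b where "finite N" and F: "\<And>m. m \<in> N \<Longrightarrow> deg m = d" "\<And>m. b m \<in> k" "F = (\<lambda>v. \<Sum>m\<in>N. b m * mon m v)"
    using form_fun_expand[OF assms] by auto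
  have "mon m (c *s v) = c ^ d * mon m v" if "m \<in> N" for m
    using F(1)[OF that] by (simp add: power_mult_distrib prod.distrib flip: power_sum)
  then show ?thesis by (simp add: F(3) sum_distrib_left algebra_simps)
qed

lemma form_fun_mono: "k \<subseteq> l \<Longrightarrow> form_fun k d F \<Longrightarrow> form_fun l d F"
  by (auto simp: form_fun_def forms_def)

lemma countable_form_funs:
  assumes "countable k"
  shows "countable {F :: complex ^ 'n::finite \<Rightarrow> complex. form_fun k d F}"
proof -
  let ?g = "\<lambda>P :: 'n mpoly. {(m, Poly_Mapping.lookup P m) | m. m \<in> Poly_Mapping.keys P}"
  have "countable (UNIV :: ('n \<Rightarrow>\<^sub>0 nat) set)"
    using countableI_type[of "range (Poly_Mapping.lookup :: ('n \<Rightarrow>\<^sub>0 nat) \<Rightarrow> _)"]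
    by (rule countable_image_inj_on) (rule injI, simp only: poly_mapping_eq_iff)
  then have "countable ((UNIV :: ('n \<Rightarrow>\<^sub>0 nat) set) \<times> k)" using assms by blast
  then have "countable {X. finite X \<and> X \<subseteq> (UNIV :: ('n \<Rightarrow>\<^sub>0 nat) set) \<times> k}"
    by (rule countable_Collect_finite_subset)
  moreover have "?g ` forms k d \<subseteq> {X. finite X \<and> X \<subseteq> (UNIV :: ('n \<Rightarrow>\<^sub>0 nat) set) \<times> k}"
    by (auto simp: forms_def)
  ultimately have "countable (?g ` forms k d)" by (rule countable_subset[rotated])
  moreover have "inj_on ?g (forms k d)"
  proof (rule inj_onI, rule poly_mapping_eqI)
    fix P Q :: "'n mpoly" and m assume eq: "?g P = ?g Q"
    have "(m, c) \<in> ?g P \<longleftrightarrow> c \<noteq> 0 \<and> Poly_Mapping.lookup P m = c" for P :: "'n mpoly" and c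
      by (auto simp: in_keys_iff)
    from this[of _ P] this[of _ Q] have
      "c \<noteq> 0 \<and> Poly_Mapping.lookup P m = c \<longleftrightarrow> c \<noteq> 0 \<and> Poly_Mapping.lookup Q m = c" for c
      unfolding eq by simp
    from this[of "Poly_Mapping.lookup P m"] this[of "Poly_Mapping.lookup Q m"]
    show "Poly_Mapping.lookup P m = Poly_Mapping.lookup Q m"
      by (cases "Poly_Mapping.lookup P m = 0") auto
  qed
  ultimately have "countable (forms k d :: 'n mpoly set)" by (rule countable_image_inj_on)
  moreover have "{F :: complex ^ 'n \<Rightarrow> complex. form_fun k d F} = eval_mpoly ` (forms k d :: 'n mpoly set)"
    by (auto simp: form_fun_def)
  ultimately show ?thesis by simp
qed

text \<open>A form has finitely many coefficients, so countably many complex forms are defined over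
  one countable ring.\<close>

lemma form_fun_coeffs_finite:
  assumes "form_fun k d F"
  shows "\<exists>l. finite l \<and> l \<subseteq> k \<and> (\<forall>k'. l \<subseteq> k' \<and> 0 \<in> k' \<longrightarrow> form_fun k' d F)"
proof -
  obtain P where P: "P \<in> forms k d" "F = eval_mpoly P" using assms by (auto simp: form_fun_def)
  have "P \<in> forms k' d" if "Poly_Mapping.range P \<subseteq> k' \<and> 0 \<in> k'" for k'
    using that P(1) unfolding forms_def
    by (auto simp: in_keys_iff) (metis in_keys_iff in_keys_lookup_in_range subsetD)
  moreover have "Poly_Mapping.range P \<subseteq> k" using P(1)
    by (auto simp: forms_def Poly_Mapping.range.rep_eq)
  ultimately show ?thesis using P(2)
    by (intro exI[of _ "Poly_Mapping.range P"]) (auto simp: form_fun_def)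
qed

lemma sum_fun_apply: "sum f N s = (\<Sum>i\<in>N. f i s)" for f :: "_ \<Rightarrow> _ \<Rightarrow> complex"
  by (induction N rule: infinite_finite_induct) auto

lemma prod_fun_apply: "prod f N s = (\<Prod>i\<in>N. f i s)" for f :: "_ \<Rightarrow> _ \<Rightarrow> complex"
  by (induction N rule: infinite_finite_induct) auto

lemma power_fun_apply: "(f ^ n) s = f s ^ n" for f :: "_ \<Rightarrow> complex"
  by (induction n) auto

text \<open>Forms commute with ring homomorphisms that fix their coefficients. The left ring
  consists of functions, in which a number appears as a constant function.\<close>

lemma ring_rel_form_fun:
  assumes \<Gamma>: "ring_rel \<Gamma>" and F: "form_fun k d F"
    and k: "\<And>c. c \<in> k \<Longrightarrow> ((\<lambda>_. c), c) \<in> \<Gamma>" and u: "\<And>i. (u i, w $ i) \<in> \<Gamma>"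
  shows "((\<lambda>s. F (\<chi> i. u i s)), F w) \<in> \<Gamma>"
proof -
  obtain N c where "finite N" and F: "\<And>m. m \<in> N \<Longrightarrow> deg m = d" "\<And>m. c m \<in> k"
    "F = (\<lambda>v. \<Sum>m\<in>N. c m * mon m v)"
    using form_fun_expand[OF F] by auto
  have "((\<Sum>m\<in>N. (\<lambda>_. c m) * (\<Prod>i\<in>UNIV. u i ^ Poly_Mapping.lookup m i)),
      \<Sum>m\<in>N. c m * (\<Prod>i\<in>UNIV. (w $ i) ^ Poly_Mapping.lookup m i)) \<in> \<Gamma>"
    by (intro ring_rel_sum ring_rel_mult ring_rel_prod ring_rel_power \<Gamma> k F u)
  moreover have "(\<Sum>m\<in>N. (\<lambda>_. c m) * (\<Prod>i\<in>UNIV. u i ^ Poly_Mapping.lookup m i)) = (\<lambda>s. F (\<chi> i. u i s))"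
    by (simp add: fun_eq_iff F(3) sum_fun_apply prod_fun_apply power_fun_apply)
  ultimately show ?thesis by (simp add: F(3))
qed

section \<open>The Zariski topology and the Segre embedding\<close>

lemma rep_proj_nonzero [simp]: "rep_proj p \<noteq> 0"
  using Quotient3_rep_reflp[OF Quotient3_proj] by blast

lemma abs_rep_proj [simp]: "abs_proj (rep_proj p) = p"
  by (rule Quotient3_abs_rep[OF Quotient3_proj])

lemma abs_proj_eq_iff:
  assumes "v \<noteq> 0" "w \<noteq> 0"
  shows "abs_proj v = abs_proj w \<longleftrightarrow> (\<exists>c. c \<noteq> 0 \<and> w = c *s v)"
proof -
  have refl: "\<exists>c. c \<noteq> 0 \<and> u = c *s u" for u :: "complex ^ 'n" by (rule exI[of _ 1]) simp
  show ?thesis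
    using Quotient3_rel[OF Quotient3_proj, of v w] refl assms by auto
qed

lemma rep_abs_proj:
  assumes "v \<noteq> 0"
  obtains c where "c \<noteq> 0" "rep_proj (abs_proj v) = c *s v"
  using abs_proj_eq_iff[OF assms rep_proj_nonzero, of "abs_proj v"] by auto

lemma vec_nonzero: "v \<noteq> 0 \<Longrightarrow> \<exists>i. v $ i \<noteq> 0" for v :: "complex ^ 'n"
  by (auto simp: vec_eq_iff)

text \<open>Proportionality as the vanishing of 2 by 2 minors is a polynomial condition; this makes
  the locus where two morphisms differ open.\<close>

lemma abs_proj_eq_minors:
  assumes "v \<noteq> 0" "w \<noteq> 0"
  shows "abs_proj v = abs_proj w \<longleftrightarrow> (\<forall>i j. v $ i * w $ j = v $ j * w $ i)"
proof
  assume "abs_proj v = abs_proj w"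
  then show "\<forall>i j. v $ i * w $ j = v $ j * w $ i"
    using abs_proj_eq_iff[OF assms] by auto
next
  assume minors: "\<forall>i j. v $ i * w $ j = v $ j * w $ i"
  obtain i where i: "v $ i \<noteq> 0" using vec_nonzero[OF assms(1)] by blast
  have w: "w = (w $ i / v $ i) *s v"
  proof (subst vec_eq_iff, intro allI)
    fix j
    have "w $ j * v $ i = w $ i * v $ j"
      using minors[rule_format, of i j] by (simp only: mult.commute)
    then show "w $ j = ((w $ i / v $ i) *s v) $ j" using i by (simp add: nonzero_eq_divide_eq)
  qed
  moreover have "w $ i / v $ i \<noteq> 0"
  proof
    assume "w $ i / v $ i = 0"
    then have "w = 0" by (subst w) simp
    then show False using assms(2) by simp
  qed
  ultimately show "abs_proj v = abs_proj w" using abs_proj_eq_iff[OF assms] by blast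
qed

lemma form_fun_rep_abs:
  assumes "form_fun k d F" "v \<noteq> 0"
  shows "F (rep_proj (abs_proj v)) = 0 \<longleftrightarrow> F v = 0"
proof -
  obtain c where "c \<noteq> 0" "rep_proj (abs_proj v) = c *s v" using rep_abs_proj[OF assms(2)] .
  then show ?thesis using form_fun_homogeneous[OF assms(1), of c v] by simp
qed

lemma zariski_alt:
  "zariski k = topology_generated_by {{p. F (rep_proj p) \<noteq> 0} | F. \<exists>d. form_fun k d F}"
  unfolding zariski_def form_fun_def by (rule arg_cong[of _ _ topology_generated_by]) blast

lemma openin_zariski_basic:
  "form_fun k d F \<Longrightarrow> openin (zariski k) {p. F (rep_proj p) \<noteq> 0}"
  unfolding zariski_alt by (rule topology_generated_by_Basis) blast

text \<open>The generating sets already form a base: the intersection of two of them is the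
  nonvanishing set of the product of the forms.\<close>

lemma openin_zariski_iff:
  assumes k: "ring_set k"
  shows "openin (zariski k) W \<longleftrightarrow>
    (\<forall>p\<in>W. \<exists>F d. form_fun k d F \<and> F (rep_proj p) \<noteq> 0 \<and> (\<forall>q. F (rep_proj q) \<noteq> 0 \<longrightarrow> q \<in> W))"
    (is "_ \<longleftrightarrow> ?R W")
proof
  assume "openin (zariski k) W"
  then have "generate_topology_on {{p. F (rep_proj p) \<noteq> 0} | F. \<exists>d. form_fun k d F} W"
    unfolding zariski_alt openin_topology_generated_by_iff .
  then show "?R W"
  proof induction
    case (Int a b)
    show ?case
    proof
      fix p assume "p \<in> a \<inter> b"
      then have "p \<in> a" "p \<in> b" by auto
      obtain F d where F: "form_fun k d F" "F (rep_proj p) \<noteq> 0" "\<forall>q. F (rep_proj q) \<noteq> 0 \<longrightarrow> q \<in> a"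
        using bspec[OF Int.IH(1) \<open>p \<in> a\<close>] by (elim exE conjE)
      obtain G e where G: "form_fun k e G" "G (rep_proj p) \<noteq> 0" "\<forall>q. G (rep_proj q) \<noteq> 0 \<longrightarrow> q \<in> b"
        using bspec[OF Int.IH(2) \<open>p \<in> b\<close>] by (elim exE conjE)
      show "\<exists>F d. form_fun k d F \<and> F (rep_proj p) \<noteq> 0 \<and> (\<forall>q. F (rep_proj q) \<noteq> 0 \<longrightarrow> q \<in> a \<inter> b)"
        using form_fun_mult[OF k F(1) G(1)] F G
        by (intro exI[of _ "\<lambda>v. F v * G v"] exI[of _ "d + e"]) simp
    qed
  next
    case (UN K)
    show ?case
    proof
      fix p assume "p \<in> \<Union>K"
      then obtain a where a: "a \<in> K" "p \<in> a" by blast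
      obtain F d where "form_fun k d F" "F (rep_proj p) \<noteq> 0" "\<forall>q. F (rep_proj q) \<noteq> 0 \<longrightarrow> q \<in> a"
        using bspec[OF UN.IH[OF a(1)] a(2)] by (elim exE conjE)
      then show "\<exists>F d. form_fun k d F \<and> F (rep_proj p) \<noteq> 0 \<and> (\<forall>q. F (rep_proj q) \<noteq> 0 \<longrightarrow> q \<in> \<Union>K)"
        using a(1) by (intro exI[of _ F] exI[of _ d]) blast
    qed
  next
    case (Basis s)
    then show ?case by blast
  qed simp
next
  assume R: "?R W"
  show "openin (zariski k) W"
  proof (subst openin_subopen, intro ballI)
    fix p assume "p \<in> W"
    then obtain F d where F: "form_fun k d F" "F (rep_proj p) \<noteq> 0" "\<forall>q. F (rep_proj q) \<noteq> 0 \<longrightarrow> q \<in> W"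
      using R by blast
    show "\<exists>T. openin (zariski k) T \<and> p \<in> T \<and> T \<subseteq> W"
      using openin_zariski_basic[OF F(1)] F(2,3)
      by (intro exI[of _ "{p. F (rep_proj p) \<noteq> 0}"]) auto
  qed
qed

lemma topspace_zariski [simp]: assumes "ring_set k" shows "topspace (zariski k) = UNIV"
proof -
  have "form_fun k 0 (\<lambda>_. 1)" using assms by (intro form_fun_const) (auto simp: ring_set_def)
  from openin_zariski_basic[OF this] show ?thesis using openin_subset by fastforce
qed

lemma closedin_zariski_iff:
  assumes k: "ring_set k"
  shows "closedin (zariski k) V \<longleftrightarrow>
    (\<forall>p. p \<notin> V \<longrightarrow> (\<exists>F d. form_fun k d F \<and> F (rep_proj p) \<noteq> 0 \<and> (\<forall>q\<in>V. F (rep_proj q) = 0)))"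
  unfolding closedin_def topspace_zariski[OF k] openin_zariski_iff[OF k]
  by (simp add: Ball_def Compl_eq_Diff_UNIV[symmetric]) blast

lemma closedin_zariski_zeros:
  assumes k: "ring_set k" and "form_fun k d F"
  shows "closedin (zariski k) {p. F (rep_proj p) = 0}"
  using openin_zariski_basic[OF assms(2)] unfolding closedin_def topspace_zariski[OF k]
  by (simp add: Diff_eq Compl_eq)

lemma irreducible_openin_Int:
  assumes "irreducible_subset \<T> S" "openin \<T> U" "openin \<T> W" "S \<inter> U \<noteq> {}" "S \<inter> W \<noteq> {}"
  shows "S \<inter> U \<inter> W \<noteq> {}"
proof
  assume "S \<inter> U \<inter> W = {}"
  then have "S \<subseteq> (topspace \<T> - U) \<union> (topspace \<T> - W)"
    using assms(1) by (auto simp: irreducible_subset_def)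
  then have "S \<subseteq> topspace \<T> - U \<or> S \<subseteq> topspace \<T> - W"
    using assms(1,2,3) unfolding irreducible_subset_def by (meson closedin_diff closedin_topspace)
  then show False using assms(4,5) by blast
qed

lemma irreducible_subset_closure:
  assumes "irreducible_subset \<T> S" "openin (subtopology \<T> S) U" "U \<noteq> {}"
  shows "S \<subseteq> \<T> closure_of U"
proof
  fix p assume p: "p \<in> S"
  obtain W where W: "openin \<T> W" "U = W \<inter> S" using assms(2) by (auto simp: openin_subtopology)
  show "p \<in> \<T> closure_of U"
    unfolding in_closure_of
  proof (intro conjI allI impI)
    show "p \<in> topspace \<T>" using p assms(1) by (auto simp: irreducible_subset_def)
  next
    fix O' assume "p \<in> O' \<and> openin \<T> O'"
    then show "\<exists>y. y \<in> U \<and> y \<in> O'"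
      using irreducible_openin_Int[OF assms(1) W(1), of O'] W assms(3) p by blast
  qed
qed

lemma irreducible_openin_subtopology_Int:
  assumes "irreducible_subset \<T> S" "openin (subtopology \<T> S) U" "openin (subtopology \<T> S) W"
    "U \<noteq> {}" "W \<noteq> {}"
  shows "U \<inter> W \<noteq> {}"
proof -
  obtain U' W' where "openin \<T> U'" "U = U' \<inter> S" "openin \<T> W'" "W = W' \<inter> S"
    using assms(2,3) by (auto simp: openin_subtopology)
  then show ?thesis using irreducible_openin_Int[OF assms(1), of U' W'] assms(4,5) by blast
qed

lemma irreducible_form_fun:
  assumes "irreducible_subset (zariski UNIV) S" "form_fun UNIV d F" "form_fun UNIV e G"
    and "\<And>p. p \<in> S \<Longrightarrow> F (rep_proj p) = 0 \<or> G (rep_proj p) = 0"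
  shows "(\<forall>p\<in>S. F (rep_proj p) = 0) \<or> (\<forall>p\<in>S. G (rep_proj p) = 0)"
proof -
  have "S \<subseteq> {p. F (rep_proj p) = 0} \<union> {p. G (rep_proj p) = 0}" using assms(4) by blast
  then have "S \<subseteq> {p. F (rep_proj p) = 0} \<or> S \<subseteq> {p. G (rep_proj p) = 0}"
    using assms(1) closedin_zariski_zeros[OF ring_set_UNIV assms(2)]
      closedin_zariski_zeros[OF ring_set_UNIV assms(3)]
    unfolding irreducible_subset_def by blast
  then show ?thesis by blast
qed

lemma form_fun_vanishes_on_closure:
  assumes "B \<subseteq> zariski UNIV closure_of S" "form_fun UNIV d F" "\<And>p. p \<in> S \<Longrightarrow> F (rep_proj p) = 0"
    and "p \<in> B"
  shows "F (rep_proj p) = 0"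
proof -
  have "zariski UNIV closure_of S \<subseteq> {p. F (rep_proj p) = 0}"
    by (rule closure_of_minimal)
      (use assms(3) in blast, rule closedin_zariski_zeros[OF ring_set_UNIV assms(2)])
  then show ?thesis using assms(1,4) by blast
qed

section \<open>The Segre embedding on coordinate vectors\<close>

definition segre_vec :: "complex ^ 'n::finite \<Rightarrow> complex ^ 'm::finite \<Rightarrow> complex ^ ('n \<times> 'm)" where
  "segre_vec v w = (\<chi> ij. v $ fst ij * w $ snd ij)"

lemma segre_vec_nth [simp]: "segre_vec v w $ (i, j) = v $ i * w $ j"
  by (simp add: segre_vec_def)

lemma segre_vec_nonzero:
  assumes "v \<noteq> 0" "w \<noteq> 0" shows "segre_vec v w \<noteq> 0"
proof -
  obtain i j where "v $ i \<noteq> 0" "w $ j \<noteq> 0" using vec_nonzero[OF assms(1)] vec_nonzero[OF assms(2)] by blast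
  then have "segre_vec v w $ (i, j) \<noteq> 0" by simp
  then show ?thesis by (metis zero_index)
qed

lemma segre_alt: "segre p q = abs_proj (segre_vec (rep_proj p) (rep_proj q))"
  by (simp add: segre_def segre_vec_def)

lemma segre_vec_scale: "segre_vec (c *s v) (d *s w) = (c * d) *s segre_vec v w"
  by (simp add: segre_vec_def vec_eq_iff)

lemma segre_abs_proj:
  assumes "v \<noteq> 0" "w \<noteq> 0"
  shows "segre (abs_proj v) (abs_proj w) = abs_proj (segre_vec v w)"
proof -
  obtain c where c: "c \<noteq> 0" "rep_proj (abs_proj v) = c *s v" using rep_abs_proj[OF assms(1)] .
  obtain d where d: "d \<noteq> 0" "rep_proj (abs_proj w) = d *s w" using rep_abs_proj[OF assms(2)] .
  have "abs_proj (segre_vec v w) = abs_proj ((c * d) *s segre_vec v w)"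
    using c d assms segre_vec_nonzero[OF assms]
    by (subst abs_proj_eq_iff) (auto simp: vector_mul_eq_0 intro!: exI[of _ "c * d"])
  then show ?thesis by (simp add: segre_alt c d segre_vec_scale)
qed

lemma form_fun_rep_segre:
  assumes "form_fun k d H"
  shows "H (rep_proj (segre p q)) = 0 \<longleftrightarrow> H (segre_vec (rep_proj p) (rep_proj q)) = 0"
  unfolding segre_alt by (rule form_fun_rep_abs[OF assms segre_vec_nonzero]) simp_all

lemma segre_inject: "segre p q = segre p' q' \<longleftrightarrow> p = p' \<and> q = q'"
proof
  assume eq: "segre p q = segre p' q'"
  let ?v = "rep_proj p" and ?w = "rep_proj q" and ?v' = "rep_proj p'" and ?w' = "rep_proj q'"
  have minors: "?v $ i * ?w $ j * (?v' $ i' * ?w' $ j') = ?v $ i' * ?w $ j' * (?v' $ i * ?w' $ j)" for i j i' j'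
    using iffD1[OF abs_proj_eq_minors[OF segre_vec_nonzero segre_vec_nonzero] eq[unfolded segre_alt],
        rule_format, of "(i, j)" "(i', j')"] by simp
  obtain i0 j0 where "?v $ i0 \<noteq> 0" "?w $ j0 \<noteq> 0" using vec_nonzero[OF rep_proj_nonzero] by metis
  moreover obtain i j where ij: "?v' $ i \<noteq> 0" "?w' $ j \<noteq> 0"
    using vec_nonzero[OF rep_proj_nonzero] by metis
  ultimately have "?v $ i0 * ?w $ j0 * (?v' $ i * ?w' $ j) \<noteq> 0" by simp
  \<comment> \<open>The minor turns a nonzero product into one that contains coordinates
    \<open>i\<close> and \<open>j\<close> of the unprimed vectors. At these indices all four vectors
    are nonzero, so the factors cancel below.\<close>
  then have ij': "?v $ i \<noteq> 0" "?w $ j \<noteq> 0" unfolding minors[of i0 j0] by auto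
  have "abs_proj ?v = abs_proj ?v'"
  proof (subst abs_proj_eq_minors, simp, simp, intro allI)
    fix l l'
    have "?w $ j * ?w' $ j * (?v $ l * ?v' $ l') = ?w $ j * ?w' $ j * (?v $ l' * ?v' $ l)"
      using minors[of l j l' j] by (simp add: ac_simps)
    then show "?v $ l * ?v' $ l' = ?v $ l' * ?v' $ l" using ij ij' by simp
  qed
  moreover have "abs_proj ?w = abs_proj ?w'"
  proof (subst abs_proj_eq_minors, simp, simp, intro allI)
    fix l l'
    have "?v $ i * ?v' $ i * (?w $ l * ?w' $ l') = ?v $ i * ?v' $ i * (?w $ l' * ?w' $ l)"
      using minors[of i l i l'] by (simp add: ac_simps)
    then show "?w $ l * ?w' $ l' = ?w $ l' * ?w' $ l" using ij ij' by simp
  qed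
  ultimately show "p = p' \<and> q = q'" by simp
qed simp

section \<open>Generic points of families\<close>

text \<open>The index \<open>c\<close> packs several binary operations into one function. The
  superset is the union of countably many stages, each adding the values on the previous
  one.\<close>

lemma countable_closed_superset:
  fixes f :: "'c::countable \<Rightarrow> 'a \<Rightarrow> 'a \<Rightarrow> 'a"
  assumes "countable A"
  shows "\<exists>R. countable R \<and> A \<subseteq> R \<and> (\<forall>c. \<forall>x\<in>R. \<forall>y\<in>R. f c x y \<in> R)"
proof -
  define g where "g X = X \<union> (\<lambda>(c, x, y). f c x y) ` (UNIV \<times> X \<times> X)" for X
  define R where "R = (\<Union>n. (g ^^ n) A)"
  have "countable ((g ^^ n) A)" for n
    by (induction n) (auto simp: g_def assms)
  then have "countable R" by (auto simp: R_def)
  moreover have "A \<subseteq> R" using UN_upper[of 0 UNIV "\<lambda>n. (g ^^ n) A"] by (simp add: R_def)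
  moreover have "f c x y \<in> R" if xy: "x \<in> R" "y \<in> R" for c x y
  proof -
    have mono: "(g ^^ m) A \<subseteq> (g ^^ n) A" if "m \<le> n" for m n
      using that by (rule lift_Suc_mono_le[rotated]) (auto simp: g_def)
    obtain m n where "x \<in> (g ^^ m) A" "y \<in> (g ^^ n) A" using xy by (auto simp: R_def)
    then have "x \<in> (g ^^ max m n) A" "y \<in> (g ^^ max m n) A"
      using mono[of m "max m n"] mono[of n "max m n"] by auto
    then have "f c x y \<in> g ((g ^^ max m n) A)" by (force simp: g_def)
    then have "f c x y \<in> (g ^^ Suc (max m n)) A" by simp
    then show ?thesis unfolding R_def by blast
  qed
  ultimately show ?thesis by (intro exI[of _ R]) simp
qed

lemma countable_ring_hull:
  assumes "countable A"
  obtains R where "countable R" "A \<subseteq> R" "ring_set R"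
proof -
  define f :: "nat \<Rightarrow> complex \<Rightarrow> complex \<Rightarrow> complex"
    where "f n x y = (if n = 0 then x + y else if n = 1 then x - y else x * y)" for n x y
  have "countable (A \<union> {0, 1})" using assms by simp
  from countable_closed_superset[OF this, of f] obtain R where
    R: "countable R" "A \<union> {0, 1} \<subseteq> R" "\<forall>n. \<forall>x\<in>R. \<forall>y\<in>R. f n x y \<in> R"
    by (elim exE conjE)
  have "ring_set R"
    using R(2) spec[OF R(3), of 0] spec[OF R(3), of 1] spec[OF R(3), of 2]
    by (simp add: f_def ring_set_def)
  then show ?thesis using that[OF R(1)] R(2) by simp
qed

text \<open>Meaningful only for points with nonzero \<open>i\<close>-th coordinate, since \<open>1 / 0 = 0\<close>.\<close>

definition affine_vec :: "'n \<Rightarrow> ('n::finite) proj \<Rightarrow> complex ^ 'n" where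
  "affine_vec i p = (1 / rep_proj p $ i) *s rep_proj p"

section \<open>Affine charts of a family and their coordinate rings\<close>

definition chart ::
  "(('n::finite) proj \<times> ('m::finite) proj) set \<Rightarrow> 'n \<Rightarrow> 'm \<Rightarrow> ('n proj \<times> 'm proj) set" where
  "chart C i j = {(p, q) \<in> C. rep_proj p $ i \<noteq> 0 \<and> rep_proj q $ j \<noteq> 0}"

definition affine_segre :: "'n \<Rightarrow> 'm \<Rightarrow> ('n::finite) proj \<times> ('m::finite) proj \<Rightarrow> complex ^ ('n \<times> 'm)" where
  "affine_segre i j s = segre_vec (affine_vec i (fst s)) (affine_vec j (snd s))"

text \<open>Values off the chart are arbitrary; only the quotient by \<open>chart_ideal\<close> is
  the coordinate ring of the chart. All degrees occur together because the normalised coordinate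
  \<open>(i, j)\<close> is 1 on the chart.\<close>

definition chart_ring ::
  "(('n::finite) proj \<times> ('m::finite) proj) set \<Rightarrow> 'n \<Rightarrow> 'm \<Rightarrow> ('n proj \<times> 'm proj \<Rightarrow> complex) set" where
  "chart_ring C i j =
     {f. \<exists>d H. form_fun UNIV d H \<and> (\<forall>s\<in>chart C i j. f s = H (affine_segre i j s))}"

definition chart_ideal ::
  "(('n::finite) proj \<times> ('m::finite) proj) set \<Rightarrow> 'n \<Rightarrow> 'm \<Rightarrow> ('n proj \<times> 'm proj \<Rightarrow> complex) set" where
  "chart_ideal C i j = {f. \<forall>s\<in>chart C i j. f s = 0}"

lemma affine_vec_nth [simp]: "affine_vec i p $ l = rep_proj p $ l / rep_proj p $ i"
  by (simp add: affine_vec_def)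

lemma affine_segre_nth [simp]:
  "affine_segre i j s $ (l, m) = affine_vec i (fst s) $ l * affine_vec j (snd s) $ m"
  by (simp add: affine_segre_def)

lemma form_fun_affine_vec:
  assumes "form_fun k d F" "rep_proj p $ i \<noteq> 0"
  shows "F (affine_vec i p) = 0 \<longleftrightarrow> F (rep_proj p) = 0"
  using assms by (simp add: affine_vec_def form_fun_homogeneous[OF assms(1)])

lemma form_fun_affine_segre:
  assumes "form_fun k d H" "(p, q) \<in> chart C i j"
  shows "H (affine_segre i j (p, q)) = 0 \<longleftrightarrow> H (segre_vec (rep_proj p) (rep_proj q)) = 0"
  using assms(2)
  by (simp add: affine_segre_def affine_vec_def segre_vec_scale form_fun_homogeneous[OF assms(1)] chart_def)

text \<open>A power of a coordinate that is 1 on the chart raises the degree without changing the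
  values there, so forms of different degrees can be subtracted.\<close>

lemma form_fun_coord_power: "form_fun UNIV d H \<Longrightarrow> form_fun UNIV (d + e) (\<lambda>z. H z * (z $ ij) ^ e)"
  using form_fun_mult[of UNIV d H "1 * e"] form_fun_power[of UNIV 1 "\<lambda>z. z $ ij" e]
    form_fun_coord[of UNIV ij] by simp

context
  fixes C :: "(('n::finite) proj \<times> ('m::finite) proj) set" and i :: 'n and j :: 'm
  assumes irr: "irreducible_subset (zariski UNIV) (segre_image C)"
begin

lemma irreducible_segre_forms:
  assumes "form_fun UNIV d F" "form_fun UNIV e G"
    and "\<And>p q. (p, q) \<in> C \<Longrightarrow>
      F (segre_vec (rep_proj p) (rep_proj q)) = 0 \<or> G (segre_vec (rep_proj p) (rep_proj q)) = 0"
  shows "(\<forall>(p, q)\<in>C. F (segre_vec (rep_proj p) (rep_proj q)) = 0) \<or>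
    (\<forall>(p, q)\<in>C. G (segre_vec (rep_proj p) (rep_proj q)) = 0)"
proof -
  have "(\<forall>x\<in>segre_image C. F (rep_proj x) = 0) \<or> (\<forall>x\<in>segre_image C. G (rep_proj x) = 0)"
    by (rule irreducible_form_fun[OF irr assms(1,2)])
      (use assms(3) in \<open>fastforce simp: segre_image_def form_fun_rep_segre[OF assms(1)]
        form_fun_rep_segre[OF assms(2)]\<close>)
  then show ?thesis
    by (auto simp: segre_image_def form_fun_rep_segre[OF assms(1)] form_fun_rep_segre[OF assms(2)])
qed

lemma prime_ideal_on_chart: "prime_ideal_on (chart_ring C i j) (chart_ideal C i j)"
proof
  show "1 \<in> chart_ring C i j"
    unfolding chart_ring_def using form_fun_const[of UNIV 1] by force
next
  fix f g assume "f \<in> chart_ring C i j" "g \<in> chart_ring C i j"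
  then obtain d H e G where H: "form_fun UNIV d H" "\<And>s. s \<in> chart C i j \<Longrightarrow> f s = H (affine_segre i j s)"
    and G: "form_fun UNIV e G" "\<And>s. s \<in> chart C i j \<Longrightarrow> g s = G (affine_segre i j s)"
    unfolding chart_ring_def by blast
  have one: "affine_segre i j s $ (i, j) = 1" if "s \<in> chart C i j" for s
    using that by (auto simp: chart_def)
  have "form_fun UNIV (d + e) (\<lambda>z. H z * (z $ (i, j)) ^ e - G z * (z $ (i, j)) ^ d)"
    using form_fun_coord_power[OF H(1), of e "(i, j)"] form_fun_coord_power[OF G(1), of d "(i, j)"]
    by (intro form_fun_diff) (simp_all add: add.commute)
  then show "f - g \<in> chart_ring C i j" using H(2) G(2) one unfolding chart_ring_def by force
  show "f * g \<in> chart_ring C i j"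
    using form_fun_mult[OF ring_set_UNIV H(1) G(1)] H(2) G(2) unfolding chart_ring_def by force
  assume fg: "f * g \<in> chart_ideal C i j"
  \<comment> \<open>The extra coordinate vanishes outside the chart, so the product of the two forms
    vanishes on all of \<open>C\<close> and irreducibility applies.\<close>
  have "form_fun UNIV (d + 1) (\<lambda>z. H z * (z $ (i, j)))"
    using form_fun_coord_power[OF H(1), of 1] by simp
  then have "(\<forall>(p, q)\<in>C. H (segre_vec (rep_proj p) (rep_proj q)) * segre_vec (rep_proj p) (rep_proj q) $ (i, j) = 0) \<or>
    (\<forall>(p, q)\<in>C. G (segre_vec (rep_proj p) (rep_proj q)) = 0)"
    using G(1)
  proof (rule irreducible_segre_forms)
    fix p q assume pq: "(p, q) \<in> C"
    show "H (segre_vec (rep_proj p) (rep_proj q)) * segre_vec (rep_proj p) (rep_proj q) $ (i, j) = 0 \<or>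
      G (segre_vec (rep_proj p) (rep_proj q)) = 0"
    proof (cases "(p, q) \<in> chart C i j")
      case True
      have "H (affine_segre i j (p, q)) * G (affine_segre i j (p, q)) = 0"
        using fg True H(2) G(2) by (simp add: chart_ideal_def)
      then show ?thesis
        using form_fun_affine_segre[OF H(1) True] form_fun_affine_segre[OF G(1) True] by auto
    qed (use pq in \<open>auto simp: chart_def\<close>)
  qed
  then show "f \<in> chart_ideal C i j \<or> g \<in> chart_ideal C i j"
  proof
    assume *: "\<forall>(p, q)\<in>C. H (segre_vec (rep_proj p) (rep_proj q)) * segre_vec (rep_proj p) (rep_proj q) $ (i, j) = 0"
    have "f (p, q) = 0" if s: "(p, q) \<in> chart C i j" for p q
      using * s H(2)[OF s] form_fun_affine_segre[OF H(1) s] by (auto simp: chart_def)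
    then show ?thesis by (auto simp: chart_ideal_def)
  next
    assume *: "\<forall>(p, q)\<in>C. G (segre_vec (rep_proj p) (rep_proj q)) = 0"
    have "g (p, q) = 0" if s: "(p, q) \<in> chart C i j" for p q
      using * s G(2)[OF s] form_fun_affine_segre[OF G(1) s] by (auto simp: chart_def)
    then show ?thesis by (auto simp: chart_ideal_def)
  qed
next
  show "0 \<in> chart_ideal C i j" by (simp add: chart_ideal_def)
qed (auto simp: chart_ideal_def)

text \<open>A nonempty chart is dense. The coordinate \<open>(i, j)\<close> vanishes outside the
  chart but not on all of \<open>C\<close>, so by irreducibility it is \<open>H\<close> that
  vanishes on all of \<open>C\<close>.\<close>

lemma segre_form_vanishes:
  assumes "chart C i j \<noteq> {}" and H: "form_fun UNIV d H"
    and "\<And>s. s \<in> chart C i j \<Longrightarrow> H (affine_segre i j s) = 0" and "(p, q) \<in> C"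
  shows "H (segre_vec (rep_proj p) (rep_proj q)) = 0"
proof -
  have coord: "form_fun UNIV 1 (\<lambda>z :: complex ^ ('n \<times> 'm). z $ (i, j))"
    by (rule form_fun_coord) auto
  have "(\<forall>(p, q)\<in>C. segre_vec (rep_proj p) (rep_proj q) $ (i, j) = 0) \<or>
    (\<forall>(p, q)\<in>C. H (segre_vec (rep_proj p) (rep_proj q)) = 0)"
  proof (rule irreducible_segre_forms[OF coord H])
    fix p q assume pq: "(p, q) \<in> C"
    show "segre_vec (rep_proj p) (rep_proj q) $ (i, j) = 0 \<or> H (segre_vec (rep_proj p) (rep_proj q)) = 0"
    proof (cases "(p, q) \<in> chart C i j")
      case True
      then show ?thesis using form_fun_affine_segre[OF H True] assms(3)[OF True] by simp
    qed (use pq in \<open>auto simp: chart_def\<close>)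
  qed
  moreover have "\<exists>(p, q)\<in>C. segre_vec (rep_proj p) (rep_proj q) $ (i, j) \<noteq> 0"
    using assms(1) by (force simp: chart_def)
  ultimately show ?thesis using assms(4) by blast
qed

text \<open>A form in the first factor can be evaluated on a column of the Segre matrix, which is a
  multiple of the first vector. The column is chosen so that the scalar is nonzero at
  \<open>q\<close>.\<close>

lemma fst_form_vanishes:
  assumes ne: "chart C i j \<noteq> {}" and F: "form_fun UNIV d F"
    and "\<And>s. s \<in> chart C i j \<Longrightarrow> F (affine_vec i (fst s)) = 0" and pq: "(p, q) \<in> C"
  shows "F (rep_proj p) = 0"
proof -
  obtain m where m: "rep_proj q $ m \<noteq> 0" using vec_nonzero[OF rep_proj_nonzero] by blast
  define H where "H z = F (\<chi> l. z $ (l, m))" for z :: "complex ^ ('n \<times> 'm)"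
  have coord: "form_fun UNIV 1 (\<lambda>z :: complex ^ ('n \<times> 'm). z $ lm)" for lm
    by (rule form_fun_coord) auto
  have H: "form_fun UNIV d H"
    using form_fun_compose[OF ring_set_UNIV F, of 1 "\<lambda>l z. z $ (l, m)", OF coord]
    by (simp add: H_def[abs_def])
  have eq: "H (segre_vec v w) = (w $ m) ^ d * F v" for v w
  proof -
    have "(\<chi> l. segre_vec v w $ (l, m)) = (w $ m) *s v" by (simp add: vec_eq_iff)
    then show ?thesis using form_fun_homogeneous[OF F] by (simp add: H_def)
  qed
  have "H (segre_vec (rep_proj p) (rep_proj q)) = 0"
    by (rule segre_form_vanishes[OF ne H _ pq]) (simp add: affine_segre_def eq assms(3))
  then show ?thesis using m by (simp add: eq)
qed

lemma snd_form_vanishes: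
  assumes ne: "chart C i j \<noteq> {}" and F: "form_fun UNIV d F"
    and "\<And>s. s \<in> chart C i j \<Longrightarrow> F (affine_vec j (snd s)) = 0" and pq: "(p, q) \<in> C"
  shows "F (rep_proj q) = 0"
proof -
  obtain m where m: "rep_proj p $ m \<noteq> 0" using vec_nonzero[OF rep_proj_nonzero] by blast
  define H where "H z = F (\<chi> l. z $ (m, l))" for z :: "complex ^ ('n \<times> 'm)"
  have coord: "form_fun UNIV 1 (\<lambda>z :: complex ^ ('n \<times> 'm). z $ lm)" for lm
    by (rule form_fun_coord) auto
  have H: "form_fun UNIV d H"
    using form_fun_compose[OF ring_set_UNIV F, of 1 "\<lambda>l z. z $ (m, l)", OF coord]
    by (simp add: H_def[abs_def])
  have eq: "H (segre_vec v w) = (v $ m) ^ d * F w" for v w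
  proof -
    have "(\<chi> l. segre_vec v w $ (m, l)) = (v $ m) *s w" by (simp add: vec_eq_iff)
    then show ?thesis using form_fun_homogeneous[OF F] by (simp add: H_def)
  qed
  have "H (segre_vec (rep_proj p) (rep_proj q)) = 0"
    by (rule segre_form_vanishes[OF ne H _ pq]) (simp add: affine_segre_def eq assms(3))
  then show ?thesis using m by (simp add: eq)
qed

lemma coordinates_in_chart_ring:
  "(\<lambda>s. affine_vec i (fst s) $ l) \<in> chart_ring C i j"
  "(\<lambda>s. affine_vec j (snd s) $ m) \<in> chart_ring C i j"
proof -
  have "affine_vec i (fst s) $ l = affine_segre i j s $ (l, j)"
    "affine_vec j (snd s) $ m = affine_segre i j s $ (i, m)" if "s \<in> chart C i j" for s
    using that by (auto simp: chart_def)
  moreover have "form_fun UNIV 1 (\<lambda>z :: complex ^ ('n \<times> 'm). z $ lm)" for lm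
    by (rule form_fun_coord) auto
  ultimately show "(\<lambda>s. affine_vec i (fst s) $ l) \<in> chart_ring C i j"
    "(\<lambda>s. affine_vec j (snd s) $ m) \<in> chart_ring C i j"
    unfolding chart_ring_def by blast+
qed

text \<open>The homomorphism from the coordinate ring of \<open>C\<close> over \<open>R\<close> is built one coordinate at a time.\<close>

lemma generic_homomorphism:
  assumes ne: "chart C i j \<noteq> {}" and R: "countable R" "ring_set R"
  shows "\<exists>a e. a \<noteq> 0 \<and> e \<noteq> 0 \<and>
    (\<forall>d F. form_fun R d F \<longrightarrow> (F a = 0 \<longleftrightarrow> (\<forall>(p, q)\<in>C. F (rep_proj p) = 0))) \<and>
    (\<forall>d F. form_fun R d F \<longrightarrow> (F e = 0 \<longleftrightarrow> (\<forall>(p, q)\<in>C. F (rep_proj q) = 0))) \<and>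
    (\<forall>d H. form_fun R d H \<longrightarrow> (\<forall>(p, q)\<in>C. H (segre_vec (rep_proj p) (rep_proj q)) = 0) \<longrightarrow>
       H (segre_vec a e) = 0)"
proof -
  interpret prime_ideal_on "chart_ring C i j" "chart_ideal C i j" by (rule prime_ideal_on_chart)
  \<comment> \<open>Each constant of \<open>R\<close> is matched with itself, which makes the
    homomorphism one over \<open>R\<close>.\<close>
  define \<Gamma>0 where "\<Gamma>0 = (\<lambda>c. ((\<lambda>_ :: 'n proj \<times> 'm proj. c), c)) ` R"
  have const: "(\<lambda>_. c) \<in> chart_ring C i j" for c
    unfolding chart_ring_def using form_fun_const[of UNIV c] by force
  have "partial_iso \<Gamma>0"
    unfolding partial_iso_def ring_rel_def
  proof (intro conjI allI impI)
    show "(1, 1) \<in> \<Gamma>0" using R(2) by (auto simp: \<Gamma>0_def ring_set_def image_iff fun_eq_iff)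
    show "(f - g, b - d) \<in> \<Gamma>0" "(f * g, b * d) \<in> \<Gamma>0" if "(f, b) \<in> \<Gamma>0" "(g, d) \<in> \<Gamma>0" for f g b d
      using that R(2) by (auto simp: \<Gamma>0_def ring_set_def image_iff fun_eq_iff)
    show "fst ` \<Gamma>0 \<subseteq> chart_ring C i j" using const by (auto simp: \<Gamma>0_def)
    show "f \<in> chart_ideal C i j \<longleftrightarrow> c = 0" if "(f, c) \<in> \<Gamma>0" for f c
      using that ne by (auto simp: \<Gamma>0_def chart_ideal_def)
  qed
  moreover have "countable \<Gamma>0" using R(1) by (simp add: \<Gamma>0_def)
  moreover define X where "X = range (\<lambda>l s. affine_vec i (fst s) $ l) \<union> range (\<lambda>m s. affine_vec j (snd s) $ m)"
  have "countable X" by (simp add: X_def countable_finite)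
  moreover have "X \<subseteq> chart_ring C i j" using coordinates_in_chart_ring by (auto simp: X_def)
  ultimately obtain \<Gamma> where pi: "partial_iso \<Gamma>" and "\<Gamma>0 \<subseteq> \<Gamma>" "X \<subseteq> Domain \<Gamma>"
    using partial_iso_extend[of \<Gamma>0 X] by blast
  note rr = partial_isoD(1)[OF pi] and zero = partial_isoD(3)[OF pi]
  have "\<forall>l. \<exists>y. ((\<lambda>s. affine_vec i (fst s) $ l), y) \<in> \<Gamma>" "\<forall>m. \<exists>y. ((\<lambda>s. affine_vec j (snd s) $ m), y) \<in> \<Gamma>"
    using \<open>X \<subseteq> Domain \<Gamma>\<close> by (force simp: X_def)+
  then obtain a' e' where ae': "\<And>l. ((\<lambda>s. affine_vec i (fst s) $ l), a' l) \<in> \<Gamma>"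
    "\<And>m. ((\<lambda>s. affine_vec j (snd s) $ m), e' m) \<in> \<Gamma>"
    by metis
  define a where "a = (\<chi> l. a' l)"
  define e where "e = (\<chi> m. e' m)"
  have a: "((\<lambda>s. affine_vec i (fst s) $ l), a $ l) \<in> \<Gamma>" for l using ae' by (simp add: a_def)
  have e: "((\<lambda>s. affine_vec j (snd s) $ m), e $ m) \<in> \<Gamma>" for m using ae' by (simp add: e_def)
  have c: "((\<lambda>_. c), c) \<in> \<Gamma>" if "c \<in> R" for c using that \<open>\<Gamma>0 \<subseteq> \<Gamma>\<close> by (auto simp: \<Gamma>0_def)
  \<comment> \<open>The normalising coordinates are 1 on the chart and so lie outside the ideal.
    Hence neither image vector is 0 and both define projective points.\<close>
  have "(\<lambda>s. affine_vec i (fst s) $ i) \<notin> chart_ideal C i j" "(\<lambda>s. affine_vec j (snd s) $ j) \<notin> chart_ideal C i j"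
    using ne by (auto simp: chart_ideal_def chart_def)
  then have "a $ i \<noteq> 0" "e $ j \<noteq> 0" using zero[OF a[of i]] zero[OF e[of j]] by auto
  then have "a \<noteq> 0" "e \<noteq> 0" by auto
  moreover have "F a = 0 \<longleftrightarrow> (\<forall>(p, q)\<in>C. F (rep_proj p) = 0)" if F: "form_fun R d F" for d F
  proof -
    have "((\<lambda>s. F (affine_vec i (fst s))), F a) \<in> \<Gamma>"
      using ring_rel_form_fun[OF rr F c a] by (simp only: vec_lambda_eta)
    from zero[OF this] have "F a = 0 \<longleftrightarrow> (\<forall>s\<in>chart C i j. F (affine_vec i (fst s)) = 0)"
      by (simp only: chart_ideal_def mem_Collect_eq)
    also have "\<dots> \<longleftrightarrow> (\<forall>(p, q)\<in>C. F (rep_proj p) = 0)"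
      using fst_form_vanishes[OF ne form_fun_mono[OF subset_UNIV F]] form_fun_affine_vec[OF F]
      by (fastforce simp: chart_def)
    finally show ?thesis .
  qed
  moreover have "F e = 0 \<longleftrightarrow> (\<forall>(p, q)\<in>C. F (rep_proj q) = 0)" if F: "form_fun R d F" for d F
  proof -
    have "((\<lambda>s. F (affine_vec j (snd s))), F e) \<in> \<Gamma>"
      using ring_rel_form_fun[OF rr F c e] by (simp only: vec_lambda_eta)
    from zero[OF this] have "F e = 0 \<longleftrightarrow> (\<forall>s\<in>chart C i j. F (affine_vec j (snd s)) = 0)"
      by (simp only: chart_ideal_def mem_Collect_eq)
    also have "\<dots> \<longleftrightarrow> (\<forall>(p, q)\<in>C. F (rep_proj q) = 0)"
      using snd_form_vanishes[OF ne form_fun_mono[OF subset_UNIV F]] form_fun_affine_vec[OF F]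
      by (fastforce simp: chart_def)
    finally show ?thesis .
  qed
  moreover have "H (segre_vec a e) = 0"
    if H: "form_fun R d H" and 0: "\<forall>(p, q)\<in>C. H (segre_vec (rep_proj p) (rep_proj q)) = 0" for d H
  proof -
    have "((\<lambda>s. affine_vec i (fst s) $ fst lm) * (\<lambda>s. affine_vec j (snd s) $ snd lm), segre_vec a e $ lm) \<in> \<Gamma>" for lm
      using ring_rel_mult[OF rr a e] by (simp add: segre_vec_def)
    from ring_rel_form_fun[OF rr H c this]
    have "((\<lambda>s. H (\<chi> lm. affine_vec i (fst s) $ fst lm * affine_vec j (snd s) $ snd lm)), H (segre_vec a e)) \<in> \<Gamma>"
      by simp
    then have "((\<lambda>s. H (affine_segre i j s)), H (segre_vec a e)) \<in> \<Gamma>"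
      unfolding affine_segre_def segre_vec_def .
    moreover have "(\<lambda>s. H (affine_segre i j s)) \<in> chart_ideal C i j"
      using form_fun_affine_segre[OF H] 0 by (fastforce simp: chart_ideal_def chart_def)
    ultimately show ?thesis using zero by blast
  qed
  ultimately show ?thesis by (intro exI[of _ a] exI[of _ e] conjI allI impI)
qed

end

text \<open>The point has as coordinates the images of the affine coordinate functions under a
  homomorphism over a countable ring that contains \<open>k\<close> and the coefficients of the
  forms in \<open>\<F>\<close>. A form over this ring in one of the factors vanishes at the point
  only if it vanishes on the whole projection of the family, which is dense in \<open>B\<close> and
  equal to \<open>T\<close>, respectively.\<close>

theorem generic_point_of_family:
  assumes k: "countable k" "ring_set k"
    and B: "closedin (zariski k) B" and T: "locally_closed k T" "T \<noteq> {}"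
    and fam: "covering_family B T \<C>"
    and C: "closedin (subtopology (zariski k) (segre_image (B \<times> T))) (segre_image \<C>)"
    and \<F>: "countable \<F>" "\<And>F. F \<in> \<F> \<Longrightarrow> \<exists>d. form_fun UNIV d F"
      "\<And>F. F \<in> \<F> \<Longrightarrow> \<exists>b\<in>B. F (rep_proj b) \<noteq> 0"
  obtains b t where "(b, t) \<in> \<C>" "\<And>F. F \<in> \<F> \<Longrightarrow> F (rep_proj b) \<noteq> 0" "very_general k T t"
proof -
  have irr: "irreducible_subset (zariski UNIV) (segre_image \<C>)" and sub: "\<C> \<subseteq> B \<times> T"
    and dense: "B \<subseteq> zariski UNIV closure_of (fst ` \<C>)"
    using fam by (auto simp: covering_family_def)
  \<comment> \<open>The members of the family are irreducible, hence nonempty, so the family maps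
    onto \<open>T\<close>.\<close>
  have snd: "\<exists>b. (b, t) \<in> \<C>" if "t \<in> T" for t
  proof -
    have "irreducible_curve (family_member \<C> t)" using fam that by (simp add: covering_family_def)
    then have "family_member \<C> t \<noteq> {}"
      by (simp add: irreducible_curve_def projective_variety_def irreducible_subset_def)
    then show ?thesis by (auto simp: family_member_def)
  qed
  then obtain b0 t0 where bt0: "(b0, t0) \<in> \<C>" using T(2) by blast
  obtain i j where ij: "rep_proj b0 $ i \<noteq> 0" "rep_proj t0 $ j \<noteq> 0"
    using vec_nonzero[OF rep_proj_nonzero[of b0]] vec_nonzero[OF rep_proj_nonzero[of t0]] by blast
  then have ne: "chart \<C> i j \<noteq> {}" using bt0 by (auto simp: chart_def)
  have "\<forall>F\<in>\<F>. \<exists>l d. finite l \<and> (\<forall>k'. l \<subseteq> k' \<and> 0 \<in> k' \<longrightarrow> form_fun k' d F)"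
    using \<F>(2) form_fun_coeffs_finite by metis
  then obtain l where l: "\<And>F. F \<in> \<F> \<Longrightarrow> finite (l F)"
    "\<And>F. F \<in> \<F> \<Longrightarrow> \<exists>d. \<forall>k'. l F \<subseteq> k' \<and> 0 \<in> k' \<longrightarrow> form_fun k' d F"
    by metis
  have "countable (k \<union> (\<Union>F\<in>\<F>. l F))" using k(1) \<F>(1) l(1) countable_finite by auto
  then obtain R where R: "countable R" "k \<union> (\<Union>F\<in>\<F>. l F) \<subseteq> R" "ring_set R"
    by (rule countable_ring_hull)
  have kR: "form_fun k d F \<Longrightarrow> form_fun R d F" for d and F :: "complex ^ 'z::finite \<Rightarrow> complex"
    using form_fun_mono[of k R] R(2) by blast
  from generic_homomorphism[OF irr ne R(1,3)] obtain a e where ae: "a \<noteq> 0" "e \<noteq> 0"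
    and a: "\<forall>d F. form_fun R d F \<longrightarrow> (F a = 0 \<longleftrightarrow> (\<forall>(p, q)\<in>\<C>. F (rep_proj p) = 0))"
    and e: "\<forall>d F. form_fun R d F \<longrightarrow> (F e = 0 \<longleftrightarrow> (\<forall>(p, q)\<in>\<C>. F (rep_proj q) = 0))"
    and H: "\<forall>d H. form_fun R d H \<longrightarrow> (\<forall>(p, q)\<in>\<C>. H (segre_vec (rep_proj p) (rep_proj q)) = 0) \<longrightarrow>
       H (segre_vec a e) = 0"
    by (elim exE conjE)
  define b where "b = abs_proj a"
  define t where "t = abs_proj e"
  have b: "F (rep_proj b) = 0 \<longleftrightarrow> (\<forall>(p, q)\<in>\<C>. F (rep_proj p) = 0)" if "form_fun R d F" for d F
    using form_fun_rep_abs[OF that ae(1)] a[rule_format, OF that] by (simp add: b_def)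
  have t: "F (rep_proj t) = 0 \<longleftrightarrow> (\<forall>(p, q)\<in>\<C>. F (rep_proj q) = 0)" if "form_fun R d F" for d F
    using form_fun_rep_abs[OF that ae(2)] e[rule_format, OF that] by (simp add: t_def)
  have t_nz: "G (rep_proj t) \<noteq> 0" if "form_fun k d G" "u \<in> T" "G (rep_proj u) \<noteq> 0" for d G u
    using t[OF kR[OF that(1)]] snd[OF that(2)] that(3) by blast
  have "b \<in> B"
  proof (rule ccontr)
    assume "b \<notin> B"
    then obtain F d where F: "form_fun k d F" "F (rep_proj b) \<noteq> 0" "\<forall>q\<in>B. F (rep_proj q) = 0"
      using B unfolding closedin_zariski_iff[OF k(2)] by blast
    then show False using b[OF kR[OF F(1)]] sub by blast
  qed
  \<comment> \<open>\<open>T\<close> is only locally closed. Forms vanishing on its closed part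
    vanish at \<open>t\<close>; for the open part a form is used that is nonzero somewhere on
    \<open>T\<close> and hence at \<open>t\<close>.\<close>
  moreover have "t \<in> T"
  proof -
    obtain Z W where Z: "closedin (zariski k) Z" and W: "openin (zariski k) W" and TZW: "T = Z \<inter> W"
      using T(1) by (auto simp: locally_closed_def)
    have "t \<in> Z"
    proof (rule ccontr)
      assume "t \<notin> Z"
      then obtain F d where F: "form_fun k d F" "F (rep_proj t) \<noteq> 0" "\<forall>q\<in>Z. F (rep_proj q) = 0"
        using Z unfolding closedin_zariski_iff[OF k(2)] by blast
      then show False using t[OF kR[OF F(1)]] sub TZW by blast
    qed
    moreover have "t \<in> W"
    proof -
      obtain u where u: "u \<in> T" using T(2) by blast
      then obtain G d where G: "form_fun k d G" "G (rep_proj u) \<noteq> 0" "\<forall>q. G (rep_proj q) \<noteq> 0 \<longrightarrow> q \<in> W"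
        using W TZW unfolding openin_zariski_iff[OF k(2)] by blast
      then show ?thesis using t_nz[OF G(1) u] by blast
    qed
    ultimately show ?thesis using TZW by blast
  qed
  ultimately have "segre b t \<in> segre_image (B \<times> T)" by (auto simp: segre_image_def)
  moreover obtain K where K: "closedin (zariski k) K" "segre_image \<C> = K \<inter> segre_image (B \<times> T)"
    using C unfolding closedin_subtopology by blast
  moreover have "segre b t \<in> K"
  proof (rule ccontr)
    assume "segre b t \<notin> K"
    then obtain G d where G: "form_fun k d G" "G (rep_proj (segre b t)) \<noteq> 0" "\<forall>q\<in>K. G (rep_proj q) = 0"
      using K(1) unfolding closedin_zariski_iff[OF k(2)] by blast
    have "G (segre_vec (rep_proj p) (rep_proj q)) = 0" if "(p, q) \<in> \<C>" for p q
    proof -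
      have "segre p q \<in> K" using K(2) that by (auto simp: segre_image_def)
      then show ?thesis using G(3) form_fun_rep_segre[OF G(1)] by blast
    qed
    then have "G (segre_vec a e) = 0" by (intro H[rule_format, OF kR[OF G(1)]]) blast
    then show False
      using G(2) form_fun_rep_abs[OF G(1) segre_vec_nonzero[OF ae]] segre_abs_proj[OF ae]
      by (simp add: b_def t_def)
  qed
  ultimately have "segre b t \<in> segre_image \<C>" by blast
  then have "(b, t) \<in> \<C>" by (auto simp: segre_image_def segre_inject)
  moreover have "F (rep_proj b) \<noteq> 0" if "F \<in> \<F>" for F
  proof
    assume "F (rep_proj b) = 0"
    moreover obtain d where d: "\<forall>k'. l F \<subseteq> k' \<and> 0 \<in> k' \<longrightarrow> form_fun k' d F" using l(2)[OF \<open>F \<in> \<F>\<close>] by blast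
    moreover have "l F \<subseteq> R" "0 \<in> R" using that R(2,3) by (auto simp: ring_set_def)
    ultimately have "\<forall>(p, q)\<in>\<C>. F (rep_proj p) = 0" using b[of d F] by simp
    \<comment> \<open>Vanishing on the image of the family spreads to its closure, which contains
      \<open>B\<close>.\<close>
    then have "F (rep_proj p) = 0" if "p \<in> fst ` \<C>" for p using that by auto
    moreover have "form_fun UNIV d F" using d by simp
    ultimately have "\<forall>p\<in>B. F (rep_proj p) = 0" using form_fun_vanishes_on_closure[OF dense] by blast
    then show False using \<F>(3)[OF that] by blast
  qed
  moreover have "very_general k T t"
    unfolding very_general_def
  proof (intro conjI allI impI)
    show "t \<in> T" by fact
    fix Z assume Z: "closedin (subtopology (zariski k) T) Z \<and> Z \<noteq> T"
    then obtain K where K: "closedin (zariski k) K" "Z = K \<inter> T" by (auto simp: closedin_subtopology)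
    then obtain u where u: "u \<in> T" "u \<notin> K" using Z by blast
    obtain G d where G: "form_fun k d G" "G (rep_proj u) \<noteq> 0" "\<forall>q\<in>K. G (rep_proj q) = 0"
      using K(1) u(2) unfolding closedin_zariski_iff[OF k(2)] by blast
    show "t \<notin> Z" using t_nz[OF G(1) u(1) G(2)] G(3) K(2) by blast
  qed
  ultimately show ?thesis by (rule that)
qed

section \<open>Conjugation by automorphisms of the complex numbers\<close>

text \<open>\<open>HOL-Algebra\<close> uses the notation \<open>inv\<close> for inverses in groups.\<close>

abbreviation finv :: "('a \<Rightarrow> 'b) \<Rightarrow> 'b \<Rightarrow> 'a" where
  "finv \<equiv> inv_into UNIV"

definition vmap :: "(complex \<Rightarrow> complex) \<Rightarrow> complex ^ 'n \<Rightarrow> complex ^ ('n::finite)" where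
  "vmap \<sigma> v = (\<chi> i. \<sigma> (v $ i))"

text \<open>For a field automorphism the choice of homogeneous coordinates is immaterial. The map is
  then a homeomorphism for the Zariski topology over \<complex>, although in general not a
  morphism.\<close>

definition pmap :: "(complex \<Rightarrow> complex) \<Rightarrow> 'n proj \<Rightarrow> ('n::finite) proj" where
  "pmap \<sigma> p = abs_proj (vmap \<sigma> (rep_proj p))"

lemma vmap_nth [simp]: "vmap \<sigma> v $ i = \<sigma> (v $ i)"
  by (simp add: vmap_def)

lemma morphism_over_alt:
  "morphism_over k S W f \<longleftrightarrow> f ` S \<subseteq> W \<and>
     (\<forall>p\<in>S. \<exists>N d P. openin (zariski k) N \<and> p \<in> N \<and> (\<forall>j. form_fun k d (P j)) \<and>
        (\<forall>x\<in>S \<inter> N. (\<chi> j. P j (rep_proj x)) \<noteq> 0 \<and> f x = abs_proj (\<chi> j. P j (rep_proj x))))"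
proof -
  have "(\<exists>P. (\<forall>j. P j \<in> forms k d) \<and> Q (\<lambda>j. eval_mpoly (P j))) \<longleftrightarrow> (\<exists>P. (\<forall>j. form_fun k d (P j)) \<and> Q P)"
    for d :: nat and Q :: "('b \<Rightarrow> complex ^ 'a \<Rightarrow> complex) \<Rightarrow> bool"
  proof
    assume "\<exists>P. (\<forall>j. P j \<in> forms k d) \<and> Q (\<lambda>j. eval_mpoly (P j))"
    then obtain P where "\<forall>j. P j \<in> forms k d" "Q (\<lambda>j. eval_mpoly (P j))" by blast
    then show "\<exists>P. (\<forall>j. form_fun k d (P j)) \<and> Q P"
      by (intro exI[of _ "\<lambda>j. eval_mpoly (P j)"]) (auto simp: form_fun_def)
  next
    assume "\<exists>P. (\<forall>j. form_fun k d (P j)) \<and> Q P"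
    then obtain P where P: "\<forall>j. \<exists>R \<in> forms k d. P j = eval_mpoly R" "Q P" by (auto simp: form_fun_def)
    then obtain R where R: "\<forall>j. R j \<in> forms k d \<and> P j = eval_mpoly (R j)" by metis
    then have "P = (\<lambda>j. eval_mpoly (R j))" by (simp add: fun_eq_iff)
    then show "\<exists>P. (\<forall>j. P j \<in> forms k d) \<and> Q (\<lambda>j. eval_mpoly (P j))"
      using R P(2) by (intro exI[of _ R]) simp
  qed
  note * = this
  have "(\<exists>P. openin (zariski k) N \<and> p \<in> N \<and> (\<forall>j. P j \<in> forms k d) \<and>
        (\<forall>x\<in>S \<inter> N. (\<chi> j. eval_mpoly (P j) (rep_proj x)) \<noteq> 0 \<and> f x = abs_proj (\<chi> j. eval_mpoly (P j) (rep_proj x)))) \<longleftrightarrow>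
    (\<exists>P. openin (zariski k) N \<and> p \<in> N \<and> (\<forall>j. form_fun k d (P j)) \<and>
        (\<forall>x\<in>S \<inter> N. (\<chi> j. P j (rep_proj x)) \<noteq> 0 \<and> f x = abs_proj (\<chi> j. P j (rep_proj x))))" for N p d
    using *[of d "\<lambda>P. \<forall>x\<in>S \<inter> N. (\<chi> j. P j (rep_proj x)) \<noteq> 0 \<and> f x = abs_proj (\<chi> j. P j (rep_proj x))"]
    by simp
  then show ?thesis unfolding morphism_over_def by simp
qed

lemma morphism_over_cong:
  "morphism_over k S W f \<Longrightarrow> (\<And>x. x \<in> S \<Longrightarrow> f x = g x) \<Longrightarrow> morphism_over k S W g"
  unfolding morphism_over_def by (simp cong: image_cong)

lemma morphism_over_subset:
  assumes "morphism_over k S W f" "S' \<subseteq> S" "f ` S' \<subseteq> W'"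
  shows "morphism_over k S' W' f"
  unfolding morphism_over_def
proof (intro conjI ballI)
  fix p assume "p \<in> S'"
  then have "p \<in> S" using assms(2) by blast
  then obtain N d P where "openin (zariski k) N" "p \<in> N" "\<forall>j. P j \<in> forms k d"
    "\<forall>x\<in>S \<inter> N. (\<chi> j. eval_mpoly (P j) (rep_proj x)) \<noteq> 0 \<and>
      f x = abs_proj (\<chi> j. eval_mpoly (P j) (rep_proj x))"
    using assms(1) unfolding morphism_over_def by blast
  then show "\<exists>N d P. openin (zariski k) N \<and> p \<in> N \<and> (\<forall>j. P j \<in> forms k d) \<and>
      (\<forall>x\<in>S' \<inter> N. (\<chi> j. eval_mpoly (P j) (rep_proj x)) \<noteq> 0 \<and>
        f x = abs_proj (\<chi> j. eval_mpoly (P j) (rep_proj x)))"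
    using assms(2) by (intro exI[of _ N] exI[of _ d] exI[of _ P]) blast
qed (use assms(3) in blast)

lemma irreducible_subset_homeomorphic:
  assumes f: "homeomorphic_map X Y f" and S: "irreducible_subset X S"
  shows "irreducible_subset Y (f ` S)"
  unfolding irreducible_subset_def
proof (intro conjI allI impI)
  have sub: "S \<subseteq> topspace X" using S by (simp add: irreducible_subset_def)
  then show "f ` S \<subseteq> topspace Y" using homeomorphic_imp_surjective_map[OF f] by blast
  show "f ` S \<noteq> {}" using S by (simp add: irreducible_subset_def)
  fix A B assume AB: "closedin Y A \<and> closedin Y B \<and> f ` S \<subseteq> A \<union> B"
  have "continuous_map X Y f" using f by (simp add: homeomorphic_imp_continuous_map)
  then have "closedin X {x \<in> topspace X. f x \<in> A}" "closedin X {x \<in> topspace X. f x \<in> B}"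
    using AB closedin_continuous_map_preimage by blast+
  moreover have "S \<subseteq> {x \<in> topspace X. f x \<in> A} \<union> {x \<in> topspace X. f x \<in> B}" using AB sub by blast
  ultimately have "S \<subseteq> {x \<in> topspace X. f x \<in> A} \<or> S \<subseteq> {x \<in> topspace X. f x \<in> B}"
    using S unfolding irreducible_subset_def by blast
  then show "f ` S \<subseteq> A \<or> f ` S \<subseteq> B" by blast
qed

text \<open>Conjugation is available only as a homeomorphism, so the dimension of a conjugate curve
  is obtained by transporting chains of closed irreducible sets.\<close>

lemma krull_dim_homeomorphic_le:
  assumes f: "homeomorphic_map X Y f"
  shows "krull_dim X \<le> krull_dim Y"
  unfolding krull_dim_def
proof (rule Sup_subset_mono, clarify)
  fix n :: nat and Z :: "nat \<Rightarrow> 'a set"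
  assume Z: "\<forall>i\<le>n. closedin X (Z i) \<and> irreducible_subset X (Z i)" and strict: "\<forall>i<n. Z i \<subset> Z (Suc i)"
  have "closedin Y (f ` Z i)" if "i \<le> n" for i
    using homeomorphic_map_closedness_eq[OF f, of "Z i"] Z that by blast
  moreover have "irreducible_subset Y (f ` Z i)" if "i \<le> n" for i
    using irreducible_subset_homeomorphic[OF f] Z that by blast
  moreover have "f ` Z i \<subset> f ` Z (Suc i)" if "i < n" for i
  proof (rule image_strict_mono)
    have "Z (Suc i) \<subseteq> topspace X" using Z that by (simp add: closedin_subset Suc_leI)
    then show "inj_on f (Z (Suc i))"
      using homeomorphic_imp_injective_map[OF f] inj_on_subset by blast
  qed (use strict that in blast)
  ultimately show "\<exists>n'. enat n = enat n' \<and> (\<exists>Z. (\<forall>i\<le>n'. closedin Y (Z i) \<and> irreducible_subset Y (Z i)) \<and>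
      (\<forall>i<n'. Z i \<subset> Z (Suc i)))"
    by (intro exI[of _ n] conjI exI[of _ "\<lambda>i. f ` Z i"]) simp_all
qed

lemma krull_dim_homeomorphic:
  assumes "homeomorphic_map X Y f"
  shows "krull_dim X = krull_dim Y"
proof (rule antisym)
  obtain g where "homeomorphic_map Y X g"
    using assms homeomorphic_map_maps homeomorphic_maps_sym by metis
  then show "krull_dim Y \<le> krull_dim X" by (rule krull_dim_homeomorphic_le)
qed (rule krull_dim_homeomorphic_le[OF assms])

context field_aut
begin

lemma aut_zero: "\<sigma> 0 = 0"
  using aut_add[of 0 0] by simp

lemma aut_eq_iff: "\<sigma> x = \<sigma> y \<longleftrightarrow> x = y"
  using bij_aut by (simp add: bij_def inj_eq)

lemma aut_zero_iff: "\<sigma> x = 0 \<longleftrightarrow> x = 0"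
  using aut_eq_iff[of x 0] by (simp add: aut_zero)

lemma aut_one: "\<sigma> 1 = 1"
  using aut_mult[of 1 1] aut_zero_iff[of 1] by simp

lemma aut_inv [simp]: "\<sigma> (finv \<sigma> x) = x" "finv \<sigma> (\<sigma> x) = x"
  using bij_aut by (simp_all add: bij_is_surj surj_f_inv_f bij_is_inj inv_f_f)

lemma field_aut_inv: "field_aut (finv \<sigma>)"
proof
  show "bij (finv \<sigma>)" using bij_aut by (rule bij_imp_bij_inv)
  fix x y
  have "\<sigma> (finv \<sigma> (x + y)) = \<sigma> (finv \<sigma> x + finv \<sigma> y)" by (simp add: aut_add)
  then show "finv \<sigma> (x + y) = finv \<sigma> x + finv \<sigma> y" by (simp only: aut_eq_iff)
  have "\<sigma> (finv \<sigma> (x * y)) = \<sigma> (finv \<sigma> x * finv \<sigma> y)" by (simp add: aut_mult)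
  then show "finv \<sigma> (x * y) = finv \<sigma> x * finv \<sigma> y" by (simp only: aut_eq_iff)
qed

lemma inv_inv_aut [simp]: "finv (finv \<sigma>) = \<sigma>"
  using bij_aut by (rule inv_inv_eq)

lemma aut_sum: "\<sigma> (sum f N) = (\<Sum>i\<in>N. \<sigma> (f i))"
  by (induction N rule: infinite_finite_induct) (auto simp: aut_zero aut_add)

lemma aut_prod: "\<sigma> (prod f N) = (\<Prod>i\<in>N. \<sigma> (f i))"
  by (induction N rule: infinite_finite_induct) (auto simp: aut_one aut_mult)

lemma aut_power: "\<sigma> (x ^ n) = \<sigma> x ^ n"
  by (induction n) (auto simp: aut_one aut_mult)

lemma vmap_zero_iff [simp]: "vmap \<sigma> v = 0 \<longleftrightarrow> v = 0"
  by (simp add: vec_eq_iff aut_zero_iff)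

lemma vmap_scale: "vmap \<sigma> (c *s v) = \<sigma> c *s vmap \<sigma> v"
  by (simp add: vec_eq_iff aut_mult)

lemma vmap_inv [simp]: "vmap (finv \<sigma>) (vmap \<sigma> v) = v" "vmap \<sigma> (vmap (finv \<sigma>) v) = v"
  by (simp_all add: vec_eq_iff)

lemma pmap_abs_proj:
  assumes "v \<noteq> 0" shows "pmap \<sigma> (abs_proj v) = abs_proj (vmap \<sigma> v)"
proof -
  obtain c where c: "c \<noteq> 0" "rep_proj (abs_proj v) = c *s v" using rep_abs_proj[OF assms] .
  then have "vmap \<sigma> (rep_proj (abs_proj v)) = \<sigma> c *s vmap \<sigma> v" by (simp add: vmap_scale)
  moreover have "\<sigma> c \<noteq> 0" using c by (simp add: aut_zero_iff)
  moreover have "vmap \<sigma> v \<noteq> 0" using assms by simp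
  ultimately have "abs_proj (vmap \<sigma> v) = abs_proj (vmap \<sigma> (rep_proj (abs_proj v)))"
    using abs_proj_eq_iff[of "vmap \<sigma> v" "\<sigma> c *s vmap \<sigma> v"] by (auto simp: vector_mul_eq_0)
  then show ?thesis by (simp add: pmap_def)
qed

lemma rep_pmap: obtains c where "c \<noteq> 0" "rep_proj (pmap \<sigma> p) = c *s vmap \<sigma> (rep_proj p)"
  unfolding pmap_def by (rule rep_abs_proj[of "vmap \<sigma> (rep_proj p)"]) auto

lemma pmap_inv_left [simp]: "pmap (finv \<sigma>) (pmap \<sigma> p) = p"
  using field_aut.pmap_abs_proj[OF field_aut_inv, of "vmap \<sigma> (rep_proj p)"] by (simp add: pmap_def[of \<sigma>])

lemma pmap_inv_right [simp]: "pmap \<sigma> (pmap (finv \<sigma>) p) = p"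
  using field_aut.pmap_inv_left[OF field_aut_inv] by simp

lemma inj_pmap: "inj (pmap \<sigma>)"
  by (rule inj_on_inverseI) (rule pmap_inv_left)

lemma pmap_eq_iff [simp]: "pmap \<sigma> p = pmap \<sigma> q \<longleftrightarrow> p = q"
  by (rule inj_eq[OF inj_pmap])

lemma mem_pmap_image: "p \<in> pmap \<sigma> ` W \<longleftrightarrow> pmap (finv \<sigma>) p \<in> W"
  by (metis image_iff pmap_inv_left pmap_inv_right)

lemma pmap_image_eq_vimage: "pmap \<sigma> ` W = {p. pmap (finv \<sigma>) p \<in> W}"
  using mem_pmap_image by blast

text \<open>The form with \<sigma> applied to its coefficients, expressed without choosing
  them.\<close>

definition conj_form :: "(complex ^ 'n \<Rightarrow> complex) \<Rightarrow> complex ^ ('n::finite) \<Rightarrow> complex" where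
  "conj_form F v = \<sigma> (F (vmap (finv \<sigma>) v))"

lemma form_fun_conj_form:
  assumes "form_fun UNIV d F" shows "form_fun UNIV d (conj_form F)"
proof -
  obtain N c where F: "\<And>m. m \<in> N \<Longrightarrow> deg m = d" "F = (\<lambda>v. \<Sum>m\<in>N. c m * mon m v)"
    using form_fun_expand[OF assms] by auto
  have "form_fun UNIV d (\<lambda>v. \<Sum>m\<in>N. \<sigma> (c m) * mon m v)"
  proof (rule form_fun_sum)
    fix m assume "m \<in> N"
    then show "form_fun UNIV d (\<lambda>v. \<sigma> (c m) * mon m v)"
      using form_fun_monomial[of UNIV "\<sigma> (c m)" m] F(1) by simp
  qed simp
  moreover have "conj_form F = (\<lambda>v. \<Sum>m\<in>N. \<sigma> (c m) * mon m v)"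
    by (simp add: fun_eq_iff conj_form_def F(2) aut_sum aut_mult aut_prod aut_power)
  ultimately show ?thesis by simp
qed

lemma conj_form_scale:
  assumes "form_fun UNIV d F"
  shows "conj_form F (c *s vmap \<sigma> v) = c ^ d * \<sigma> (F v)"
  using form_fun_homogeneous[OF form_fun_conj_form[OF assms], of c "vmap \<sigma> v"]
  by (simp add: conj_form_def)

lemma conj_form_zero_iff:
  assumes "form_fun UNIV d F"
  shows "conj_form F (rep_proj (pmap \<sigma> p)) = 0 \<longleftrightarrow> F (rep_proj p) = 0"
proof -
  obtain c where "c \<noteq> 0" "rep_proj (pmap \<sigma> p) = c *s vmap \<sigma> (rep_proj p)" by (rule rep_pmap)
  then show ?thesis by (simp add: conj_form_scale[OF assms] aut_zero_iff)
qed

lemma openin_pmap_image: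
  assumes "openin (zariski UNIV) W" shows "openin (zariski UNIV) (pmap \<sigma> ` W)"
  unfolding openin_zariski_iff[OF ring_set_UNIV]
proof clarify
  fix p assume "p \<in> W"
  then obtain F d where F: "form_fun UNIV d F" "F (rep_proj p) \<noteq> 0" "\<forall>q. F (rep_proj q) \<noteq> 0 \<longrightarrow> q \<in> W"
    using assms unfolding openin_zariski_iff[OF ring_set_UNIV] by blast
  have "q \<in> pmap \<sigma> ` W" if "conj_form F (rep_proj q) \<noteq> 0" for q
    using that conj_form_zero_iff[OF F(1), of "pmap (finv \<sigma>) q"] F(3) by (simp add: mem_pmap_image)
  then show "\<exists>F d. form_fun UNIV d F \<and> F (rep_proj (pmap \<sigma> p)) \<noteq> 0 \<and>
      (\<forall>q. F (rep_proj q) \<noteq> 0 \<longrightarrow> q \<in> pmap \<sigma> ` W)"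
    using form_fun_conj_form[OF F(1)] conj_form_zero_iff[OF F(1)] F(2)
    by (intro exI[of _ "conj_form F"] exI[of _ d]) simp
qed

lemma continuous_pmap:
  "continuous_map (zariski UNIV) (zariski UNIV :: ('n::finite) proj topology) (pmap \<sigma>)"
proof -
  have "{p. pmap \<sigma> p \<in> W} = pmap (finv \<sigma>) ` W" for W :: "'n proj set"
    using field_aut.pmap_image_eq_vimage[OF field_aut_inv, of W] by simp
  then show ?thesis
    by (auto simp: continuous_map_def intro!: field_aut.openin_pmap_image[OF field_aut_inv])
qed

lemma homeomorphic_pmap: "homeomorphic_map (zariski UNIV) (zariski UNIV) (pmap \<sigma>)"
  unfolding homeomorphic_map_maps homeomorphic_maps_def
  by (intro exI[of _ "pmap (finv \<sigma>)"])
    (simp add: continuous_pmap field_aut.continuous_pmap[OF field_aut_inv])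

lemma openin_subtopology_pmap_image:
  assumes "openin (subtopology (zariski UNIV) S) U"
  shows "openin (subtopology (zariski UNIV) (pmap \<sigma> ` S)) (pmap \<sigma> ` U)"
proof -
  obtain W where "openin (zariski UNIV) W" "U = W \<inter> S" using assms by (auto simp: openin_subtopology)
  then show ?thesis
    using openin_pmap_image by (auto simp: openin_subtopology image_Int[OF inj_pmap])
qed

lemma irreducible_curve_pmap:
  assumes "irreducible_curve C" shows "irreducible_curve (pmap \<sigma> ` C)"
proof -
  have "homeomorphic_map (subtopology (zariski UNIV) C) (subtopology (zariski UNIV) (pmap \<sigma> ` C)) (pmap \<sigma>)"
    by (rule homeomorphic_map_subtopologies[OF homeomorphic_pmap]) simp
  from krull_dim_homeomorphic[OF this] show ?thesis
    using assms irreducible_subset_homeomorphic[OF homeomorphic_pmap]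
      homeomorphic_map_closedness_eq[OF homeomorphic_pmap]
    by (auto simp: irreducible_curve_def projective_variety_def)
qed

text \<open>The conjugate forms describe the conjugate map locally; passing to the chosen
  coordinates of a conjugate point only rescales their values by a common factor
  \<open>c ^ d\<close>.\<close>

lemma morphism_over_conj:
  assumes "morphism_over UNIV S W f"
  shows "morphism_over UNIV (pmap \<sigma> ` S) (pmap \<sigma> ` W) (pmap \<sigma> \<circ> f \<circ> pmap (finv \<sigma>))"
  unfolding morphism_over_alt
proof (intro conjI ballI)
  show "(pmap \<sigma> \<circ> f \<circ> pmap (finv \<sigma>)) ` pmap \<sigma> ` S \<subseteq> pmap \<sigma> ` W"
    using assms by (auto simp: morphism_over_def)
  fix p' assume "p' \<in> pmap \<sigma> ` S"
  then obtain p where p: "p \<in> S" "p' = pmap \<sigma> p" by blast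
  from assms[unfolded morphism_over_alt] p(1) obtain N d P where
    N: "openin (zariski UNIV) N" "p \<in> N" and P: "\<forall>j. form_fun UNIV d (P j)"
      "\<forall>x\<in>S \<inter> N. (\<chi> j. P j (rep_proj x)) \<noteq> 0 \<and> f x = abs_proj (\<chi> j. P j (rep_proj x))"
    by blast
  have "(\<chi> j. conj_form (P j) (rep_proj (pmap \<sigma> x))) \<noteq> 0 \<and>
    pmap \<sigma> (f x) = abs_proj (\<chi> j. conj_form (P j) (rep_proj (pmap \<sigma> x)))" if x: "x \<in> S" "x \<in> N" for x
  proof -
    let ?v = "\<chi> j. P j (rep_proj x)"
    obtain c where c: "c \<noteq> 0" "rep_proj (pmap \<sigma> x) = c *s vmap \<sigma> (rep_proj x)" by (rule rep_pmap)
    have "conj_form (P j) (rep_proj (pmap \<sigma> x)) = c ^ d * \<sigma> (P j (rep_proj x))" for j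
      using conj_form_scale[OF P(1)[rule_format]] by (simp add: c(2))
    then have eq: "(\<chi> j. conj_form (P j) (rep_proj (pmap \<sigma> x))) = c ^ d *s vmap \<sigma> ?v"
      by (simp add: vec_eq_iff)
    have v: "?v \<noteq> 0" "f x = abs_proj ?v" using P(2) x by auto
    then have "pmap \<sigma> (f x) = abs_proj (vmap \<sigma> ?v)" by (simp add: pmap_abs_proj)
    also have "\<dots> = abs_proj (c ^ d *s vmap \<sigma> ?v)"
      using v(1) c(1) by (subst abs_proj_eq_iff) (auto simp: vector_mul_eq_0)
    finally show ?thesis using v(1) c(1) unfolding eq by (simp add: vector_mul_eq_0)
  qed
  then show "\<exists>N d P. openin (zariski UNIV) N \<and> p' \<in> N \<and> (\<forall>j. form_fun UNIV d (P j)) \<and>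
      (\<forall>x\<in>pmap \<sigma> ` S \<inter> N. (\<chi> j. P j (rep_proj x)) \<noteq> 0 \<and>
        (pmap \<sigma> \<circ> f \<circ> pmap (finv \<sigma>)) x = abs_proj (\<chi> j. P j (rep_proj x)))"
    using openin_pmap_image[OF N(1)] N(2) p(2) P(1) form_fun_conj_form
    by (intro exI[of _ "pmap \<sigma> ` N"] exI[of _ d] exI[of _ "\<lambda>j. conj_form (P j)"]) auto
qed

lemma segre_pmap: "segre (pmap \<sigma> p) (pmap \<sigma> q) = pmap \<sigma> (segre p q)"
proof -
  have "segre (pmap \<sigma> p) (pmap \<sigma> q) = abs_proj (segre_vec (vmap \<sigma> (rep_proj p)) (vmap \<sigma> (rep_proj q)))"
    unfolding pmap_def by (rule segre_abs_proj) auto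
  also have "segre_vec (vmap \<sigma> (rep_proj p)) (vmap \<sigma> (rep_proj q)) = vmap \<sigma> (segre_vec (rep_proj p) (rep_proj q))"
    by (simp add: vec_eq_iff segre_vec_def aut_mult)
  finally show ?thesis by (simp add: segre_alt pmap_abs_proj segre_vec_nonzero)
qed

lemma segre_image_pmap: "pmap \<sigma> ` segre_image (E \<times> E') = segre_image (pmap \<sigma> ` E \<times> pmap \<sigma> ` E')"
  unfolding segre_image_def by (force simp flip: segre_pmap)

text \<open>The bijection \<open>pmap \<sigma>\<close> carries one law to the other and thereby the
  group axioms; multiplication and inversion remain morphisms because conjugates of morphisms are
  morphisms.\<close>

lemma elliptic_group_law_pmap:
  assumes "elliptic_group_law E p0 m"
  shows "elliptic_group_law (pmap \<sigma> ` E) (pmap \<sigma> p0)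
    (\<lambda>p q. pmap \<sigma> (m (pmap (finv \<sigma>) p) (pmap (finv \<sigma>) q)))"
proof -
  define G where "G = \<lparr>carrier = E, monoid.mult = m, one = p0\<rparr>"
  define m' where "m' p q = pmap \<sigma> (m (pmap (finv \<sigma>) p) (pmap (finv \<sigma>) q))" for p q
  define G' where "G' = \<lparr>carrier = pmap \<sigma> ` E, monoid.mult = m', one = pmap \<sigma> p0\<rparr>"
  have curve: "irreducible_curve E" and "group G" and inv: "morphism_over UNIV E E (m_inv G)"
    using assms by (auto simp: elliptic_group_law_def G_def)
  obtain M where M: "morphism_over UNIV (segre_image (E \<times> E)) E M" "\<forall>p\<in>E. \<forall>q\<in>E. M (segre p q) = m p q"
    using assms by (auto simp: elliptic_group_law_def)
  interpret group G by fact
  have carr: "carrier G = E" "monoid.mult G = m" "one G = p0" by (simp_all add: G_def)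
  have mm: "m' (pmap \<sigma> p) (pmap \<sigma> q) = pmap \<sigma> (m p q)" for p q by (simp add: m'_def)
  have "group G'"
  proof (rule groupI)
    fix x y z assume "x \<in> carrier G'" "y \<in> carrier G'" "z \<in> carrier G'"
    then obtain p q r where "p \<in> E" "q \<in> E" "r \<in> E" "x = pmap \<sigma> p" "y = pmap \<sigma> q" "z = pmap \<sigma> r"
      by (auto simp: G'_def)
    then show "x \<otimes>\<^bsub>G'\<^esub> y \<otimes>\<^bsub>G'\<^esub> z = x \<otimes>\<^bsub>G'\<^esub> (y \<otimes>\<^bsub>G'\<^esub> z)"
      using m_assoc[of p q r] by (simp add: G'_def mm carr)
  next
    fix x y assume "x \<in> carrier G'" "y \<in> carrier G'"
    then show "x \<otimes>\<^bsub>G'\<^esub> y \<in> carrier G'" using m_closed by (auto simp: G'_def mm carr)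
  next
    show "\<one>\<^bsub>G'\<^esub> \<in> carrier G'" using one_closed by (auto simp: G'_def carr)
  next
    fix x assume "x \<in> carrier G'"
    then obtain p where p: "p \<in> E" "x = pmap \<sigma> p" by (auto simp: G'_def)
    then show "\<one>\<^bsub>G'\<^esub> \<otimes>\<^bsub>G'\<^esub> x = x" using l_one[of p] by (simp add: G'_def mm carr)
    show "\<exists>y\<in>carrier G'. y \<otimes>\<^bsub>G'\<^esub> x = \<one>\<^bsub>G'\<^esub>"
      using p l_inv[of p] inv_closed[of p]
      by (intro bexI[of _ "pmap \<sigma> (m_inv G p)"]) (simp_all add: G'_def mm carr)
  qed
  then interpret G': group G' .
  have inv_eq: "m_inv G' (pmap \<sigma> p) = pmap \<sigma> (m_inv G p)" if "p \<in> E" for p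
    using that l_inv[of p] inv_closed[of p]
    by (intro G'.inv_equality) (simp_all add: G'_def mm carr)
  have "morphism_over UNIV (pmap \<sigma> ` E) (pmap \<sigma> ` E) (m_inv G')"
    by (rule morphism_over_cong[OF morphism_over_conj[OF inv]]) (auto simp: inv_eq)
  moreover have "morphism_over UNIV (segre_image (pmap \<sigma> ` E \<times> pmap \<sigma> ` E)) (pmap \<sigma> ` E) (pmap \<sigma> \<circ> M \<circ> pmap (finv \<sigma>))"
    using morphism_over_conj[OF M(1)] by (simp add: segre_image_pmap)
  moreover have "(pmap \<sigma> \<circ> M \<circ> pmap (finv \<sigma>)) (segre p q) = m' p q"
    if "p \<in> pmap \<sigma> ` E" "q \<in> pmap \<sigma> ` E" for p q
    using that M(2) by (auto simp: segre_pmap mm)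
  ultimately show ?thesis
    using irreducible_curve_pmap[OF curve] \<open>group G'\<close>
    unfolding elliptic_group_law_def G'_def m'_def by blast
qed

lemma elliptic_curve_pmap: "elliptic_curve E \<Longrightarrow> elliptic_curve (pmap \<sigma> ` E)"
  unfolding elliptic_curve_def using elliptic_group_law_pmap by blast

end

section \<open>Conjugate sections\<close>

definition gal :: "complex set \<Rightarrow> (complex \<Rightarrow> complex) set" where
  "gal k = {\<sigma>. field_aut \<sigma> \<and> (\<forall>c\<in>k. \<sigma> c = c)}"

lemma gal_field_aut: "\<sigma> \<in> gal k \<Longrightarrow> field_aut \<sigma>"
  by (simp add: gal_def)

lemma gal_inv: "\<sigma> \<in> gal k \<Longrightarrow> finv \<sigma> \<in> gal k"
  unfolding gal_def by (auto intro: field_aut.field_aut_inv) (metis field_aut.aut_inv(2))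

lemma field_aut_comp: "field_aut \<sigma> \<Longrightarrow> field_aut \<tau> \<Longrightarrow> field_aut (\<sigma> \<circ> \<tau>)"
  unfolding field_aut_def by (auto intro: bij_comp)

lemma gal_comp: "\<sigma> \<in> gal k \<Longrightarrow> \<tau> \<in> gal k \<Longrightarrow> \<sigma> \<circ> \<tau> \<in> gal k"
  unfolding gal_def using field_aut_comp by auto

lemma pmap_comp:
  assumes "field_aut \<sigma>" "field_aut \<tau>" shows "pmap (\<sigma> \<circ> \<tau>) p = pmap \<sigma> (pmap \<tau> p)"
proof -
  have "vmap \<sigma> (vmap \<tau> v) = vmap (\<sigma> \<circ> \<tau>) v" for v :: "complex ^ 'a" by (simp add: vec_eq_iff)
  moreover have "vmap \<tau> (rep_proj p) \<noteq> 0" by (simp add: field_aut.vmap_zero_iff[OF assms(2)])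
  ultimately show ?thesis
    using field_aut.pmap_abs_proj[OF assms(1), of "vmap \<tau> (rep_proj p)"]
    by (simp add: pmap_def[of \<tau>] pmap_def[of "\<sigma> \<circ> \<tau>"])
qed

lemma gal_form:
  assumes \<sigma>: "\<sigma> \<in> gal k" and F: "form_fun k d F"
  shows "F (vmap \<sigma> v) = \<sigma> (F v)"
proof -
  interpret field_aut \<sigma> using \<sigma> by (rule gal_field_aut)
  obtain N c where F: "\<And>m. c m \<in> k" "F = (\<lambda>v. \<Sum>m\<in>N. c m * mon m v)"
    using form_fun_expand[OF F] by auto
  have "\<sigma> (c m) = c m" for m using \<sigma> F(1) by (simp add: gal_def)
  then show ?thesis by (simp add: F(2) aut_sum aut_mult aut_prod aut_power)
qed

lemma gal_form_rep_pmap: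
  assumes \<sigma>: "\<sigma> \<in> gal k" and F: "form_fun k d F"
  shows "F (rep_proj (pmap \<sigma> p)) = 0 \<longleftrightarrow> F (rep_proj p) = 0"
proof -
  interpret field_aut \<sigma> using \<sigma> by (rule gal_field_aut)
  show ?thesis unfolding pmap_def
    by (subst form_fun_rep_abs[OF F]) (simp_all add: gal_form[OF \<sigma> F] aut_zero_iff)
qed

text \<open>A form over \<open>k\<close> vanishes at a point if and only if it vanishes at the
  conjugate point, so a set closed over \<open>k\<close> is mapped into itself. The inverse
  automorphism gives the converse.\<close>

lemma gal_closedin:
  assumes \<sigma>: "\<sigma> \<in> gal k" and k: "ring_set k" and V: "closedin (zariski k) V"
  shows "pmap \<sigma> p \<in> V \<longleftrightarrow> p \<in> V"
proof -
  have imp: "pmap \<tau> q \<in> V" if "q \<in> V" and \<tau>: "\<tau> \<in> gal k" for \<tau> q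
  proof (rule ccontr)
    assume "pmap \<tau> q \<notin> V"
    then obtain F d where "form_fun k d F" "F (rep_proj (pmap \<tau> q)) \<noteq> 0" "\<forall>q\<in>V. F (rep_proj q) = 0"
      using V unfolding closedin_zariski_iff[OF k] by blast
    then show False using gal_form_rep_pmap[OF \<tau>] \<open>q \<in> V\<close> by blast
  qed
  show ?thesis
    using imp[of p \<sigma>] imp[of "pmap \<sigma> p" "finv \<sigma>"] \<sigma> gal_inv[OF \<sigma>]
      field_aut.pmap_inv_left[OF gal_field_aut[OF \<sigma>], of p] by auto
qed

lemma gal_locally_closed:
  assumes \<sigma>: "\<sigma> \<in> gal k" and k: "ring_set k" and V: "locally_closed k V"
  shows "pmap \<sigma> p \<in> V \<longleftrightarrow> p \<in> V"
proof -
  obtain Z W where Z: "closedin (zariski k) Z" and W: "openin (zariski k) W" and VZW: "V = Z \<inter> W"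
    using V by (auto simp: locally_closed_def)
  have "closedin (zariski k) (UNIV - W)"
    using closedin_diff[OF closedin_topspace W] by (simp add: topspace_zariski[OF k])
  then show ?thesis using gal_closedin[OF \<sigma> k] Z VZW by blast
qed

text \<open>The zeros of \<open>F\<close> in \<open>T\<close> form a set closed over
  \<open>k\<close>, which must be all of \<open>T\<close> as soon as it contains a very general
  point. Hence all very general points satisfy the same equations over \<open>k\<close>.\<close>

lemma very_general_form:
  assumes k: "ring_set k" and t: "very_general k T t" and F: "form_fun k d F"
  shows "F (rep_proj t) = 0 \<longleftrightarrow> (\<forall>u\<in>T. F (rep_proj u) = 0)"
proof
  assume "F (rep_proj t) = 0"
  moreover have "closedin (subtopology (zariski k) T) ({p. F (rep_proj p) = 0} \<inter> T)"
    using closedin_zariski_zeros[OF k F] unfolding closedin_subtopology by blast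
  ultimately have "{p. F (rep_proj p) = 0} \<inter> T = T"
    using t unfolding very_general_def by blast
  then show "\<forall>u\<in>T. F (rep_proj u) = 0" by blast
qed (use t in \<open>auto simp: very_general_def\<close>)

text \<open>Normalised coordinates of the two points satisfy the same forms over \<open>k\<close>.
  Matching the values of forms therefore gives an isomorphism of countable rings that fixes
  \<open>k\<close>, and an extension of it to \<complex> carries coordinates to coordinates.\<close>

theorem gal_transitive_on_very_general:
  assumes k: "ring_set k" "countable k" and t: "very_general k T t" and t': "very_general k T t'"
  shows "\<exists>\<sigma>\<in>gal k. pmap \<sigma> t = t'"
proof -
  have iff: "F (rep_proj t) = 0 \<longleftrightarrow> F (rep_proj t') = 0" if "form_fun k d F" for d F
    using very_general_form[OF k(1) t that] very_general_form[OF k(1) t' that] by simp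
  have coord: "form_fun k 1 (\<lambda>v :: complex ^ 'a. v $ i)" for i
    using k(1) by (intro form_fun_coord) (simp_all add: ring_set_def)
  obtain j where j: "rep_proj t $ j \<noteq> 0" using vec_nonzero[OF rep_proj_nonzero] by blast
  then have j': "rep_proj t' $ j \<noteq> 0" using iff[OF coord[of j]] by simp
  define u where "u = affine_vec j t"
  define u' where "u' = affine_vec j t'"
  have uj: "u $ j = 1" "u' $ j = 1" using j j' by (simp_all add: u_def u'_def)
  define \<Gamma> where "\<Gamma> = {(F u, F u') | F d. form_fun k d F}"
  have \<Gamma>I: "(F u, F u') \<in> \<Gamma>" if "form_fun k d F" for d F using that by (auto simp: \<Gamma>_def)
  have const: "(c, c) \<in> \<Gamma>" if "c \<in> k" for c
    using \<Gamma>I[OF form_fun_const[of k c]] that k(1) by (simp add: ring_set_def)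
  have "cx.partial_iso \<Gamma>"
    unfolding cx.partial_iso_def ring_rel_def
  proof (intro conjI allI impI)
    show "(1, 1) \<in> \<Gamma>" using const k(1) by (simp add: ring_set_def)
    fix a b c d assume "(a, b) \<in> \<Gamma>" "(c, d) \<in> \<Gamma>"
    then obtain F m G n where F: "form_fun k m F" "a = F u" "b = F u'"
      and G: "form_fun k n G" "c = G u" "d = G u'" by (auto simp: \<Gamma>_def)
    \<comment> \<open>Powers of coordinate \<open>j\<close>, which is 1 at \<open>u\<close> and at
      \<open>u'\<close>, bring both forms to a common degree before subtraction.\<close>
    have pow: "form_fun k n (\<lambda>v :: complex ^ 'a. v $ j ^ n)" for n
      using form_fun_power[OF k(1) coord, of n] by simp
    have "form_fun k (m + n) (\<lambda>v. G v * v $ j ^ m)"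
      using form_fun_mult[OF k(1) G(1) pow[of m]] by (simp add: add.commute)
    from \<Gamma>I[OF form_fun_diff[OF k(1) form_fun_mult[OF k(1) F(1) pow[of n]] this]]
    show "(a - c, b - d) \<in> \<Gamma>" by (simp add: F G uj)
    from \<Gamma>I[OF form_fun_mult[OF k(1) F(1) G(1)]] show "(a * c, b * d) \<in> \<Gamma>" by (simp add: F G)
  next
    fix a b assume "(a, b) \<in> \<Gamma>"
    then obtain F m where F: "form_fun k m F" "a = F u" "b = F u'" by (auto simp: \<Gamma>_def)
    then show "a \<in> {0} \<longleftrightarrow> b = 0"
      using iff[OF F(1)] form_fun_affine_vec[OF F(1) j] form_fun_affine_vec[OF F(1) j']
      by (simp add: u_def u'_def)
  qed simp
  moreover have "countable \<Gamma>"
  proof -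
    have "\<Gamma> = (\<Union>d. (\<lambda>F. (F u, F u')) ` {F. form_fun k d F})" by (auto simp: \<Gamma>_def)
    then show ?thesis
      by (simp only:) (intro countable_UN countable_image countable_form_funs k countableI_type)
  qed
  ultimately obtain \<sigma> where \<sigma>: "field_aut \<sigma>" "\<forall>(a, b)\<in>\<Gamma>. \<sigma> a = b"
    using countable_partial_iso_extends_to_aut by blast
  have graph: "\<sigma> a = b" if "(a, b) \<in> \<Gamma>" for a b using \<sigma>(2) that by auto
  interpret field_aut \<sigma> by fact
  have "\<sigma> \<in> gal k" using \<sigma> graph[OF const] by (simp add: gal_def)
  moreover have "vmap \<sigma> u = u'"
    using graph[OF \<Gamma>I[OF coord]] by (simp add: vec_eq_iff)
  moreover have "abs_proj (affine_vec i p) = p" and "affine_vec i p \<noteq> 0" if "rep_proj p $ i \<noteq> 0" for i and p :: "'a proj"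
  proof -
    show nz: "affine_vec i p \<noteq> 0" using that by (simp add: affine_vec_def vector_mul_eq_0)
    have "abs_proj (rep_proj p) = abs_proj (affine_vec i p)"
      using that nz by (subst abs_proj_eq_iff) (auto simp: affine_vec_def intro!: exI[of _ "1 / rep_proj p $ i"])
    then show "abs_proj (affine_vec i p) = p" by simp
  qed
  ultimately have "pmap \<sigma> t = t'"
    using pmap_abs_proj[of u] j j' by (simp add: u_def u'_def)
  then show ?thesis using \<open>\<sigma> \<in> gal k\<close> by blast
qed

text \<open>Where the values differ, some 2 by 2 minor of the two local coordinate vectors is
  nonzero, and it remains so on a neighbourhood.\<close>

lemma morphisms_differ_open:
  assumes "morphism_over UNIV U W s" "morphism_over UNIV U' W' s'" "b \<in> U" "b \<in> U'" "s b \<noteq> s' b"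
  obtains N where "openin (zariski UNIV) N" "b \<in> N" "\<And>x. x \<in> U \<Longrightarrow> x \<in> U' \<Longrightarrow> x \<in> N \<Longrightarrow> s x \<noteq> s' x"
proof -
  obtain N d P where N: "openin (zariski UNIV) N" "b \<in> N" "\<forall>j. form_fun UNIV d (P j)"
    "\<forall>x\<in>U \<inter> N. (\<chi> j. P j (rep_proj x)) \<noteq> 0 \<and> s x = abs_proj (\<chi> j. P j (rep_proj x))"
    using assms(1,3) unfolding morphism_over_alt by blast
  obtain N' d' P' where N': "openin (zariski UNIV) N'" "b \<in> N'" "\<forall>j. form_fun UNIV d' (P' j)"
    "\<forall>x\<in>U' \<inter> N'. (\<chi> j. P' j (rep_proj x)) \<noteq> 0 \<and> s' x = abs_proj (\<chi> j. P' j (rep_proj x))"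
    using assms(2,4) unfolding morphism_over_alt by blast
  have eq: "s x = s' x \<longleftrightarrow>
      (\<forall>i j. P i (rep_proj x) * P' j (rep_proj x) - P j (rep_proj x) * P' i (rep_proj x) = 0)"
    if "x \<in> U" "x \<in> U'" "x \<in> N" "x \<in> N'" for x
    using N(4) N'(4) that abs_proj_eq_minors[of "\<chi> j. P j (rep_proj x)" "\<chi> j. P' j (rep_proj x)"] by simp
  obtain i j where ij: "P i (rep_proj b) * P' j (rep_proj b) - P j (rep_proj b) * P' i (rep_proj b) \<noteq> 0"
    using eq[OF assms(3,4) N(2) N'(2)] assms(5) by blast
  have "form_fun UNIV (d + d') (\<lambda>v. P i v * P' j v - P j v * P' i v)"
    using N(3) N'(3) by (intro form_fun_diff form_fun_mult) auto
  from openin_zariski_basic[OF this]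
  have "openin (zariski UNIV) (N \<inter> N' \<inter> {p. P i (rep_proj p) * P' j (rep_proj p) - P j (rep_proj p) * P' i (rep_proj p) \<noteq> 0})"
    using N(1) N'(1) by (intro openin_Int)
  then show ?thesis by (rule that) (use N(2) N'(2) ij eq in blast)+
qed

text \<open>Transitivity is the point that needs irreducibility: if two sections that agree with a
  third differed somewhere, they would differ on a nonempty open set, and this set meets the domain
  of the third.\<close>

lemma equiv_section_rel:
  assumes irr: "irreducible_subset (zariski UNIV) B"
  shows "equiv (local_sections X B \<pi>) (section_rel X B \<pi>)"
proof (rule equivI)
  show "section_rel X B \<pi> \<subseteq> local_sections X B \<pi> \<times> local_sections X B \<pi>"
    by (auto simp: section_rel_def)
  show "refl_on (local_sections X B \<pi>) (section_rel X B \<pi>)"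
    by (auto simp: refl_on_def section_rel_def)
  show "sym (section_rel X B \<pi>)" by (auto simp: sym_def section_rel_def)
  show "trans (section_rel X B \<pi>)"
  proof (rule transI, clarsimp simp: section_rel_def)
    fix U s V r U' s' b
    assume sec: "(U, s) \<in> local_sections X B \<pi>" "(V, r) \<in> local_sections X B \<pi>" "(U', s') \<in> local_sections X B \<pi>"
      and agree: "\<forall>b\<in>U \<inter> V. s b = r b" "\<forall>b\<in>V \<inter> U'. r b = s' b" and b: "b \<in> U" "b \<in> U'"
    show "s b = s' b"
    proof (rule ccontr)
      assume "s b \<noteq> s' b"
      moreover have "morphism_over UNIV U X s" "morphism_over UNIV U' X s'"
        using sec by (auto simp: local_sections_def)
      ultimately obtain N where N: "openin (zariski UNIV) N" "b \<in> N"
        "\<And>x. x \<in> U \<Longrightarrow> x \<in> U' \<Longrightarrow> x \<in> N \<Longrightarrow> s x \<noteq> s' x"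
        using morphisms_differ_open b by metis
      have op: "openin (subtopology (zariski UNIV) B) U" "openin (subtopology (zariski UNIV) B) U'"
        "openin (subtopology (zariski UNIV) B) V" "V \<noteq> {}"
        using sec by (auto simp: local_sections_def)
      have "U \<subseteq> B" using openin_subset[OF op(1)] by simp
      then have "U \<inter> U' \<inter> N = U \<inter> U' \<inter> (N \<inter> B)" by blast
      moreover have "openin (subtopology (zariski UNIV) B) (N \<inter> B)"
        using N(1) by (auto simp: openin_subtopology)
      ultimately have "openin (subtopology (zariski UNIV) B) (U \<inter> U' \<inter> N)"
        using openin_Int[OF openin_Int[OF op(1,2)]] by simp
      moreover have "U \<inter> U' \<inter> N \<noteq> {}" using b N(2) by blast
      ultimately have "U \<inter> U' \<inter> N \<inter> V \<noteq> {}"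
        using irreducible_openin_subtopology_Int[OF irr _ op(3)] op(4) by blast
      then show False using N(3) agree by force
    qed
  qed
qed

text \<open>All of \<open>generate G S\<close> lies in any set that contains the unit, the
  generators and their inverses and is closed under multiplication. The argument is for an arbitrary
  record \<open>G\<close>.\<close>

lemma countable_finitely_generated:
  assumes "finitely_generated_group G" shows "countable (carrier G)"
proof -
  obtain S where S: "finite S" "generate G S = carrier G"
    using assms by (auto simp: finitely_generated_group_def)
  have "countable (insert \<one>\<^bsub>G\<^esub> (S \<union> m_inv G ` S))" using S(1) by (simp add: countable_finite)
  \<comment> \<open>The index type \<open>nat\<close> is a dummy, as there is a single
    operation.\<close>
  from countable_closed_superset[OF this, of "\<lambda>_ :: nat. monoid.mult G"] obtain R where
    R: "countable R" "insert \<one>\<^bsub>G\<^esub> (S \<union> m_inv G ` S) \<subseteq> R" "\<forall>_ :: nat. \<forall>x\<in>R. \<forall>y\<in>R. x \<otimes>\<^bsub>G\<^esub> y \<in> R"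
    by (elim exE conjE)
  have "x \<in> R" if "x \<in> generate G S" for x
    using that by induction (use R in auto)
  then have "carrier G \<subseteq> R" using S(2) by blast
  then show ?thesis using R(1) by (rule countable_subset)
qed

text \<open>Its graph is the image under \<sigma> of the graph of \<open>s\<close>.\<close>

definition conj_section ::
  "(complex \<Rightarrow> complex) \<Rightarrow> (('b::finite) proj \<Rightarrow> ('x::finite) proj) \<Rightarrow> 'b proj \<Rightarrow> 'x proj" where
  "conj_section \<sigma> s = pmap \<sigma> \<circ> s \<circ> pmap (finv \<sigma>)"

lemma conj_section_comp:
  assumes "field_aut \<sigma>" "field_aut \<tau>"
  shows "conj_section (\<sigma> \<circ> \<tau>) s = conj_section \<sigma> (conj_section \<tau> s)"
proof -
  have eq: "finv (\<sigma> \<circ> \<tau>) = finv \<tau> \<circ> finv \<sigma>"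
    using assms by (intro o_inv_distrib) (auto simp: field_aut_def)
  have inv: "field_aut (finv \<tau>)" "field_aut (finv \<sigma>)"
    using assms by (simp_all add: field_aut.field_aut_inv)
  show ?thesis
    unfolding conj_section_def eq by (rule ext) (simp only: o_apply pmap_comp[OF assms] pmap_comp[OF inv])
qed

lemma conj_section_inv:
  assumes "field_aut \<sigma>" shows "conj_section (finv \<sigma>) (conj_section \<sigma> s) = s"
  using assms by (simp add: conj_section_def fun_eq_iff field_aut.inv_inv_aut field_aut.pmap_inv_left)

section \<open>The action on a fibration and a family defined over \<open>k\<close>\<close>

locale fibration_over =
  fixes k :: "complex set" and X :: "('x::finite) proj set" and B :: "('b::finite) proj set"
    and \<pi> :: "'x proj \<Rightarrow> 'b proj"
  assumes ring_k: "ring_set k" and countable_k: "countable k"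
    and closed_X: "closedin (zariski k) X" and closed_B: "closedin (zariski k) B"
    and irreducible_B: "irreducible_subset (zariski UNIV) B"
    and morphism_\<pi>: "morphism_over k X B \<pi>"
begin

lemma pmap_image_closed:
  assumes "\<sigma> \<in> gal k" "closedin (zariski k) V" shows "pmap \<sigma> ` V = V"
  unfolding field_aut.pmap_image_eq_vimage[OF gal_field_aut[OF assms(1)]]
  using gal_closedin[OF gal_inv[OF assms(1)] ring_k assms(2)] by blast

lemma \<pi>_pmap:
  assumes \<sigma>: "\<sigma> \<in> gal k" and p: "p \<in> X"
  shows "\<pi> (pmap \<sigma> p) = pmap \<sigma> (\<pi> p)"
proof -
  interpret field_aut \<sigma> using \<sigma> by (rule gal_field_aut)
  obtain N d P where N: "openin (zariski k) N" "p \<in> N" and P: "\<forall>j. form_fun k d (P j)"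
    "\<forall>x\<in>X \<inter> N. (\<chi> j. P j (rep_proj x)) \<noteq> 0 \<and> \<pi> x = abs_proj (\<chi> j. P j (rep_proj x))"
    using morphism_\<pi> p unfolding morphism_over_alt by blast
  \<comment> \<open>The neighbourhood is open over \<open>k\<close>, so it contains the conjugate of
    \<open>p\<close> as well, and the same forms compute \<pi> at both points.\<close>
  have "locally_closed k N"
    using N(1) ring_k unfolding locally_closed_def
    by (intro exI[of _ UNIV] exI[of _ N]) (auto simp: closedin_def)
  then have x: "pmap \<sigma> p \<in> X \<inter> N"
    using gal_locally_closed[OF \<sigma> ring_k] gal_closedin[OF \<sigma> ring_k closed_X] p N(2) by blast
  let ?v = "\<chi> j. P j (rep_proj p)" and ?w = "\<chi> j. P j (rep_proj (pmap \<sigma> p))"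
  obtain c where c: "c \<noteq> 0" "rep_proj (pmap \<sigma> p) = c *s vmap \<sigma> (rep_proj p)" by (rule rep_pmap)
  have "P j (c *s vmap \<sigma> v) = c ^ d * \<sigma> (P j v)" for j v
    using form_fun_homogeneous[OF P(1)[rule_format]] gal_form[OF \<sigma> P(1)[rule_format]] by simp
  then have w: "?w = c ^ d *s vmap \<sigma> ?v" by (simp add: vec_eq_iff c(2))
  have v: "?v \<noteq> 0" using P(2) p N(2) by blast
  have "\<pi> (pmap \<sigma> p) = abs_proj (c ^ d *s vmap \<sigma> ?v)" using P(2) x w by simp
  also have "\<dots> = abs_proj (vmap \<sigma> ?v)"
    using v c(1) by (subst eq_commute, subst abs_proj_eq_iff) (auto simp: vector_mul_eq_0)
  also have "\<dots> = pmap \<sigma> (abs_proj ?v)" using v by (simp add: pmap_abs_proj)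
  also have "abs_proj ?v = \<pi> p" using P(2) p N(2) by simp
  finally show ?thesis .
qed

text \<open>Together with \<open>elliptic_curve_pmap\<close> this shows that the conjugate of a
  point with elliptic fiber again has an elliptic fiber.\<close>

lemma fiber_pmap:
  assumes "\<sigma> \<in> gal k" shows "pmap \<sigma> ` fiber X \<pi> b = fiber X \<pi> (pmap \<sigma> b)"
proof -
  interpret field_aut \<sigma> using assms by (rule gal_field_aut)
  have X: "pmap (finv \<sigma>) q \<in> X \<longleftrightarrow> q \<in> X" for q
    using gal_closedin[OF gal_inv[OF assms] ring_k closed_X] .
  have "\<pi> (pmap (finv \<sigma>) q) = b \<longleftrightarrow> \<pi> q = pmap \<sigma> b" if "q \<in> X" for q
  proof -
    have "\<pi> (pmap (finv \<sigma>) q) = pmap (finv \<sigma>) (\<pi> q)" by (rule \<pi>_pmap[OF gal_inv[OF assms] that])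
    then show ?thesis by (metis pmap_inv_left pmap_inv_right)
  qed
  then show ?thesis unfolding pmap_image_eq_vimage by (auto simp: fiber_def X)
qed

lemma conj_local_sections:
  assumes \<sigma>: "\<sigma> \<in> gal k" and s: "(U, s) \<in> local_sections X B \<pi>"
  shows "(pmap \<sigma> ` U, conj_section \<sigma> s) \<in> local_sections X B \<pi>"
proof -
  interpret field_aut \<sigma> using \<sigma> by (rule gal_field_aut)
  have U: "openin (subtopology (zariski UNIV) B) U" "U \<noteq> {}" and mor: "morphism_over UNIV U X s"
    and sec: "\<forall>b\<in>U. \<pi> (s b) = b" using s by (auto simp: local_sections_def)
  have "openin (subtopology (zariski UNIV) B) (pmap \<sigma> ` U)"
    using openin_subtopology_pmap_image[OF U(1)] pmap_image_closed[OF \<sigma> closed_B] by simp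
  moreover have "morphism_over UNIV (pmap \<sigma> ` U) X (conj_section \<sigma> s)"
    using morphism_over_conj[OF mor] pmap_image_closed[OF \<sigma> closed_X] by (simp add: conj_section_def)
  moreover have "\<pi> (pmap \<sigma> (s b)) = pmap \<sigma> b" if "b \<in> U" for b
    using \<pi>_pmap[OF \<sigma>, of "s b"] mor sec that by (auto simp: morphism_over_def)
  ultimately show ?thesis using U(2) by (auto simp: local_sections_def conj_section_def)
qed

lemma conj_section_rel:
  assumes \<sigma>: "\<sigma> \<in> gal k" and "((U, s), (V, r)) \<in> section_rel X B \<pi>"
  shows "((pmap \<sigma> ` U, conj_section \<sigma> s), (pmap \<sigma> ` V, conj_section \<sigma> r)) \<in> section_rel X B \<pi>"
proof -
  interpret field_aut \<sigma> using \<sigma> by (rule gal_field_aut)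
  show ?thesis using assms(2) conj_local_sections[OF \<sigma>]
    by (auto simp: section_rel_def conj_section_def mem_pmap_image)
qed

end

locale family_over = fibration_over k X B \<pi>
  for k and X :: "('x::finite) proj set" and B :: "('b::finite) proj set" and \<pi> +
  fixes T :: "('t::finite) proj set" and \<C> :: "('b proj \<times> 't proj) set"
  assumes nonempty_T: "T \<noteq> {}" and locally_closed_T: "locally_closed k T"
    and family: "covering_family B T \<C>"
    and closed_family: "closedin (subtopology (zariski k) (segre_image (B \<times> T))) (segre_image \<C>)"
    and countable_sections: "countable (rational_sections X B \<pi>)"
begin

lemma pmap_family:
  assumes \<sigma>: "\<sigma> \<in> gal k" and bt: "(b, t) \<in> \<C>"
  shows "(pmap \<sigma> b, pmap \<sigma> t) \<in> \<C>"
proof -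
  obtain K where K: "closedin (zariski k) K" "segre_image \<C> = K \<inter> segre_image (B \<times> T)"
    using closed_family unfolding closedin_subtopology by blast
  have "b \<in> B" "t \<in> T" using bt family by (auto simp: covering_family_def)
  then have "pmap \<sigma> b \<in> B" "pmap \<sigma> t \<in> T"
    using gal_closedin[OF \<sigma> ring_k closed_B] gal_locally_closed[OF \<sigma> ring_k locally_closed_T] by auto
  then have "segre (pmap \<sigma> b) (pmap \<sigma> t) \<in> segre_image (B \<times> T)" by (auto simp: segre_image_def)
  moreover have "segre b t \<in> K" using K(2) bt by (auto simp: segre_image_def)
  then have "segre (pmap \<sigma> b) (pmap \<sigma> t) \<in> K"
    using gal_closedin[OF \<sigma> ring_k K(1)] field_aut.segre_pmap[OF gal_field_aut[OF \<sigma>]] by metis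
  ultimately have "segre (pmap \<sigma> b) (pmap \<sigma> t) \<in> segre_image \<C>" using K(2) by blast
  then show ?thesis by (auto simp: segre_image_def segre_inject)
qed

text \<open>Countably many automorphisms represent all conjugates of the two sections; a generic point of the
  family lies over the corresponding conjugates of \<open>W\<close>.\<close>

theorem conjugate_meets_member:
  assumes t: "very_general k T t"
    and s: "(U, s) \<in> local_sections X B \<pi>" and s': "(U', s') \<in> local_sections X B \<pi>"
    and W: "openin (subtopology (zariski UNIV) B) W" "W \<noteq> {}"
  shows "\<exists>\<sigma>\<in>gal k. \<exists>b\<in>family_member \<C> t. b \<in> pmap \<sigma> ` W \<and>
    ((U, s), (pmap \<sigma> ` U, conj_section \<sigma> s)) \<in> section_rel X B \<pi> \<and>
    ((U', s'), (pmap \<sigma> ` U', conj_section \<sigma> s')) \<in> section_rel X B \<pi>"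
proof -
  \<comment> \<open>The effect of \<open>g\<close> is recorded by the classes of both conjugate
    sections at once, because a single automorphism has to serve for both.\<close>
  define cls where "cls g = (section_rel X B \<pi> `` {(pmap g ` U, conj_section g s)},
    section_rel X B \<pi> `` {(pmap g ` U', conj_section g s')})" for g
  have "cls ` gal k \<subseteq> rational_sections X B \<pi> \<times> rational_sections X B \<pi>"
    using conj_local_sections[OF _ s] conj_local_sections[OF _ s']
    by (auto simp: cls_def rational_sections_def intro!: quotientI)
  then have "countable (cls ` gal k)"
    by (rule countable_subset) (intro countable_SIGMA countable_sections)
  \<comment> \<open>One automorphism is chosen for each pair of classes that occurs.\<close>
  define G where "G = inv_into (gal k) cls ` cls ` gal k"
  have G: "countable G" "G \<subseteq> gal k"
    using \<open>countable (cls ` gal k)\<close> unfolding G_def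
    by (rule countable_image, intro image_subsetI inv_into_into)
  have repr: "\<exists>h\<in>G. cls h = cls g" if "g \<in> gal k" for g
    unfolding G_def using that by (auto simp: f_inv_into_f)
  \<comment> \<open>Genericity of a point is expressed by forms, so each conjugate of
    \<open>W\<close> is replaced by the nonvanishing locus in \<open>B\<close> of one form inside
    it.\<close>
  have "\<exists>F d. form_fun UNIV d F \<and> (\<exists>b\<in>B. F (rep_proj b) \<noteq> 0) \<and> (\<forall>b\<in>B. F (rep_proj b) \<noteq> 0 \<longrightarrow> b \<in> pmap g ` W)"
    if "g \<in> G" for g
  proof -
    have g: "g \<in> gal k" using that G(2) by blast
    have "openin (subtopology (zariski UNIV) B) (pmap g ` W)"
      using field_aut.openin_subtopology_pmap_image[OF gal_field_aut[OF g] W(1)]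
        pmap_image_closed[OF g closed_B] by simp
    then obtain O' where O': "openin (zariski UNIV) O'" "pmap g ` W = O' \<inter> B"
      by (auto simp: openin_subtopology)
    then obtain b where b: "b \<in> B" "b \<in> O'" using W(2) by blast
    from bspec[OF O'(1)[unfolded openin_zariski_iff[OF ring_set_UNIV]] b(2)] obtain F d where
      "form_fun UNIV d F" "F (rep_proj b) \<noteq> 0" "\<forall>q. F (rep_proj q) \<noteq> 0 \<longrightarrow> q \<in> O'"
      by (elim exE conjE)
    then show ?thesis using b(1) O'(2) by (intro exI[of _ F] exI[of _ d]) auto
  qed
  then obtain F where F: "\<And>g. g \<in> G \<Longrightarrow> \<exists>d. form_fun UNIV d (F g)"
    "\<And>g. g \<in> G \<Longrightarrow> \<exists>b\<in>B. F g (rep_proj b) \<noteq> 0"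
    "\<And>g b. g \<in> G \<Longrightarrow> b \<in> B \<Longrightarrow> F g (rep_proj b) \<noteq> 0 \<Longrightarrow> b \<in> pmap g ` W"
    by metis
  obtain b t' where bt': "(b, t') \<in> \<C>" "\<And>f. f \<in> F ` G \<Longrightarrow> f (rep_proj b) \<noteq> 0" "very_general k T t'"
    by (rule generic_point_of_family[OF countable_k ring_k closed_B locally_closed_T nonempty_T family closed_family, of "F ` G"])
      (use G(1) F in auto)
  obtain g where g: "g \<in> gal k" "pmap g t = t'"
    using gal_transitive_on_very_general[OF ring_k countable_k t bt'(3)] by blast
  obtain h where h: "h \<in> G" "cls h = cls g" using repr[OF g(1)] by blast
  then have hk: "h \<in> gal k" using G(2) by blast
  define \<sigma> where "\<sigma> = finv g \<circ> h"
  have \<sigma>: "\<sigma> \<in> gal k" unfolding \<sigma>_def by (intro gal_comp gal_inv g hk)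
  note aut = gal_field_aut[OF g(1)] gal_field_aut[OF gal_inv[OF g(1)]] gal_field_aut[OF hk]
  have pmap_\<sigma>: "pmap \<sigma> p = pmap (finv g) (pmap h p)" for p :: "'z::finite proj"
    unfolding \<sigma>_def by (rule pmap_comp[OF aut(2,3)])
  have "b \<in> B" using bt'(1) family by (auto simp: covering_family_def)
  then have "b \<in> pmap h ` W" using F(3)[OF h(1)] bt'(2) h(1) by blast
  then have "pmap (finv g) b \<in> pmap \<sigma> ` W" by (auto simp: pmap_\<sigma>)
  moreover have "pmap (finv g) b \<in> family_member \<C> t"
    using pmap_family[OF gal_inv[OF g(1)] bt'(1)] g(2) field_aut.pmap_inv_left[OF aut(1), of t]
    by (auto simp: family_member_def)
  moreover have "((V, r), (pmap \<sigma> ` V, conj_section \<sigma> r)) \<in> section_rel X B \<pi>"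
    if r: "(V, r) \<in> local_sections X B \<pi>" and eq: "section_rel X B \<pi> `` {(pmap g ` V, conj_section g r)} =
      section_rel X B \<pi> `` {(pmap h ` V, conj_section h r)}" for V r
  proof -
    have "((pmap g ` V, conj_section g r), (pmap h ` V, conj_section h r)) \<in> section_rel X B \<pi>"
      by (rule eq_equiv_class[OF eq equiv_section_rel[OF irreducible_B] conj_local_sections[OF hk r]])
    from conj_section_rel[OF gal_inv[OF g(1)] this] show ?thesis
      unfolding \<sigma>_def conj_section_comp[OF aut(2,3)] conj_section_inv[OF aut(1)] image_image
        field_aut.pmap_inv_left[OF aut(1)] pmap_comp[OF aut(2,3)] by simp
  qed
  ultimately show ?thesis using s s' h(2)
    by (intro bexI[OF _ \<sigma>] bexI[of _ "pmap (finv g) b"] conjI) (simp_all add: cls_def)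
qed

end

section \<open>Restriction of sections\<close>

text \<open>Representatives of one rational section agree wherever both are defined, so all their
  restrictions lie in a single class over \<open>C\<close>, and the union in
  \<open>restrict_section\<close> is this class.\<close>

lemma restrict_section_eq:
  assumes C: "irreducible_subset (zariski UNIV) C" and sub: "C \<subseteq> B"
    and irr: "irreducible_subset (zariski UNIV) B"
    and x: "x \<in> rational_sections X B \<pi>" and V: "(V, r) \<in> x" "V \<inter> C \<noteq> {}"
  defines "Z \<equiv> {p \<in> X. \<pi> p \<in> C}"
  shows "(V \<inter> C, r) \<in> local_sections Z C \<pi>"
    and "restrict_section Z C \<pi> x = section_rel Z C \<pi> `` {(V \<inter> C, r)}"
proof -
  obtain a where x_eq: "x = section_rel X B \<pi> `` {a}"
    using x by (auto simp: rational_sections_def elim: quotientE)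
  have equiv: "equiv (local_sections X B \<pi>) (section_rel X B \<pi>)" using irr by (rule equiv_section_rel)
  have rel: "(b, c) \<in> section_rel X B \<pi>" if "b \<in> x" "c \<in> x" for b c
    using that equiv unfolding x_eq equiv_def by (auto dest: symD transD)
  have loc: "(V' \<inter> C, r') \<in> local_sections Z C \<pi>" if V': "(V', r') \<in> x" "V' \<inter> C \<noteq> {}" for V' r'
  proof -
    have s: "(V', r') \<in> local_sections X B \<pi>" using rel[OF V'(1) V'(1)] by (auto simp: section_rel_def)
    then have mor: "morphism_over UNIV V' X r'" and sec: "\<forall>b\<in>V'. \<pi> (r' b) = b"
      by (auto simp: local_sections_def)
    obtain W where "openin (zariski UNIV) W" "V' = W \<inter> B"
      using s by (auto simp: local_sections_def openin_subtopology)
    then have "openin (subtopology (zariski UNIV) C) (V' \<inter> C)"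
      using sub unfolding openin_subtopology by (intro exI[of _ W]) auto
    moreover have "r' ` V' \<subseteq> X" using mor by (simp add: morphism_over_def)
    then have "morphism_over UNIV (V' \<inter> C) Z r'"
      using sec by (intro morphism_over_subset[OF mor]) (auto simp: Z_def)
    ultimately show ?thesis using sec V'(2) by (auto simp: local_sections_def)
  qed
  then show "(V \<inter> C, r) \<in> local_sections Z C \<pi>" using V by blast
  have "section_rel Z C \<pi> `` {(V' \<inter> C, r')} = section_rel Z C \<pi> `` {(V \<inter> C, r)}"
    if V': "(V', r') \<in> x" "V' \<inter> C \<noteq> {}" for V' r'
  proof (rule equiv_class_eq[OF equiv_section_rel[OF C]])
    show "((V' \<inter> C, r'), (V \<inter> C, r)) \<in> section_rel Z C \<pi>"
      using rel[OF V'(1) V(1)] loc[OF V'] loc[OF V] by (auto simp: section_rel_def)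
  qed
  then show "restrict_section Z C \<pi> x = section_rel Z C \<pi> `` {(V \<inter> C, r)}"
    unfolding restrict_section_def using V by fastforce
qed

lemma mem_rational_section:
  assumes "x \<in> rational_sections X B \<pi>"
  obtains U s where "(U, s) \<in> local_sections X B \<pi>" "x = section_rel X B \<pi> `` {(U, s)}"
  using assms by (auto simp: rational_sections_def elim!: quotientE)

theorem theorem5p1:
  fixes X :: "('x::finite) proj set" and B :: "('b::finite) proj set"
    and T :: "('t::finite) proj set"
    and \<pi> :: "'x proj \<Rightarrow> 'b proj" and \<omega> :: "('x, 'b) ratsec"
    and \<C> :: "('b proj \<times> 't proj) set" and k :: "complex set"
  assumes "projective_variety X" and "normal_variety X"
    and "projective_variety B" and "normal_variety B"
    and "elliptic_fibration X B \<pi>"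
    and "\<omega> \<in> rational_sections X B \<pi>"
    and "locally_closed UNIV T" and "irreducible_subset (zariski UNIV) T"
    and "covering_family B T \<C>"
    and "finitely_generated_group (MW X B \<pi> \<omega>)"
    and "countable k" and "algebraically_closed_subfield k"
    and "closedin (zariski k) X" and "closedin (zariski k) B" and "locally_closed k T"
    and "morphism_over k X B \<pi>"
    and "closedin (subtopology (zariski k) (segre_image (B \<times> T))) (segre_image \<C>)"
  shows "\<forall>t. very_general k T t \<longrightarrow>
    (let C = family_member \<C> t;
         Z = {x \<in> X. \<pi> x \<in> C};
         G = MW X B \<pi> \<omega>;
         H = MW Z C \<pi> (restrict_section Z C \<pi> \<omega>)
     in elliptic_fibration Z C \<pi> \<and>
        restrict_section Z C \<pi> \<in> carrier G \<rightarrow> carrier H \<and>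
        inj_on (restrict_section Z C \<pi>) (carrier G))"
proof (intro allI impI)
  fix t assume t: "very_general k T t"
  define C where "C = family_member \<C> t"
  define Z where "Z = {p \<in> X. \<pi> p \<in> C}"
  have "ring_set k"
    using assms(12) unfolding algebraically_closed_subfield_def ring_set_def
    by (metis diff_conv_add_uminus)
  moreover have irr: "irreducible_subset (zariski UNIV) B"
    using assms(3) by (simp add: projective_variety_def)
  moreover have "countable (rational_sections X B \<pi>)"
    using countable_finitely_generated[OF assms(10)] by (simp add: MW_def)
  moreover have "T \<noteq> {}" using assms(8) by (simp add: irreducible_subset_def)
  ultimately interpret family_over k X B \<pi> T \<C>
    using assms by unfold_locales
  have "t \<in> T" using t by (simp add: very_general_def)
  then have "irreducible_curve C" and C_sub: "C \<subseteq> B"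
    using assms(9) by (auto simp: covering_family_def C_def family_member_def)
  then have irr_C: "irreducible_subset (zariski UNIV) C"
    by (simp add: irreducible_curve_def projective_variety_def)
  note meets = conjugate_meets_member[OF t, folded C_def]
  note restrict = restrict_section_eq[OF irr_C C_sub irr, where X = X and \<pi> = \<pi>, folded Z_def]

  \<comment> \<open>The given open set of elliptic fibers may miss \<open>C\<close>; some conjugate
    of it meets \<open>C\<close> and has elliptic fibers too.\<close>
  have "elliptic_fibration Z C \<pi>"
  proof -
    obtain U where U: "openin (subtopology (zariski UNIV) B) U" "B \<subseteq> zariski UNIV closure_of U"
      "\<forall>b\<in>U. elliptic_curve (fiber X \<pi> b)"
      using assms(5) by (auto simp: elliptic_fibration_def)
    have "U \<noteq> {}" using U(2) irr by (auto simp: irreducible_subset_def)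
    \<comment> \<open>The result on conjugates speaks of two sections; a representative of
      \<open>\<omega>\<close> fills both places.\<close>
    moreover obtain V z where "(V, z) \<in> local_sections X B \<pi>"
      using mem_rational_section[OF assms(6)] by metis
    ultimately obtain \<sigma> b where \<sigma>: "\<sigma> \<in> gal k" and b: "b \<in> C" "b \<in> pmap \<sigma> ` U"
      using meets U(1) by blast
    have "openin (subtopology (zariski UNIV) B) (pmap \<sigma> ` U)"
      using field_aut.openin_subtopology_pmap_image[OF gal_field_aut[OF \<sigma>] U(1)]
        pmap_image_closed[OF \<sigma> closed_B] by simp
    then obtain W where "openin (zariski UNIV) W" "pmap \<sigma> ` U = W \<inter> B"
      by (auto simp: openin_subtopology)
    then have "openin (subtopology (zariski UNIV) C) (pmap \<sigma> ` U \<inter> C)"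
      using C_sub unfolding openin_subtopology by (intro exI[of _ W]) auto
    moreover from this have "C \<subseteq> zariski UNIV closure_of (pmap \<sigma> ` U \<inter> C)"
      using b by (intro irreducible_subset_closure[OF irr_C]) auto
    moreover have "elliptic_curve (fiber Z \<pi> c)" if c: "c \<in> pmap \<sigma> ` U \<inter> C" for c
    proof -
      obtain u where u: "u \<in> U" "c = pmap \<sigma> u" using c by blast
      have "fiber Z \<pi> c = fiber X \<pi> c" using c by (auto simp: fiber_def Z_def)
      also have "\<dots> = pmap \<sigma> ` fiber X \<pi> u" using fiber_pmap[OF \<sigma>] u(2) by simp
      finally show ?thesis
        using field_aut.elliptic_curve_pmap[OF gal_field_aut[OF \<sigma>] bspec[OF U(3) u(1)]] by simp
    qed
    moreover have "morphism_over UNIV Z C \<pi>"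
    proof (rule morphism_over_subset)
      show "morphism_over UNIV X B \<pi>" using assms(5) by (simp add: elliptic_fibration_def)
    qed (auto simp: Z_def)
    ultimately show ?thesis unfolding elliptic_fibration_def by blast
  qed
  \<comment> \<open>With the domain of the section itself as \<open>W\<close>, a conjugate
    representative of \<open>x\<close> is found whose domain meets \<open>C\<close>.\<close>
  moreover have "restrict_section Z C \<pi> x \<in> rational_sections Z C \<pi>"
    if x: "x \<in> rational_sections X B \<pi>" for x
  proof -
    obtain U s where s: "(U, s) \<in> local_sections X B \<pi>" "x = section_rel X B \<pi> `` {(U, s)}"
      using mem_rational_section[OF x] .
    then have "openin (subtopology (zariski UNIV) B) U" "U \<noteq> {}" by (auto simp: local_sections_def)
    from meets[OF s(1) s(1) this] obtain \<sigma> b where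
      "b \<in> C" "b \<in> pmap \<sigma> ` U" "(pmap \<sigma> ` U, conj_section \<sigma> s) \<in> x"
      using s(2) by blast
    then have "(pmap \<sigma> ` U, conj_section \<sigma> s) \<in> x" "pmap \<sigma> ` U \<inter> C \<noteq> {}" by auto
    from restrict[OF x this] show ?thesis by (simp add: rational_sections_def quotientI)
  qed
  moreover have "x = y" if x: "x \<in> rational_sections X B \<pi>" and y: "y \<in> rational_sections X B \<pi>"
    and eq: "restrict_section Z C \<pi> x = restrict_section Z C \<pi> y" for x y
  proof (rule ccontr)
    assume "x \<noteq> y"
    obtain U s where s: "(U, s) \<in> local_sections X B \<pi>" "x = section_rel X B \<pi> `` {(U, s)}"
      using mem_rational_section[OF x] .
    obtain U' s' where s': "(U', s') \<in> local_sections X B \<pi>" "y = section_rel X B \<pi> `` {(U', s')}"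
      using mem_rational_section[OF y] .
    \<comment> \<open>Conjugation carries this locus to the one where the conjugate sections differ.
      As these represent \<open>x\<close> and \<open>y\<close> again, it suffices that a conjugate
      of \<open>W\<close> meets \<open>C\<close>.\<close>
    define W where "W = {b \<in> U \<inter> U'. s b \<noteq> s' b}"
    have "((U, s), (U', s')) \<notin> section_rel X B \<pi>"
      using \<open>x \<noteq> y\<close> s(2) s'(2) equiv_class_eq[OF equiv_section_rel[OF irr]] by blast
    then have W_ne: "W \<noteq> {}" using s(1) s'(1) by (auto simp: section_rel_def W_def)
    have op: "openin (subtopology (zariski UNIV) B) U" "openin (subtopology (zariski UNIV) B) U'"
      and mor: "morphism_over UNIV U X s" "morphism_over UNIV U' X s'"
      using s(1) s'(1) by (auto simp: local_sections_def)
    have W: "openin (subtopology (zariski UNIV) B) W"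
    proof (subst openin_subopen, intro ballI)
      fix b assume b: "b \<in> W"
      then obtain N where N: "openin (zariski UNIV) N" "b \<in> N"
        "\<And>c. c \<in> U \<Longrightarrow> c \<in> U' \<Longrightarrow> c \<in> N \<Longrightarrow> s c \<noteq> s' c"
        using morphisms_differ_open[OF mor, of b] unfolding W_def by blast
      have "openin (subtopology (zariski UNIV) B) (U \<inter> U' \<inter> (N \<inter> B))"
        using openin_Int[OF openin_Int[OF op] openin_subtopology_Int[OF N(1)]] .
      moreover have "b \<in> B" using b openin_subset[OF op(1)] by (auto simp: W_def)
      ultimately show "\<exists>V. openin (subtopology (zariski UNIV) B) V \<and> b \<in> V \<and> V \<subseteq> W"
        using b N(2,3) by (intro exI[of _ "U \<inter> U' \<inter> (N \<inter> B)"]) (auto simp: W_def)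
    qed
    from meets[OF s(1) s'(1) W W_ne] obtain \<sigma> b where \<sigma>: "\<sigma> \<in> gal k" and b: "b \<in> C" "b \<in> pmap \<sigma> ` W"
      and r: "(pmap \<sigma> ` U, conj_section \<sigma> s) \<in> x" "(pmap \<sigma> ` U', conj_section \<sigma> s') \<in> y"
      using s(2) s'(2) by blast
    interpret field_aut \<sigma> using \<sigma> by (rule gal_field_aut)
    have bU: "b \<in> pmap \<sigma> ` U \<inter> C" "b \<in> pmap \<sigma> ` U' \<inter> C" using b by (auto simp: W_def)
    note rx = restrict[OF x r(1)] and ry = restrict[OF y r(2)]
    have "((pmap \<sigma> ` U \<inter> C, conj_section \<sigma> s), (pmap \<sigma> ` U' \<inter> C, conj_section \<sigma> s')) \<in> section_rel Z C \<pi>"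
      using eq rx ry bU by (intro eq_equiv_class[OF _ equiv_section_rel[OF irr_C]]) auto
    \<comment> \<open>Moved back by the inverse automorphism, equality at \<open>b\<close> becomes
      equality of \<open>s\<close> and \<open>s'\<close> at a point of \<open>W\<close>.\<close>
    then have "conj_section \<sigma> s b = conj_section \<sigma> s' b" using bU by (auto simp: section_rel_def)
    moreover have "pmap (finv \<sigma>) b \<in> W" using b(2) by (simp add: mem_pmap_image)
    ultimately show False by (simp add: conj_section_def W_def)
  qed
  ultimately show "let C = family_member \<C> t; Z = {x \<in> X. \<pi> x \<in> C}; G = MW X B \<pi> \<omega>;
      H = MW Z C \<pi> (restrict_section Z C \<pi> \<omega>)
    in elliptic_fibration Z C \<pi> \<and> restrict_section Z C \<pi> \<in> carrier G \<rightarrow> carrier H \<and>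
      inj_on (restrict_section Z C \<pi>) (carrier G)"
    unfolding Let_def C_def[symmetric] Z_def[symmetric] by (auto simp: MW_def intro!: inj_onI)
qed

end
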